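(* Let $M$ be a smooth manifold of dimension $n$, let $m\in M$, and let $\omega$ be a smooth integrable 1-form defined near $m$ which vanishes at $m$ and has non-zero linear part at $m$. Then, up to multiplication by a non-vanishing function, $\omega$ is, formally at $m$, the pull-back of an (integrable) 1-form depending only on 2 variables. That is: in local coordinates of $M$ centered at $m$, there exist a formal power series $u\in\mathbb R[[x_1,\dots,x_n]]$ with $u(0)\neq 0$, a formal map $\phi=(\phi_1,\phi_2)$ with $\phi_1,\phi_2\in\mathbb R[[x_1,\dots,x_n]]$ and $\phi_1(0)=\phi_2(0)=0$, and a formal 1-form $\omega_2=P(s,t)\,ds+Q(s,t)\,dt$ with $P,Q\in\mathbb R[[s,t]]$, such that the Taylor expansion $\hat\omega$ of $\omega$ at $m$ satisfies $$u\,\hat\omega=\phi^*\omega_2 .$$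
   Context: A 1-form $\omega$ is called integrable if $\omega\wedge d\omega=0$ (every 1-form in two variables is integrable). If $\omega=\sum_i a_i\,dx_i$ vanishes at $m$, its linear part at $m$ (in coordinates centered at $m$) is $\sum_i a_i^{(1)}dx_i$, where $a_i^{(1)}$ is the degree-one homogeneous part of the Taylor expansion of $a_i$ at $m$; whether it is non-zero does not depend on the coordinates. "Formally" means at the level of Taylor expansions (formal power series) at $m$. *)

theory Defs
  imports "HOL-Analysis.Analysis" "HOL-Library.Multiset"
begin

section \<open>Formal power series in finitely many variables\<close>

text \<open>
  \<open>('n, 'a) mfps\<close> is the ring \<open>'a[[x\<^sub>i | i :: 'n]]\<close>.  Monomials are multisets of variables:
  \<open>\<mu>\<close> stands for the product of the \<open>x\<^sub>i\<close>, with \<open>i\<close> taken \<open>count \<mu> i\<close> times, so \<open>{#}\<close> is the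
  monomial 1, \<open>\<mu> + \<nu>\<close> is the product of monomials and \<open>size \<mu>\<close> is the degree.
\<close>

typedef ('n, 'a) mfps = "UNIV :: ('n multiset \<Rightarrow> 'a) set"
  morphisms mfps_coeff Abs_mfps by simp

lemma mfps_coeff_Abs [simp]: "mfps_coeff (Abs_mfps f) = f"
  by (simp add: Abs_mfps_inverse)

lemma mfps_eqI: "(\<And>\<mu>. mfps_coeff f \<mu> = mfps_coeff g \<mu>) \<Longrightarrow> f = g"
  by (metis ext mfps_coeff_inject)

lemma finite_submultisets: "finite {\<nu>. \<nu> \<subseteq># (\<mu> :: 'n multiset)}"
proof (rule finite_subset)
  show "{\<nu>. \<nu> \<subseteq># \<mu>} \<subseteq> (\<Union>k\<le>size \<mu>. multisets_of_size (set_mset \<mu>) k)"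
    by (auto simp: multisets_of_size_def size_mset_mono dest: mset_subset_eqD)
qed (auto intro!: finite_multisets_of_size)

instantiation mfps :: (type, comm_ring_1) comm_ring_1
begin

definition zero_mfps :: "('a, 'b) mfps" where "0 = Abs_mfps (\<lambda>_. 0)"
definition one_mfps :: "('a, 'b) mfps" where "1 = Abs_mfps (\<lambda>\<mu>. if \<mu> = {#} then 1 else 0)"
definition plus_mfps :: "('a, 'b) mfps \<Rightarrow> ('a, 'b) mfps \<Rightarrow> ('a, 'b) mfps"
  where "f + g = Abs_mfps (\<lambda>\<mu>. mfps_coeff f \<mu> + mfps_coeff g \<mu>)"
definition uminus_mfps :: "('a, 'b) mfps \<Rightarrow> ('a, 'b) mfps"
  where "- f = Abs_mfps (\<lambda>\<mu>. - mfps_coeff f \<mu>)"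
definition minus_mfps :: "('a, 'b) mfps \<Rightarrow> ('a, 'b) mfps \<Rightarrow> ('a, 'b) mfps"
  where "f - g = Abs_mfps (\<lambda>\<mu>. mfps_coeff f \<mu> - mfps_coeff g \<mu>)"
definition times_mfps :: "('a, 'b) mfps \<Rightarrow> ('a, 'b) mfps \<Rightarrow> ('a, 'b) mfps"
  where "f * g = Abs_mfps (\<lambda>\<mu>. \<Sum>\<nu> | \<nu> \<subseteq># \<mu>. mfps_coeff f \<nu> * mfps_coeff g (\<mu> - \<nu>))"

instance
proof
  fix f g h :: "('a, 'b) mfps"
  show "f * g * h = f * (g * h)"
  proof (rule mfps_eqI)
    fix \<mu> :: "'a multiset"
    let ?S = "\<lambda>\<mu>. {\<nu> :: 'a multiset. \<nu> \<subseteq># \<mu>}"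
    have "mfps_coeff (f * g * h) \<mu> = (\<Sum>(\<nu>, \<kappa>)\<in>Sigma (?S \<mu>) ?S.
        mfps_coeff f \<kappa> * mfps_coeff g (\<nu> - \<kappa>) * mfps_coeff h (\<mu> - \<nu>))"
      by (simp add: times_mfps_def sum_distrib_right sum.Sigma finite_submultisets)
    also have "\<dots> = (\<Sum>(\<kappa>, \<rho>)\<in>Sigma (?S \<mu>) (\<lambda>\<kappa>. ?S (\<mu> - \<kappa>)).
        mfps_coeff f \<kappa> * (mfps_coeff g \<rho> * mfps_coeff h (\<mu> - \<kappa> - \<rho>)))"
      by (rule sum.reindex_bij_witness[of _ "\<lambda>(\<kappa>, \<rho>). (\<kappa> + \<rho>, \<kappa>)" "\<lambda>(\<nu>, \<kappa>). (\<kappa>, \<nu> - \<kappa>)"])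
        (auto simp: mult.assoc add.commute multiset_eq_iff subseteq_mset_def diff_le_mono le_diff_conv2
          intro: order_trans add_leD1 intro!: arg_cong[where f = "mfps_coeff h"])
    also have "\<dots> = mfps_coeff (f * (g * h)) \<mu>"
      by (simp add: times_mfps_def sum_distrib_left sum.Sigma finite_submultisets)
    finally show "mfps_coeff (f * g * h) \<mu> = mfps_coeff (f * (g * h)) \<mu>" .
  qed
  show "f * g = g * f"
  proof (rule mfps_eqI)
    fix \<mu> :: "'a multiset"
    show "mfps_coeff (f * g) \<mu> = mfps_coeff (g * f) \<mu>"
      unfolding times_mfps_def mfps_coeff_Abs
      by (rule sum.reindex_bij_witness[of _ "\<lambda>\<nu>. \<mu> - \<nu>" "\<lambda>\<nu>. \<mu> - \<nu>"])
        (auto simp: mult.commute subset_mset.diff_diff_right)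
  qed
  show "1 * f = f"
  proof (rule mfps_eqI)
    fix \<mu> :: "'a multiset"
    have "(\<Sum>\<nu> | \<nu> \<subseteq># \<mu>. (if \<nu> = {#} then 1 else 0) * mfps_coeff f (\<mu> - \<nu>)) =
        (\<Sum>\<nu> | \<nu> \<subseteq># \<mu>. if {#} = \<nu> then mfps_coeff f (\<mu> - \<nu>) else 0)"
      by (intro sum.cong) auto
    then show "mfps_coeff (1 * f) \<mu> = mfps_coeff f \<mu>"
      by (simp add: times_mfps_def one_mfps_def sum.delta' finite_submultisets)
  qed
  show "(f + g) * h = f * h + g * h"
    by (simp add: times_mfps_def plus_mfps_def ring_distribs sum.distrib)
  have "mfps_coeff (0 :: ('a, 'b) mfps) {#} \<noteq> mfps_coeff 1 {#}"
    by (simp add: zero_mfps_def one_mfps_def)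
  then show "(0 :: ('a, 'b) mfps) \<noteq> 1" by auto
qed (auto simp: zero_mfps_def plus_mfps_def uminus_mfps_def minus_mfps_def ac_simps
      intro!: mfps_eqI)

end

definition mfps_deriv :: "'n \<Rightarrow> ('n, 'a::comm_ring_1) mfps \<Rightarrow> ('n, 'a) mfps"
  where "mfps_deriv i f =
    Abs_mfps (\<lambda>\<mu>. of_nat (Suc (count \<mu> i)) * mfps_coeff f (add_mset i \<mu>))"

definition mfps_hom_part :: "nat \<Rightarrow> ('n, 'a::comm_ring_1) mfps \<Rightarrow> ('n, 'a) mfps"
  where "mfps_hom_part d f = Abs_mfps (\<lambda>\<mu>. if size \<mu> = d then mfps_coeff f \<mu> else 0)"

text \<open>
  \<open>mfps_subst \<phi> P\<close> is the series \<open>P(\<phi>\<^sub>1, \<phi>\<^sub>2, \<dots>)\<close>.  It is only meaningful when every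
  \<open>\<phi>\<^sub>k\<close> has zero constant term: then a monomial of degree \<open>d\<close> in the \<open>\<phi>\<^sub>k\<close> has order at
  least \<open>d\<close>, so only those of degree at most \<open>size \<mu>\<close> contribute to the coefficient of \<open>\<mu>\<close>.
\<close>

definition mfps_subst ::
    "('n, 'a::comm_ring_1) mfps ^ 'k \<Rightarrow> ('k::finite, 'a) mfps \<Rightarrow> ('n, 'a) mfps"
  where "mfps_subst \<phi> P = Abs_mfps (\<lambda>\<mu>. \<Sum>\<kappa> | size \<kappa> \<le> size \<mu>.
    mfps_coeff P \<kappa> * mfps_coeff (\<Prod>k\<in>#\<kappa>. \<phi> $ k) \<mu>)"

text \<open>
  A formal 1-form \<open>\<Sum>\<^sub>i a\<^sub>i dx\<^sub>i\<close> is the vector of its coefficients \<open>a\<^sub>i\<close>;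
  multiplication by a function is \<open>*s\<close>.
\<close>

type_synonym ('n, 'a) formal_form = "('n, 'a) mfps ^ 'n"

definition formal_pullback ::
    "('n::finite, 'a::comm_ring_1) mfps ^ 'k \<Rightarrow> ('k::finite, 'a) formal_form \<Rightarrow> ('n, 'a) formal_form"
  where "formal_pullback \<phi> \<eta> =
    (\<chi> i. \<Sum>k\<in>UNIV. mfps_subst \<phi> (\<eta> $ k) * mfps_deriv i (\<phi> $ k))"


section \<open>Smooth functions and Taylor expansions\<close>

definition partial_deriv :: "'n::finite \<Rightarrow> (real ^ 'n \<Rightarrow> real) \<Rightarrow> real ^ 'n \<Rightarrow> real"
  where "partial_deriv i f x = frechet_derivative f (at x) (axis i 1)"

text \<open>
  For open \<open>S\<close>: all iterated partial derivatives exist and are (totally) differentiable, hence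
  continuous, which is being of class \<open>C\<close>-infinity on \<open>S\<close>.
\<close>

definition smooth_fun_on :: "(real ^ 'n::finite) set \<Rightarrow> (real ^ 'n \<Rightarrow> real) \<Rightarrow> bool"
  where "smooth_fun_on S f \<longleftrightarrow>
    (\<forall>is. \<forall>x\<in>S. foldr partial_deriv is f differentiable (at x))"

text \<open>
  Taylor expansion at the origin.  The order \<open>is\<close> in which the partial derivatives belonging to
  the monomial \<open>\<mu>\<close> are taken is immaterial for functions that are smooth near the origin.
\<close>

definition taylor :: "(real ^ 'n::finite \<Rightarrow> real) \<Rightarrow> ('n, real) mfps"
  where "taylor f = Abs_mfps (\<lambda>\<mu>.
    foldr partial_deriv (SOME is. mset is = \<mu>) f 0 / (\<Prod>i\<in>set_mset \<mu>. fact (count \<mu> i)))"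

definition taylor_form :: "(real ^ 'n::finite \<Rightarrow> real ^ 'n) \<Rightarrow> ('n, real) formal_form"
  where "taylor_form a = (\<chi> i. taylor (\<lambda>x. a x $ i))"

definition linear_part :: "(real ^ 'n::finite \<Rightarrow> real ^ 'n) \<Rightarrow> ('n, real) formal_form"
  where "linear_part a = (\<chi> i. mfps_hom_part 1 (taylor_form a $ i))"


section \<open>Smooth manifolds\<close>

text \<open>A chart is its domain together with a coordinate map, whose values off the domain are irrelevant.\<close>

type_synonym ('m, 'n) chart = "'m set \<times> ('m \<Rightarrow> real ^ 'n)"

definition is_chart :: "'m topology \<Rightarrow> ('m, 'n::finite) chart \<Rightarrow> bool"
  where "is_chart M = (\<lambda>(U, \<psi>). openin M U \<and> open (\<psi> ` U) \<and>
    homeomorphic_map (subtopology M U) (top_of_set (\<psi> ` U)) \<psi>)"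

definition transition :: "('m, 'n::finite) chart \<Rightarrow> ('m, 'n) chart \<Rightarrow> real ^ 'n \<Rightarrow> real ^ 'n"
  where "transition c c' = (\<lambda>x. snd c' (inv_into (fst c) (snd c) x))"

definition smooth_transition :: "('m, 'n::finite) chart \<Rightarrow> ('m, 'n) chart \<Rightarrow> bool"
  where "smooth_transition c c' \<longleftrightarrow>
    (\<forall>j. smooth_fun_on (snd c ` (fst c \<inter> fst c')) (\<lambda>x. transition c c' x $ j))"

definition compatible_charts :: "('m, 'n::finite) chart \<Rightarrow> ('m, 'n) chart \<Rightarrow> bool"
  where "compatible_charts c c' \<longleftrightarrow> smooth_transition c c' \<and> smooth_transition c' c"

text \<open>The smooth structure is given by its maximal atlas; the dimension is \<open>CARD('n)\<close>.\<close>

definition smooth_manifold :: "'m topology \<Rightarrow> ('m, 'n::finite) chart set \<Rightarrow> bool"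
  where "smooth_manifold M A \<longleftrightarrow>
    Hausdorff_space M \<and> second_countable M \<and>
    (\<forall>c\<in>A. is_chart M c) \<and> (\<Union>c\<in>A. fst c) = topspace M \<and>
    (\<forall>c\<in>A. \<forall>c'\<in>A. compatible_charts c c') \<and>
    (\<forall>c. is_chart M c \<and> (\<forall>c'\<in>A. compatible_charts c c') \<longrightarrow> c \<in> A)"

definition centered_chart :: "('m, 'n::finite) chart \<Rightarrow> 'm \<Rightarrow> bool"
  where "centered_chart c m \<longleftrightarrow> m \<in> fst c \<and> snd c m = 0"

text \<open>
  A smooth 1-form on the open set \<open>W\<close> is given by its coefficients in all charts:
  in the chart \<open>c\<close> it is \<open>\<Sum>\<^sub>i (\<omega> c x $ i) dx\<^sub>i\<close>, for \<open>x\<close> in the image of \<open>W\<close>.  The second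
  condition says that the local expressions are pulled back to each other by the transition maps.
\<close>

type_synonym ('m, 'n) one_form = "('m, 'n) chart \<Rightarrow> real ^ 'n \<Rightarrow> real ^ 'n"

definition smooth_one_form_on ::
    "('m, 'n::finite) chart set \<Rightarrow> 'm set \<Rightarrow> ('m, 'n) one_form \<Rightarrow> bool"
  where "smooth_one_form_on A W \<omega> \<longleftrightarrow>
    (\<forall>c\<in>A. \<forall>i. smooth_fun_on (snd c ` (fst c \<inter> W)) (\<lambda>x. \<omega> c x $ i)) \<and>
    (\<forall>c\<in>A. \<forall>c'\<in>A. \<forall>x \<in> snd c ` (fst c \<inter> fst c' \<inter> W). \<forall>i.
      \<omega> c x $ i = (\<Sum>j\<in>UNIV. \<omega> c' (transition c c' x) $ j *
        partial_deriv i (\<lambda>y. transition c c' y $ j) x))"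

text \<open>
  Components on coordinate vector fields of \<open>d\<alpha>\<close> for a 1-form \<open>\<alpha>\<close>, and of \<open>\<alpha> \<and> \<beta>\<close> for a
  1-form \<open>\<alpha>\<close> and a 2-form \<open>\<beta>\<close> (an antisymmetric array).
\<close>

definition ext_deriv ::
    "(real ^ 'n::finite \<Rightarrow> real ^ 'n) \<Rightarrow> real ^ 'n \<Rightarrow> 'n \<Rightarrow> 'n \<Rightarrow> real"
  where "ext_deriv a x i j =
    partial_deriv i (\<lambda>y. a y $ j) x - partial_deriv j (\<lambda>y. a y $ i) x"

definition wedge12 :: "real ^ 'n::finite \<Rightarrow> ('n \<Rightarrow> 'n \<Rightarrow> real) \<Rightarrow> 'n \<Rightarrow> 'n \<Rightarrow> 'n \<Rightarrow> real"
  where "wedge12 \<alpha> \<beta> i j k = \<alpha> $ i * \<beta> j k - \<alpha> $ j * \<beta> i k + \<alpha> $ k * \<beta> i j"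

definition integrable_form_on ::
    "('m, 'n::finite) chart set \<Rightarrow> 'm set \<Rightarrow> ('m, 'n) one_form \<Rightarrow> bool"
  where "integrable_form_on A W \<omega> \<longleftrightarrow>
    (\<forall>c\<in>A. \<forall>x \<in> snd c ` (fst c \<inter> W). \<forall>i j k. wedge12 (\<omega> c x) (ext_deriv (\<omega> c) x) i j k = 0)"

end

theory Submission
  imports Defs "HOL-Library.Multiset_Order" "HOL-Library.Countable_Set"
begin

text \<open>
  By Schwarz' theorem and the Leibniz rule the Taylor expansion \<open>\<omega>\<close> is an integrable formal form,
  and the theorem is purely formal.  If \<open>d\<omega>\<close> is non-zero at the origin (the Kupka case), then \<open>\<omega>\<close> is
  invariant under the codimension 2 foliation \<open>ker d\<omega>\<close>.  Otherwise the linear part of \<open>\<omega>\<close> is the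
  differential of a non-zero quadratic form, and after a linear change of coordinates the coefficient
  of \<open>dx\<close> has non-zero \<open>x\<close>-derivative for some coordinate \<open>x\<close>.  Then there are a unit \<open>u\<close>, a series \<open>s\<close>
  and series \<open>f\<close>, \<open>h\<close> not depending on \<open>x\<close> with \<open>u \<omega> = s ds + df + s dh\<close> (the formal analogue of Loray's
  preparation theorem).  Integrability now means \<open>df \<and> dh = 0\<close>, and by the formal Mattei-Moussu theorem
  \<open>f = F(g)\<close> and \<open>h = H(g)\<close> for a common primitive \<open>g\<close>, so that \<open>u \<omega>\<close> is the pull-back of
  \<open>s ds + (F'(t) + s H'(t)) dt\<close> by \<open>(s, g)\<close>.
\<close>

section \<open>Formal power series\<close>

text \<open>The proof uses no leaf, flow or resolution of singularities. Series are found as fixed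
  points of maps that raise an order, and identities hold because their error has every order. The
  order counts only the variables off the x-line (normal form) or off the (x_i, x_j)-plane (Kupka
  case): along that line or plane the data are prescribed and nothing is small. Why df \<and> dh =
  0: the form \<eta> = s ds + df + s dh has d\<eta> = ds \<and> dh, so \<eta> \<and> d\<eta> = df
  \<and> ds \<and> dh. As f and h do not involve x, contraction with \<partial>_x leaves
  \<partial>_x s times df \<and> dh up to sign, and \<partial>_x s is a unit. The common primitive
  is the place where geometry is replaced by algebra. The series a with df \<and> da = 0 form a
  ring, and it is not clear that an element g of least positive order divides the others without
  constant term. But all powers of such a fraction a / g have one common denominator, a power of g,
  and the ring of power series contains every fraction with this property.\<close>

lemma coeff_zero [simp]: "mfps_coeff 0 \<mu> = 0"
  by (simp add: zero_mfps_def)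

lemma coeff_one: "mfps_coeff 1 \<mu> = (if \<mu> = {#} then 1 else 0)"
  by (simp add: one_mfps_def)

lemma coeff_add [simp]: "mfps_coeff (f + g) \<mu> = mfps_coeff f \<mu> + mfps_coeff g \<mu>"
  by (simp add: plus_mfps_def)

lemma coeff_uminus [simp]: "mfps_coeff (- f) \<mu> = - mfps_coeff f \<mu>"
  by (simp add: uminus_mfps_def)

lemma coeff_diff [simp]: "mfps_coeff (f - g) \<mu> = mfps_coeff f \<mu> - mfps_coeff g \<mu>"
  by (simp add: minus_mfps_def)

lemma coeff_mult:
  "mfps_coeff (f * g) \<mu> = (\<Sum>\<nu> | \<nu> \<subseteq># \<mu>. mfps_coeff f \<nu> * mfps_coeff g (\<mu> - \<nu>))"
  by (simp add: times_mfps_def)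

lemma coeff_mult_empty [simp]: "mfps_coeff (f * g) {#} = mfps_coeff f {#} * mfps_coeff g {#}"
proof -
  have "{\<nu>. \<nu> \<subseteq># {#}} = {{#}}" by auto
  then show ?thesis by (simp add: coeff_mult)
qed

lemma coeff_sum: "mfps_coeff (sum f A) \<mu> = (\<Sum>x\<in>A. mfps_coeff (f x) \<mu>)"
  by (induction A rule: infinite_finite_induct) auto

lemma coeff_deriv:
  "mfps_coeff (mfps_deriv i f) \<mu> = of_nat (Suc (count \<mu> i)) * mfps_coeff f (add_mset i \<mu>)"
  by (simp add: mfps_deriv_def)

lemma coeff_subst: "mfps_coeff (mfps_subst \<phi> P) \<mu> =
  (\<Sum>\<kappa> | size \<kappa> \<le> size \<mu>. mfps_coeff P \<kappa> * mfps_coeff (\<Prod>k\<in>#\<kappa>. \<phi> $ k) \<mu>)"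
  by (simp add: mfps_subst_def)

definition mfps_const :: "'a \<Rightarrow> ('n, 'a::comm_ring_1) mfps"
  where "mfps_const c = Abs_mfps (\<lambda>\<mu>. if \<mu> = {#} then c else 0)"

definition mfps_X :: "'n \<Rightarrow> ('n, 'a::comm_ring_1) mfps"
  where "mfps_X i = Abs_mfps (\<lambda>\<mu>. if \<mu> = {#i#} then 1 else 0)"

lemma coeff_const: "mfps_coeff (mfps_const c) \<mu> = (if \<mu> = {#} then c else 0)"
  by (simp add: mfps_const_def)

lemma coeff_X: "mfps_coeff (mfps_X i) \<mu> = (if \<mu> = {#i#} then 1 else 0)"
  by (simp add: mfps_X_def)

lemma coeff_const_mult [simp]: "mfps_coeff (mfps_const c * f) \<mu> = c * mfps_coeff f \<mu>"
proof -
  have "mfps_coeff (mfps_const c * f) \<mu> =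
      (\<Sum>\<nu> | \<nu> \<subseteq># \<mu>. if {#} = \<nu> then c * mfps_coeff f (\<mu> - \<nu>) else 0)"
    unfolding coeff_mult by (intro sum.cong) (auto simp: coeff_const)
  then show ?thesis by (simp add: sum.delta' finite_submultisets)
qed

lemma coeff_X_mult:
  "mfps_coeff (mfps_X i * f) \<mu> = (if i \<in># \<mu> then mfps_coeff f (\<mu> - {#i#}) else 0)"
proof -
  have "mfps_coeff (mfps_X i * f) \<mu> =
      (\<Sum>\<nu> | \<nu> \<subseteq># \<mu>. if {#i#} = \<nu> then mfps_coeff f (\<mu> - \<nu>) else 0)"
    unfolding coeff_mult by (intro sum.cong) (auto simp: coeff_X)
  then show ?thesis by (simp add: sum.delta' finite_submultisets)
qed

lemma X_mult_cancel: "mfps_X i * f = mfps_X i * g \<longleftrightarrow> f = g"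
proof
  assume *: "mfps_X i * f = mfps_X i * g"
  show "f = g"
  proof (rule mfps_eqI)
    fix \<mu>
    have "mfps_coeff (mfps_X i * f) (add_mset i \<mu>) = mfps_coeff (mfps_X i * g) (add_mset i \<mu>)"
      by (simp add: *)
    then show "mfps_coeff f \<mu> = mfps_coeff g \<mu>" by (simp add: coeff_X_mult)
  qed
qed simp

lemma mfps_const_0 [simp]: "mfps_const 0 = 0"
  by (rule mfps_eqI) (simp add: coeff_const)

lemma mfps_const_1 [simp]: "mfps_const 1 = 1"
  by (rule mfps_eqI) (simp add: coeff_const coeff_one)

text \<open>The field x_i \<partial>_i is diagonal on monomials, so its Leibniz rule is just
  additivity of exponents. The rule for \<partial>_i follows by cancelling x_i, without reindexing
  shifted sums.\<close>

definition euler1 :: "'n \<Rightarrow> ('n, 'a::comm_ring_1) mfps \<Rightarrow> ('n, 'a) mfps"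
  where "euler1 i f = mfps_X i * mfps_deriv i f"

lemma coeff_euler1: "mfps_coeff (euler1 i f) \<mu> = of_nat (count \<mu> i) * mfps_coeff f \<mu>"
proof (cases "i \<in># \<mu>")
  case True
  then obtain \<nu> where "\<mu> = add_mset i \<nu>" by (metis insert_DiffM)
  then show ?thesis by (simp add: euler1_def coeff_X_mult coeff_deriv)
next
  case False
  then have "count \<mu> i = 0" by (simp only: not_in_iff)
  with False show ?thesis by (simp add: euler1_def coeff_X_mult)
qed

lemma euler1_mult: "euler1 i (f * g) = euler1 i f * g + f * euler1 i g"
proof (rule mfps_eqI)
  fix \<mu>
  have "of_nat (count \<mu> i) * (mfps_coeff f \<nu> * mfps_coeff g (\<mu> - \<nu>)) =
      of_nat (count \<nu> i) * mfps_coeff f \<nu> * mfps_coeff g (\<mu> - \<nu>) +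
      mfps_coeff f \<nu> * (of_nat (count (\<mu> - \<nu>) i) * mfps_coeff g (\<mu> - \<nu>))" if "\<nu> \<subseteq># \<mu>" for \<nu>
  proof -
    have "count \<mu> i = count \<nu> i + count (\<mu> - \<nu>) i"
      using that by (simp add: mset_subset_eq_count)
    then show ?thesis by (simp add: algebra_simps)
  qed
  then show "mfps_coeff (euler1 i (f * g)) \<mu> = mfps_coeff (euler1 i f * g + f * euler1 i g) \<mu>"
    by (simp add: coeff_euler1 coeff_mult sum_distrib_left flip: sum.distrib)
qed

lemma deriv_mult: "mfps_deriv i (f * g) = mfps_deriv i f * g + f * mfps_deriv i g"
proof -
  have "mfps_X i * mfps_deriv i (f * g) = mfps_X i * (mfps_deriv i f * g + f * mfps_deriv i g)"
    using euler1_mult[of i f g] by (simp add: euler1_def algebra_simps)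
  then show ?thesis by (simp only: X_mult_cancel)
qed

lemma deriv_add [simp]: "mfps_deriv i (f + g) = mfps_deriv i f + mfps_deriv i g"
  by (rule mfps_eqI) (simp add: coeff_deriv algebra_simps)

lemma deriv_diff [simp]: "mfps_deriv i (f - g) = mfps_deriv i f - mfps_deriv i g"
  by (rule mfps_eqI) (simp add: coeff_deriv algebra_simps)

lemma deriv_0 [simp]: "mfps_deriv i 0 = 0"
  by (rule mfps_eqI) (simp add: coeff_deriv)

lemma deriv_const [simp]: "mfps_deriv i (mfps_const c) = 0"
  by (rule mfps_eqI) (simp add: coeff_deriv coeff_const)

lemma deriv_X: "mfps_deriv i (mfps_X j) = (if i = j then 1 else 0)"
  by (rule mfps_eqI) (auto simp: coeff_deriv coeff_X coeff_one)

lemma deriv_sum: "mfps_deriv i (sum f A) = (\<Sum>x\<in>A. mfps_deriv i (f x))"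
  by (induction A rule: infinite_finite_induct) auto

lemma deriv_commute: "mfps_deriv i (mfps_deriv j f) = mfps_deriv j (mfps_deriv i f)"
  by (rule mfps_eqI) (auto simp: coeff_deriv add_mset_commute)

text \<open>
  The set of variables \<open>S\<close> grades the monomials by their degree in \<open>S\<close>; all existence and uniqueness
  arguments below go by induction along the filtration \<open>ord_ge S\<close>.
\<close>

definition deg_in :: "'n set \<Rightarrow> 'n multiset \<Rightarrow> nat"
  where "deg_in S \<mu> = size (filter_mset (\<lambda>i. i \<in> S) \<mu>)"

lemma deg_in_UNIV [simp]: "deg_in UNIV \<mu> = size \<mu>"
  by (simp add: deg_in_def)

lemma deg_in_empty [simp]: "deg_in S {#} = 0"
  by (simp add: deg_in_def)

lemma deg_in_add [simp]: "deg_in S (\<mu> + \<nu>) = deg_in S \<mu> + deg_in S \<nu>"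
  by (simp add: deg_in_def)

lemma deg_in_add_mset [simp]: "deg_in S (add_mset i \<mu>) = (if i \<in> S then Suc (deg_in S \<mu>) else deg_in S \<mu>)"
  by (simp add: deg_in_def)

lemma deg_in_eq_0_iff: "deg_in S \<mu> = 0 \<longleftrightarrow> set_mset \<mu> \<inter> S = {}"
  by (auto simp: deg_in_def filter_mset_eq_conv)

lemma deg_in_sum: "deg_in S (\<mu> :: 'n::finite multiset) = (\<Sum>i\<in>S. count \<mu> i)"
proof (induction \<mu>)
  case (add x \<mu>)
  have "(\<Sum>i\<in>S. count (add_mset x \<mu>) i) = (\<Sum>i\<in>S. count \<mu> i + (if x = i then 1 else 0))"
    by (intro sum.cong) auto
  with add show ?case by (simp add: sum.distrib)
qed simp

definition ord_ge :: "'n set \<Rightarrow> nat \<Rightarrow> ('n, 'a::comm_ring_1) mfps \<Rightarrow> bool"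
  where "ord_ge S d f \<longleftrightarrow> (\<forall>\<mu>. deg_in S \<mu> < d \<longrightarrow> mfps_coeff f \<mu> = 0)"

lemma ord_ge_0 [simp]: "ord_ge S 0 f"
  by (simp add: ord_ge_def)

lemma ord_ge_zero [simp]: "ord_ge S d 0"
  by (simp add: ord_ge_def)

lemma ord_ge_add: "ord_ge S d f \<Longrightarrow> ord_ge S d g \<Longrightarrow> ord_ge S d (f + g)"
  by (simp add: ord_ge_def)

lemma ord_ge_diff: "ord_ge S d f \<Longrightarrow> ord_ge S d g \<Longrightarrow> ord_ge S d (f - g)"
  by (simp add: ord_ge_def)

lemma ord_ge_uminus: "ord_ge S d f \<Longrightarrow> ord_ge S d (- f)"
  by (simp add: ord_ge_def)

lemma ord_ge_sum: "(\<And>x. x \<in> A \<Longrightarrow> ord_ge S d (f x)) \<Longrightarrow> ord_ge S d (sum f A)"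
  by (simp add: ord_ge_def coeff_sum)

lemma ord_ge_mono: "ord_ge S d f \<Longrightarrow> e \<le> d \<Longrightarrow> ord_ge S e f"
  by (auto simp: ord_ge_def)

lemma ord_ge_mult:
  assumes "ord_ge S d f" "ord_ge S e g"
  shows "ord_ge S (d + e) (f * g)"
  unfolding ord_ge_def
proof (intro allI impI)
  fix \<mu> assume *: "deg_in S \<mu> < d + e"
  have "mfps_coeff f \<nu> * mfps_coeff g (\<mu> - \<nu>) = 0" if "\<nu> \<subseteq># \<mu>" for \<nu>
  proof -
    have "deg_in S \<mu> = deg_in S \<nu> + deg_in S (\<mu> - \<nu>)"
      using that by (metis deg_in_add subset_mset.add_diff_inverse)
    then have "deg_in S \<nu> < d \<or> deg_in S (\<mu> - \<nu>) < e" using * by linarith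
    then show ?thesis using assms by (auto simp: ord_ge_def)
  qed
  then show "mfps_coeff (f * g) \<mu> = 0" by (simp add: coeff_mult)
qed

lemma ord_ge_mult_left: "ord_ge S d g \<Longrightarrow> ord_ge S d (f * g)"
  using ord_ge_mult[of S 0 f d g] by simp

lemma ord_ge_mult_right: "ord_ge S d f \<Longrightarrow> ord_ge S d (f * g)"
  using ord_ge_mult[of S d f 0 g] by simp

lemma ord_ge_power: "ord_ge S d f \<Longrightarrow> ord_ge S (k * d) (f ^ k)"
  by (induction k) (auto intro: ord_ge_mult)

lemma ord_ge_eq_0: "(\<And>d. ord_ge S d f) \<Longrightarrow> f = 0"
  by (rule mfps_eqI) (metis coeff_zero lessI ord_ge_def)

lemma ord_ge_deriv: "i \<notin> S \<Longrightarrow> ord_ge S d f \<Longrightarrow> ord_ge S d (mfps_deriv i f)"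
  by (simp add: ord_ge_def coeff_deriv)

lemma ord_ge_deriv_Suc: "ord_ge S (Suc d) f \<Longrightarrow> ord_ge S d (mfps_deriv i f)"
  by (simp add: ord_ge_def coeff_deriv)

lemma ord_ge_UNIV_1: "ord_ge UNIV 1 f \<longleftrightarrow> mfps_coeff f {#} = 0"
  by (auto simp: ord_ge_def)

lemma ord_ge_X: "i \<in> S \<Longrightarrow> ord_ge S 1 (mfps_X i)"
  by (auto simp: ord_ge_def coeff_X)

section \<open>Substitution\<close>

lemma finite_multisets_size_le [simp]: "finite {\<kappa> :: 'k::finite multiset. size \<kappa> \<le> N}"
proof (rule finite_subset)
  show "{\<kappa> :: 'k multiset. size \<kappa> \<le> N} \<subseteq> (\<Union>k\<le>N. multisets_of_size UNIV k)"
    by (auto simp: multisets_of_size_def)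
qed (auto intro!: finite_multisets_of_size)

lemma ord_ge_prod_mset:
  assumes "\<And>k. mfps_coeff (\<phi> k) {#} = 0"
  shows "ord_ge UNIV (size \<kappa>) (\<Prod>k\<in>#\<kappa>. \<phi> k)"
proof (induction \<kappa>)
  case (add k \<kappa>)
  have "ord_ge UNIV 1 (\<phi> k)" using assms by (simp add: ord_ge_UNIV_1 del: One_nat_def)
  from ord_ge_mult[OF this add] show ?case by simp
qed simp

text \<open>A common cut-off \<open>N\<close> for all coefficients in question is what allows their
  sums to be interchanged.\<close>

lemma coeff_subst_ge:
  assumes "\<And>k. mfps_coeff (\<phi> $ k) {#} = 0" "size \<mu> \<le> N"
  shows "mfps_coeff (mfps_subst \<phi> P) \<mu> =
    (\<Sum>\<kappa> | size \<kappa> \<le> N. mfps_coeff P \<kappa> * mfps_coeff (\<Prod>k\<in>#\<kappa>. \<phi> $ k) \<mu>)"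
  unfolding coeff_subst
proof (rule sum.mono_neutral_left)
  have "mfps_coeff (\<Prod>k\<in>#\<kappa>. \<phi> $ k) \<mu> = 0" if "size \<mu> < size \<kappa>" for \<kappa>
    using ord_ge_prod_mset[of "\<lambda>k. \<phi> $ k" \<kappa>] assms(1) that by (auto simp: ord_ge_def)
  then show "\<forall>\<kappa>\<in>{\<kappa>. size \<kappa> \<le> N} - {\<kappa>. size \<kappa> \<le> size \<mu>}.
      mfps_coeff P \<kappa> * mfps_coeff (\<Prod>k\<in>#\<kappa>. \<phi> $ k) \<mu> = 0"
    by auto
qed (use assms(2) in auto)

lemma subst_add [simp]: "mfps_subst \<phi> (P + Q) = mfps_subst \<phi> P + mfps_subst \<phi> Q"
  by (rule mfps_eqI) (simp add: coeff_subst ring_distribs sum.distrib)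

lemma subst_diff [simp]: "mfps_subst \<phi> (P - Q) = mfps_subst \<phi> P - mfps_subst \<phi> Q"
  by (rule mfps_eqI) (simp add: coeff_subst ring_distribs sum_subtractf)

lemma subst_0 [simp]: "mfps_subst \<phi> 0 = 0"
  by (rule mfps_eqI) (simp add: coeff_subst)

lemma subst_sum: "mfps_subst \<phi> (sum f A) = (\<Sum>x\<in>A. mfps_subst \<phi> (f x))"
  by (induction A rule: infinite_finite_induct) auto

lemma subst_const [simp]: "mfps_subst \<phi> (mfps_const c) = mfps_const c"
proof (rule mfps_eqI)
  fix \<mu>
  have "mfps_coeff (mfps_subst \<phi> (mfps_const c)) \<mu> = (\<Sum>\<kappa> | size \<kappa> \<le> size \<mu>.
      if {#} = \<kappa> then c * mfps_coeff (\<Prod>k\<in>#\<kappa>. \<phi> $ k) \<mu> else 0)"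
    unfolding coeff_subst by (intro sum.cong) (auto simp: coeff_const)
  then show "mfps_coeff (mfps_subst \<phi> (mfps_const c)) \<mu> = mfps_coeff (mfps_const c) \<mu>"
    by (simp add: sum.delta' coeff_one coeff_const)
qed

lemma subst_1 [simp]: "mfps_subst \<phi> 1 = 1"
  using subst_const[of \<phi> 1] by simp

lemma subst_X:
  assumes "\<And>k. mfps_coeff (\<phi> $ k) {#} = 0"
  shows "mfps_subst \<phi> (mfps_X k) = \<phi> $ k"
proof (rule mfps_eqI)
  fix \<mu>
  \<comment> \<open>The cut-off \<open>size \<mu>\<close> would lose the monomial
    \<open>{#k#}\<close> when \<open>\<mu>\<close> is empty; its successor never does.\<close>
  have "mfps_coeff (mfps_subst \<phi> (mfps_X k)) \<mu> = (\<Sum>\<kappa> | size \<kappa> \<le> Suc (size \<mu>).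
      mfps_coeff (mfps_X k) \<kappa> * mfps_coeff (\<Prod>k\<in>#\<kappa>. \<phi> $ k) \<mu>)"
    by (rule coeff_subst_ge) (auto simp: assms)
  also have "\<dots> = (\<Sum>\<kappa> | size \<kappa> \<le> Suc (size \<mu>).
      if {#k#} = \<kappa> then mfps_coeff (\<Prod>k\<in>#\<kappa>. \<phi> $ k) \<mu> else 0)"
    by (intro sum.cong) (auto simp: coeff_X)
  finally show "mfps_coeff (mfps_subst \<phi> (mfps_X k)) \<mu> = mfps_coeff (\<phi> $ k) \<mu>"
    by (simp add: sum.delta')
qed

lemma subst_mult:
  fixes \<phi> :: "('n, 'a::comm_ring_1) mfps ^ 'k::finite"
  assumes \<phi>: "\<And>k. mfps_coeff (\<phi> $ k) {#} = 0"
  shows "mfps_subst \<phi> (P * Q) = mfps_subst \<phi> P * mfps_subst \<phi> Q"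
proof (rule mfps_eqI)
  fix \<mu> :: "'n multiset"
  define N where "N = size \<mu>"
  let ?B = "{\<kappa> :: 'k multiset. size \<kappa> \<le> N}"
  let ?m = "\<lambda>\<kappa>. \<Prod>k\<in>#\<kappa>. \<phi> $ k"
  let ?t = "\<lambda>(\<kappa>, \<tau>). mfps_coeff P \<kappa> * mfps_coeff Q \<tau> * mfps_coeff (?m (\<kappa> + \<tau>)) \<mu>"
  have "mfps_coeff (mfps_subst \<phi> P * mfps_subst \<phi> Q) \<mu> = (\<Sum>\<nu> | \<nu> \<subseteq># \<mu>.
      (\<Sum>\<kappa>\<in>?B. mfps_coeff P \<kappa> * mfps_coeff (?m \<kappa>) \<nu>) *
      (\<Sum>\<tau>\<in>?B. mfps_coeff Q \<tau> * mfps_coeff (?m \<tau>) (\<mu> - \<nu>)))"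
    unfolding coeff_mult
    by (intro sum.cong arg_cong2[where f = "(*)"] coeff_subst_ge)
      (auto simp: \<phi> N_def size_mset_mono)
  also have "\<dots> = (\<Sum>\<nu> | \<nu> \<subseteq># \<mu>. \<Sum>\<kappa>\<in>?B. \<Sum>\<tau>\<in>?B. mfps_coeff P \<kappa> * mfps_coeff Q \<tau> *
      (mfps_coeff (?m \<kappa>) \<nu> * mfps_coeff (?m \<tau>) (\<mu> - \<nu>)))"
    unfolding sum_product by (simp add: mult_ac)
  also have "\<dots> = (\<Sum>\<kappa>\<in>?B. \<Sum>\<tau>\<in>?B. \<Sum>\<nu> | \<nu> \<subseteq># \<mu>. mfps_coeff P \<kappa> * mfps_coeff Q \<tau> *
      (mfps_coeff (?m \<kappa>) \<nu> * mfps_coeff (?m \<tau>) (\<mu> - \<nu>)))"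
    by (subst sum.swap, intro sum.cong refl, rule sum.swap)
  also have "\<dots> = (\<Sum>\<kappa>\<in>?B. \<Sum>\<tau>\<in>?B. ?t (\<kappa>, \<tau>))"
    by (simp add: coeff_mult sum_distrib_left)
  also have "\<dots> = sum ?t (?B \<times> ?B)"
    by (simp add: sum.cartesian_product)
  \<comment> \<open>Pairs of total degree above \<open>N\<close> contribute nothing at
    \<open>\<mu>\<close>. The remaining triangle is then sliced by the total monomial \<kappa> +
    \<tau>.\<close>
  also have "\<dots> = sum ?t {(\<kappa>, \<tau>). size (\<kappa> + \<tau>) \<le> N}"
  proof (rule sum.mono_neutral_right)
    have "mfps_coeff (?m \<rho>) \<mu> = 0" if "N < size \<rho>" for \<rho>
      using ord_ge_prod_mset[of "\<lambda>k. \<phi> $ k" \<rho>] \<phi> that by (auto simp: ord_ge_def N_def)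
    then show "\<forall>x\<in>?B \<times> ?B - {(\<kappa>, \<tau>). size (\<kappa> + \<tau>) \<le> N}. ?t x = 0"
      by (clarsimp simp del: image_mset_union) (metis mult_zero_right not_le size_union)
  qed auto
  also have "\<dots> = (\<Sum>(\<rho>, \<kappa>)\<in>Sigma ?B (\<lambda>\<rho>. {\<kappa>. \<kappa> \<subseteq># \<rho>}).
      mfps_coeff P \<kappa> * mfps_coeff Q (\<rho> - \<kappa>) * mfps_coeff (?m \<rho>) \<mu>)"
    by (rule sum.reindex_bij_witness[of _ "\<lambda>(\<rho>, \<kappa>). (\<kappa>, \<rho> - \<kappa>)" "\<lambda>(\<kappa>, \<tau>). (\<kappa> + \<tau>, \<kappa>)"])
      (auto simp: subset_mset.add_diff_inverse size_Diff_submset size_mset_mono)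
  also have "\<dots> = mfps_coeff (mfps_subst \<phi> (P * Q)) \<mu>"
    by (simp add: coeff_subst coeff_mult sum_distrib_right sum.Sigma finite_submultisets
        flip: N_def)
  finally show "mfps_coeff (mfps_subst \<phi> (P * Q)) \<mu> =
    mfps_coeff (mfps_subst \<phi> P * mfps_subst \<phi> Q) \<mu>" ..
qed

lemma ord_ge_subst:
  assumes "\<And>k. mfps_coeff (\<phi> $ k) {#} = 0" "ord_ge UNIV d P"
  shows "ord_ge UNIV d (mfps_subst \<phi> P)"
  using assms(2) by (auto simp: ord_ge_def coeff_subst)

lemma coeff_subst_empty [simp]: "mfps_coeff (mfps_subst \<phi> P) {#} = mfps_coeff P {#}"
proof -
  have "{\<kappa> :: 'a multiset. size \<kappa> \<le> size {#}} = {{#}}" by auto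
  then show ?thesis by (simp add: coeff_subst coeff_one)
qed

section \<open>Approximation by polynomials, chain rule and composition\<close>

lemma mfps_prod_X_coeff:
  "mfps_coeff (\<Prod>k\<in>#\<kappa>. mfps_X (\<iota> k)) \<mu> = (if \<mu> = image_mset \<iota> \<kappa> then 1 else 0)"
proof (induction \<kappa> arbitrary: \<mu>)
  case (add k \<kappa>)
  show ?case
    by (cases "\<iota> k \<in># \<mu>") (auto simp: coeff_X_mult add dest!: multi_member_split)
qed (simp add: coeff_one)

text \<open>Polynomials are dense for the degree filtration. This proves identities between
  operators on series from the generators, once both sides are seen to be continuous.\<close>

lemma mfps_induct [case_names const X add mult limit]:
  fixes P :: "('n::finite, 'a::comm_ring_1) mfps"
  assumes const: "\<And>c. Q (mfps_const c)" and X: "\<And>i. Q (mfps_X i)"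
    and add: "\<And>f g. Q f \<Longrightarrow> Q g \<Longrightarrow> Q (f + g)"
    and mult: "\<And>f g. Q f \<Longrightarrow> Q g \<Longrightarrow> Q (f * g)"
    and limit: "\<And>f. (\<And>N. \<exists>g. Q g \<and> ord_ge UNIV N (f - g)) \<Longrightarrow> Q f"
  shows "Q P"
proof (rule limit)
  fix N
  have monom: "Q (\<Prod>k\<in>#\<kappa>. mfps_X k)" for \<kappa>
    by (induction \<kappa>) (use const[of 1] X mult in auto)
  have sum: "Q (sum f A)" if "finite A" "\<And>x. x \<in> A \<Longrightarrow> Q (f x)"
    for A and f :: "'n multiset \<Rightarrow> _"
    using that by (induction A rule: finite_induct) (use const[of 0] add in auto)
  let ?g = "\<Sum>\<kappa> | size \<kappa> \<le> N. mfps_const (mfps_coeff P \<kappa>) * (\<Prod>k\<in>#\<kappa>. mfps_X k)"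
  have "Q ?g" by (intro sum mult const monom) simp
  moreover have "mfps_coeff ?g \<mu> = mfps_coeff P \<mu>" if "size \<mu> \<le> N" for \<mu>
  proof -
    have "mfps_coeff ?g \<mu> = (\<Sum>\<kappa> | size \<kappa> \<le> N. if \<mu> = \<kappa> then mfps_coeff P \<kappa> else 0)"
      unfolding coeff_sum coeff_const_mult
      by (intro sum.cong) (auto simp: mfps_prod_X_coeff[where \<iota> = "\<lambda>k. k", simplified])
    then show ?thesis using that by simp
  qed
  then have "ord_ge UNIV N (P - ?g)" by (simp add: ord_ge_def)
  ultimately show "\<exists>g. Q g \<and> ord_ge UNIV N (P - g)" by blast
qed

lemma deriv_subst:
  fixes P :: "('k::finite, 'a::comm_ring_1) mfps"
  assumes \<phi>: "\<And>k. mfps_coeff (\<phi> $ k) {#} = 0"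
  shows "mfps_deriv i (mfps_subst \<phi> P) =
    (\<Sum>k\<in>UNIV. mfps_subst \<phi> (mfps_deriv k P) * mfps_deriv i (\<phi> $ k))"
proof (induction P rule: mfps_induct)
  case (X k)
  have "(\<Sum>k'\<in>UNIV. mfps_subst \<phi> (mfps_deriv k' (mfps_X k)) * mfps_deriv i (\<phi> $ k')) =
      (\<Sum>k'\<in>UNIV. if k' = k then mfps_deriv i (\<phi> $ k') else 0)"
    by (intro sum.cong) (auto simp: deriv_X)
  then show ?case by (simp add: subst_X \<phi>)
next
  case (add f g)
  then show ?case by (simp add: ring_distribs sum.distrib)
next
  case (mult f g)
  then show ?case
    by (simp add: deriv_mult subst_mult \<phi> algebra_simps sum.distrib sum_distrib_left)
next
  case (limit f)
  let ?d = "\<lambda>f. mfps_deriv i (mfps_subst \<phi> f) -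
    (\<Sum>k\<in>UNIV. mfps_subst \<phi> (mfps_deriv k f) * mfps_deriv i (\<phi> $ k))"
  have "ord_ge UNIV N (?d f)" for N
  proof -
    \<comment> \<open>One order more than \<open>N\<close>, since differentiation loses one.\<close>
    obtain g where g: "?d g = 0" "ord_ge UNIV (Suc N) (f - g)"
      using limit[of "Suc N"] by auto
    have "ord_ge UNIV N (?d (f - g))"
      by (intro ord_ge_diff ord_ge_deriv_Suc ord_ge_subst ord_ge_sum ord_ge_mult_right \<phi> g)
    also have "?d (f - g) = ?d f - ?d g"
      by (simp add: left_diff_distrib sum_subtractf)
    finally show ?thesis by (simp add: g(1))
  qed
  then have "?d f = 0" by (rule ord_ge_eq_0)
  then show ?case by simp
qed simp

lemma subst_subst:
  fixes P :: "('k::finite, 'a::comm_ring_1) mfps" and \<psi> :: "('m, 'a) mfps ^ 'n::finite"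
  assumes \<phi>: "\<And>k. mfps_coeff (\<phi> $ k) {#} = 0" and \<psi>: "\<And>k. mfps_coeff (\<psi> $ k) {#} = 0"
  shows "mfps_subst \<psi> (mfps_subst \<phi> P) = mfps_subst (\<chi> k. mfps_subst \<psi> (\<phi> $ k)) P"
proof -
  let ?\<chi> = "(\<chi> k. mfps_subst \<psi> (\<phi> $ k)) :: ('m, 'a) mfps ^ 'k"
  have \<chi>: "mfps_coeff (?\<chi> $ k) {#} = 0" for k
    by (simp add: \<phi>)
  show ?thesis
  proof (induction P rule: mfps_induct)
    case (X k)
    show ?case by (simp add: subst_X \<phi> \<chi>)
  next
    case (mult f g)
    then show ?case by (simp add: subst_mult \<phi> \<psi> \<chi>)
  next
    case (limit f)
    let ?d = "\<lambda>f. mfps_subst \<psi> (mfps_subst \<phi> f) - mfps_subst ?\<chi> f"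
    have "ord_ge UNIV N (?d f)" for N
    proof -
      obtain g where g: "?d g = 0" "ord_ge UNIV N (f - g)"
        using limit[of N] by auto
      have "ord_ge UNIV N (?d (f - g))"
        by (intro ord_ge_diff ord_ge_subst \<phi> \<psi> \<chi> g)
      then show ?thesis using g(1) by simp
    qed
    then have "?d f = 0" by (rule ord_ge_eq_0)
    then show ?case by simp
  qed simp_all
qed

lemma subst_X_id:
  fixes P :: "('n::finite, 'a::comm_ring_1) mfps"
  shows "mfps_subst (\<chi> i. mfps_X i) P = P"
proof -
  have [simp]: "mfps_coeff ((\<chi> i. (mfps_X i :: ('n, 'a) mfps)) $ k) {#} = 0" for k :: 'n
    by (simp add: coeff_X)
  show ?thesis
  proof (induction P rule: mfps_induct)
    case (limit f)
    have "ord_ge UNIV N (mfps_subst (\<chi> i. mfps_X i) f - f)" for N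
    proof -
      obtain g where g: "mfps_subst (\<chi> i. mfps_X i) g = g" "ord_ge UNIV N (f - g)"
        using limit[of N] by auto
      have "ord_ge UNIV N (mfps_subst (\<chi> i. mfps_X i) (f - g) - (f - g))"
        by (rule ord_ge_diff[OF ord_ge_subst g(2)]) (use g(2) in \<open>simp_all add: coeff_X\<close>)
      then show ?thesis using g(1) by simp
    qed
    then have "mfps_subst (\<chi> i. mfps_X i) f - f = 0" by (rule ord_ge_eq_0)
    then show ?case by simp
  qed (simp_all add: subst_X subst_mult coeff_X)
qed

lemma formal_pullback_comp:
  fixes \<eta> :: "('k::finite, 'a::comm_ring_1) formal_form" and \<phi> :: "('n::finite, 'a) mfps ^ 'k"
    and \<psi> :: "('m::finite, 'a) mfps ^ 'n"
  assumes \<phi>: "\<And>k. mfps_coeff (\<phi> $ k) {#} = 0" and \<psi>: "\<And>k. mfps_coeff (\<psi> $ k) {#} = 0"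
  shows "formal_pullback \<psi> (formal_pullback \<phi> \<eta>) =
    formal_pullback (\<chi> k. mfps_subst \<psi> (\<phi> $ k)) \<eta>"
proof (simp add: vec_eq_iff formal_pullback_def, intro allI)
  fix i
  have "(\<Sum>j\<in>UNIV. mfps_subst \<psi> (\<Sum>k\<in>UNIV. mfps_subst \<phi> (\<eta> $ k) * mfps_deriv j (\<phi> $ k)) *
      mfps_deriv i (\<psi> $ j)) =
    (\<Sum>j\<in>UNIV. \<Sum>k\<in>UNIV. mfps_subst (\<chi> k. mfps_subst \<psi> (\<phi> $ k)) (\<eta> $ k) *
      (mfps_subst \<psi> (mfps_deriv j (\<phi> $ k)) * mfps_deriv i (\<psi> $ j)))"
    by (simp add: subst_sum subst_mult \<psi> subst_subst \<phi> sum_distrib_right mult.assoc)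
  also have "\<dots> = (\<Sum>k\<in>UNIV. mfps_subst (\<chi> k. mfps_subst \<psi> (\<phi> $ k)) (\<eta> $ k) *
      mfps_deriv i (mfps_subst \<psi> (\<phi> $ k)))"
    by (subst sum.swap) (simp add: deriv_subst \<psi> sum_distrib_left)
  finally show "(\<Sum>j\<in>UNIV. mfps_subst \<psi> (\<Sum>k\<in>UNIV. mfps_subst \<phi> (\<eta> $ k) * mfps_deriv j (\<phi> $ k)) *
      mfps_deriv i (\<psi> $ j)) = (\<Sum>k\<in>UNIV. mfps_subst (\<chi> k. mfps_subst \<psi> (\<phi> $ k)) (\<eta> $ k) *
      mfps_deriv i (mfps_subst \<psi> (\<phi> $ k)))" .
qed

lemma formal_pullback_scale:
  assumes "\<And>k. mfps_coeff (\<phi> $ k) {#} = 0"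
  shows "formal_pullback \<phi> (u *s \<eta>) = mfps_subst \<phi> u *s formal_pullback \<phi> \<eta>"
  by (simp add: vec_eq_iff formal_pullback_def subst_mult assms sum_distrib_left mult.assoc)

section \<open>Leading monomials\<close>

text \<open>Degree comes first, so a monomial has only finitely many predecessors and every non-zero
  series has a least one. Ties are broken by the multiset order after numbering the variables, which
  keeps the order total and invariant under multiplication.\<close>

definition mono_less :: "'n::finite multiset \<Rightarrow> 'n multiset \<Rightarrow> bool"
  where "mono_less \<mu> \<nu> \<longleftrightarrow> size \<mu> < size \<nu> \<or>
    size \<mu> = size \<nu> \<and> image_mset (to_nat_on UNIV) \<mu> < image_mset (to_nat_on UNIV) \<nu>"

lemma mono_less_irrefl [simp]: "\<not> mono_less \<mu> \<mu>"
  by (simp add: mono_less_def)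

lemma mono_less_trans: "mono_less \<mu> \<nu> \<Longrightarrow> mono_less \<nu> \<rho> \<Longrightarrow> mono_less \<mu> \<rho>"
  by (auto simp: mono_less_def)

lemma mono_less_total: "mono_less \<mu> \<nu> \<or> \<mu> = \<nu> \<or> mono_less \<nu> \<mu>"
proof -
  have "inj (to_nat_on (UNIV :: 'a set))"
    by (simp add: inj_on_to_nat_on countable_finite)
  then have "\<mu> = \<nu>" if "image_mset (to_nat_on UNIV) \<mu> = image_mset (to_nat_on UNIV) \<nu>"
    using that by (metis injD multiset.inj_map)
  then show ?thesis
    unfolding mono_less_def by (metis linorder_less_linear)
qed

lemma mono_less_add: "mono_less (\<mu> + \<rho>) (\<nu> + \<rho>) \<longleftrightarrow> mono_less \<mu> \<nu>"
  by (simp add: mono_less_def)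

lemma mono_less_size: "size \<mu> < size \<nu> \<Longrightarrow> mono_less \<mu> \<nu>"
  by (simp add: mono_less_def)

lemma mono_less_add_mono: "mono_less \<mu> \<mu>' \<Longrightarrow> mono_less \<nu> \<nu>' \<or> \<nu> = \<nu>' \<Longrightarrow> mono_less (\<mu> + \<nu>) (\<mu>' + \<nu>')"
  by (metis mono_less_add mono_less_trans union_commute)

lemma finite_mono_min:
  assumes "finite A" "A \<noteq> {}"
  shows "\<exists>m\<in>A. \<forall>x\<in>A. \<not> mono_less x m"
  using assms
proof (induction A rule: finite_ne_induct)
  case (insert x F)
  then show ?case by (metis insert_iff mono_less_irrefl mono_less_trans)
qed simp

lemma finite_mono_max:
  assumes "finite A" "A \<noteq> {}"
  shows "\<exists>m\<in>A. \<forall>x\<in>A. \<not> mono_less m x"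
  using assms
proof (induction A rule: finite_ne_induct)
  case (insert x F)
  then show ?case by (metis insert_iff mono_less_irrefl mono_less_trans)
qed simp

text \<open>Unlike \<open>is_lead\<close> this admits a zero coefficient at \<open>\<mu>\<close>,
  hence is linear in \<open>f\<close>; that is needed while a leading term is being
  cancelled.\<close>

definition low :: "('n::finite, 'a::comm_ring_1) mfps \<Rightarrow> 'n multiset \<Rightarrow> bool"
  where "low f \<mu> \<longleftrightarrow> (\<forall>\<nu>. mono_less \<nu> \<mu> \<longrightarrow> mfps_coeff f \<nu> = 0)"

definition is_lead :: "('n::finite, 'a::comm_ring_1) mfps \<Rightarrow> 'n multiset \<Rightarrow> bool"
  where "is_lead f \<mu> \<longleftrightarrow> low f \<mu> \<and> mfps_coeff f \<mu> \<noteq> 0"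

lemma ex_lead:
  assumes "f \<noteq> 0"
  shows "\<exists>\<mu>. is_lead f \<mu>"
proof -
  obtain \<nu> where \<nu>: "mfps_coeff f \<nu> \<noteq> 0"
    using assms by (metis coeff_zero mfps_eqI)
  let ?A = "{\<mu>. size \<mu> \<le> size \<nu>} \<inter> {\<mu>. mfps_coeff f \<mu> \<noteq> 0}"
  have "\<exists>m\<in>?A. \<forall>x\<in>?A. \<not> mono_less x m"
    by (rule finite_mono_min) (use \<nu> in auto)
  then obtain m where m: "m \<in> ?A" "\<And>x. x \<in> ?A \<Longrightarrow> \<not> mono_less x m" by auto
  have "mfps_coeff f x = 0" if "mono_less x m" for x
  proof (rule ccontr)
    assume "mfps_coeff f x \<noteq> 0"
    moreover have "size x \<le> size m" using that by (auto simp: mono_less_def)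
    ultimately have "x \<in> ?A" using m(1) by auto
    then show False using m(2) that by blast
  qed
  then show ?thesis using m(1) by (auto simp: is_lead_def low_def)
qed

lemma is_lead_unique: "is_lead f \<mu> \<Longrightarrow> is_lead f \<nu> \<Longrightarrow> \<mu> = \<nu>"
  by (metis is_lead_def low_def mono_less_total)

lemma is_lead_nonzero: "is_lead f \<mu> \<Longrightarrow> f \<noteq> 0"
  by (auto simp: is_lead_def)

lemma is_lead_ord_ge: "is_lead f \<mu> \<Longrightarrow> ord_ge UNIV d f \<longleftrightarrow> d \<le> size \<mu>"
  by (auto simp: is_lead_def ord_ge_def low_def mono_less_size not_less[symmetric])

text \<open>A non-zero term needs factors at or above \<open>\<alpha>\<close> and
  \<open>\<beta>\<close>; strict inequality in either one makes the product strictly larger than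
  \<open>\<alpha> + \<beta>\<close>.\<close>

lemma low_mult:
  assumes "low f \<alpha>" "low g \<beta>"
  shows "low (f * g) (\<alpha> + \<beta>)"
    and "mfps_coeff (f * g) (\<alpha> + \<beta>) = mfps_coeff f \<alpha> * mfps_coeff g \<beta>"
proof -
  have *: "mfps_coeff f \<nu> * mfps_coeff g \<kappa> = 0"
    if "mono_less (\<nu> + \<kappa>) (\<alpha> + \<beta>) \<or> \<nu> + \<kappa> = \<alpha> + \<beta> \<and> \<nu> \<noteq> \<alpha>" for \<nu> \<kappa>
  proof (rule ccontr)
    assume "mfps_coeff f \<nu> * mfps_coeff g \<kappa> \<noteq> 0"
    then have "mfps_coeff f \<nu> \<noteq> 0" "mfps_coeff g \<kappa> \<noteq> 0" by auto
    then have "\<nu> = \<alpha> \<or> mono_less \<alpha> \<nu>" "\<kappa> = \<beta> \<or> mono_less \<beta> \<kappa>"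
      using assms mono_less_total unfolding low_def by blast+
    then have "\<nu> = \<alpha> \<and> \<kappa> = \<beta> \<or> mono_less (\<alpha> + \<beta>) (\<nu> + \<kappa>)"
      by (metis mono_less_add_mono union_commute)
    with that show False by (metis mono_less_irrefl mono_less_trans)
  qed
  show "low (f * g) (\<alpha> + \<beta>)"
    unfolding low_def coeff_mult
    by (auto intro!: sum.neutral * simp: subset_mset.add_diff_inverse)
  have "mfps_coeff (f * g) (\<alpha> + \<beta>) =
      (\<Sum>\<nu> | \<nu> \<subseteq># \<alpha> + \<beta>. if \<nu> = \<alpha> then mfps_coeff f \<alpha> * mfps_coeff g \<beta> else 0)"
    unfolding coeff_mult
    by (intro sum.cong) (auto intro!: * simp: subset_mset.add_diff_inverse)
  then show "mfps_coeff (f * g) (\<alpha> + \<beta>) = mfps_coeff f \<alpha> * mfps_coeff g \<beta>"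
    by (simp add: finite_submultisets)
qed

lemma is_lead_mult:
  fixes f g :: "('n::finite, 'a::idom) mfps"
  shows "is_lead f \<alpha> \<Longrightarrow> is_lead g \<beta> \<Longrightarrow> is_lead (f * g) (\<alpha> + \<beta>)"
  by (simp add: is_lead_def low_mult)

instance mfps :: (finite, idom) idom
proof
  fix f g :: "('a, 'b) mfps"
  assume "f \<noteq> 0" "g \<noteq> 0"
  then show "f * g \<noteq> 0" by (metis ex_lead is_lead_mult is_lead_nonzero)
qed

lemma is_lead_1: "is_lead (1 :: ('n::finite, 'a::comm_ring_1) mfps) {#}"
  by (auto simp: is_lead_def low_def mono_less_def coeff_one)

lemma is_lead_power:
  fixes f :: "('n::finite, 'a::idom) mfps"
  shows "is_lead f \<alpha> \<Longrightarrow> is_lead (f ^ k) (repeat_mset k \<alpha>)"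
  by (induction k) (auto simp: is_lead_1 is_lead_mult)

section \<open>Divisibility in the ring of power series\<close>

definition mfps_monom :: "'n multiset \<Rightarrow> ('n, 'a::comm_ring_1) mfps"
  where "mfps_monom \<gamma> = Abs_mfps (\<lambda>\<mu>. if \<mu> = \<gamma> then 1 else 0)"

lemma is_lead_mfps_monom: "is_lead (mfps_monom \<gamma>) \<gamma>"
  by (auto simp: is_lead_def low_def mfps_monom_def)

lemma low_const_mult: "low f \<alpha> \<Longrightarrow> low (mfps_const c * f) \<alpha>"
  by (simp add: low_def)

lemma low_diff: "low f \<alpha> \<Longrightarrow> low g \<alpha> \<Longrightarrow> low (f - g) \<alpha>"
  by (simp add: low_def)

lemma low_lead: "low f \<alpha> \<Longrightarrow> mfps_coeff f \<alpha> = 0 \<Longrightarrow> is_lead f \<beta> \<Longrightarrow> mono_less \<alpha> \<beta>"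
  by (metis is_lead_def low_def mono_less_total)

text \<open>Principal ideals are closed. Multiplication by \<open>b\<close> raises the order by
  exactly \<open>size \<beta>\<close>, so approximate quotients agree to increasing order and
  converge coefficientwise.\<close>

lemma dvd_limit:
  fixes a b :: "('n::finite, 'a::idom) mfps"
  assumes "b \<noteq> 0" and lim: "\<And>M. \<exists>q. ord_ge UNIV M (a - b * q)"
  shows "b dvd a"
proof -
  obtain \<beta> where \<beta>: "is_lead b \<beta>" using ex_lead assms(1) by blast
  have cancel: "ord_ge UNIV M x" if "ord_ge UNIV (M + size \<beta>) (b * x)" for M x
  proof (cases "x = 0")
    case False
    then obtain \<xi> where "is_lead x \<xi>" using ex_lead by blast
    then show ?thesis
      using that \<beta> is_lead_mult[of b \<beta> x \<xi>] by (simp add: is_lead_ord_ge)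
  qed simp
  obtain q where q: "\<And>M. ord_ge UNIV (M + size \<beta>) (a - b * q M)"
    using choice[of "\<lambda>M q. ord_ge UNIV (M + size \<beta>) (a - b * q)"] lim by blast
  define Q where "Q = Abs_mfps (\<lambda>\<mu>. mfps_coeff (q (Suc (size \<mu>))) \<mu>)"
  have Q: "ord_ge UNIV M (Q - q M)" for M
    unfolding ord_ge_def
  proof (intro allI impI)
    fix \<mu> :: "'n multiset" assume *: "deg_in UNIV \<mu> < M"
    let ?K = "Suc (size \<mu>)"
    have "ord_ge UNIV (?K + size \<beta>) ((a - b * q M) - (a - b * q ?K))"
      by (intro ord_ge_diff q ord_ge_mono[OF q[of M]]) (use * in auto)
    then have "ord_ge UNIV (?K + size \<beta>) (b * (q ?K - q M))" by (simp add: algebra_simps)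
    then have "ord_ge UNIV ?K (q ?K - q M)" by (rule cancel)
    then show "mfps_coeff (Q - q M) \<mu> = 0" by (simp add: Q_def ord_ge_def)
  qed
  have "ord_ge UNIV M (a - b * Q)" for M
  proof -
    have "ord_ge UNIV M ((a - b * q M) - b * (Q - q M))"
      by (intro ord_ge_diff ord_ge_mult_left Q ord_ge_mono[OF q[of M]]) auto
    then show ?thesis by (simp add: algebra_simps)
  qed
  then have "a - b * Q = 0" by (rule ord_ge_eq_0)
  then show ?thesis by (metis dvd_triv_left eq_iff_diff_eq_0)
qed

text \<open>
  The hypothesis says that all powers of \<open>a / b\<close> have the common denominator \<open>b ^ N\<close>.  On leading
  monomials it forces that of \<open>b\<close> to divide that of \<open>a\<close>, and it is inherited by \<open>a - b * q\<close>; so \<open>a\<close>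
  can be reduced modulo \<open>b\<close> degree by degree.
\<close>

lemma completely_integrally_closed:
  fixes a b :: "('n::finite, 'a::field) mfps"
  assumes "b \<noteq> 0" and dvd: "\<And>k. b ^ k dvd b ^ N * a ^ k"
  shows "b dvd a"
proof (rule dvd_limit[OF \<open>b \<noteq> 0\<close>], rule ccontr)
  obtain \<beta> where \<beta>: "is_lead b \<beta>" using ex_lead assms(1) by blast
  have dvd': "b ^ k dvd b ^ N * (a - b * q) ^ k" for k q
  proof -
    have "b ^ k dvd b ^ N * (of_nat (k choose j) * a ^ j * (- (b * q)) ^ (k - j))" if "j \<le> k" for j
    proof -
      have "b ^ j * b ^ (k - j) dvd (b ^ N * a ^ j) * (- (b * q)) ^ (k - j)"
        by (intro mult_dvd_mono dvd dvd_power_same) simp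
      moreover have "b ^ j * b ^ (k - j) = b ^ k" using that by (simp flip: power_add)
      ultimately show ?thesis by (metis dvd_mult mult.assoc mult.left_commute)
    qed
    moreover have "a - b * q = a + (- (b * q))" by simp
    ultimately show ?thesis
      by (simp only: binomial_ring sum_distrib_left) (auto intro!: dvd_sum)
  qed
  have sub: "\<beta> \<subseteq># \<alpha>" if \<alpha>: "is_lead (a - b * q) \<alpha>" for \<alpha> q
  proof (rule mset_subset_eqI, rule ccontr)
    fix i assume "\<not> count \<beta> i \<le> count \<alpha> i"
    then have less: "Suc (count \<alpha> i) \<le> count \<beta> i" by simp
    \<comment> \<open>If the exponent of \<open>i\<close> in \<open>\<alpha>\<close> is smaller than
      in \<open>\<beta>\<close>, comparing exponents gives k \<le> N *
      \<open>count \<beta> i\<close>; this \<open>k\<close> is the first value that contradicts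
      it.\<close>
    define k where "k = Suc (N * count \<beta> i)"
    obtain r where r: "b ^ N * (a - b * q) ^ k = b ^ k * r" using dvd' by blast
    have lhs: "is_lead (b ^ N * (a - b * q) ^ k) (repeat_mset N \<beta> + repeat_mset k \<alpha>)"
      by (intro is_lead_mult is_lead_power \<alpha> \<beta>)
    then have "r \<noteq> 0" using r is_lead_nonzero by fastforce
    then obtain \<rho> where "is_lead r \<rho>" using ex_lead by blast
    then have "is_lead (b ^ k * r) (repeat_mset k \<beta> + \<rho>)"
      by (intro is_lead_mult is_lead_power \<beta>)
    then have "repeat_mset N \<beta> + repeat_mset k \<alpha> = repeat_mset k \<beta> + \<rho>"
      using lhs r is_lead_unique by metis
    then have "count (repeat_mset N \<beta> + repeat_mset k \<alpha>) i = count (repeat_mset k \<beta> + \<rho>) i"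
      by simp
    then have "k * count \<beta> i \<le> N * count \<beta> i + k * count \<alpha> i" by simp
    moreover have "k * Suc (count \<alpha> i) \<le> k * count \<beta> i" using less by (rule mult_le_mono2)
    ultimately show False by (simp add: k_def)
  qed
  fix M assume no: "\<nexists>q. ord_ge UNIV M (a - b * q)"
  have lead: "\<exists>\<alpha>. is_lead (a - b * q) \<alpha> \<and> size \<alpha> < M" for q
  proof -
    have "a - b * q \<noteq> 0" using no by (metis ord_ge_zero)
    then obtain \<alpha> where "is_lead (a - b * q) \<alpha>" using ex_lead by blast
    moreover have "size \<alpha> < M" using no calculation is_lead_ord_ge not_less by blast
    ultimately show ?thesis by blast
  qed
  \<comment> \<open>Extremal choice: only finitely many leading monomials lie below degree
    \<open>M\<close>. As \<open>\<beta>\<close> divides the largest of them, a multiple of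
    \<open>b\<close> cancels it and produces a larger one.\<close>
  define B where "B = {\<alpha>. (\<exists>q. is_lead (a - b * q) \<alpha>) \<and> size \<alpha> < M}"
  have "\<exists>m\<in>B. \<forall>x\<in>B. \<not> mono_less m x"
  proof (rule finite_mono_max)
    show "finite B"
      by (rule finite_subset[OF _ finite_multisets_size_le[of M]]) (auto simp: B_def)
    show "B \<noteq> {}" using lead[of 0] unfolding B_def by blast
  qed
  then obtain \<alpha> q where \<alpha>: "is_lead (a - b * q) \<alpha>" and max: "\<And>x. x \<in> B \<Longrightarrow> \<not> mono_less \<alpha> x"
    by (auto simp: B_def)
  obtain \<gamma> where \<gamma>: "\<alpha> = \<beta> + \<gamma>" using sub[OF \<alpha>] by (metis subset_mset.le_iff_add)
  define c where "c = mfps_coeff (a - b * q) \<alpha> / mfps_coeff b \<beta>"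
  let ?t = "b * (mfps_monom \<gamma> :: ('n, 'a) mfps)"
  have t: "low ?t \<alpha>" "mfps_coeff ?t \<alpha> = mfps_coeff b \<beta>"
    using low_mult[of b \<beta> "mfps_monom \<gamma>" \<gamma>] \<beta> is_lead_mfps_monom[of \<gamma>] 
    by (auto simp: is_lead_def \<gamma> mfps_monom_def)
  let ?a = "a - b * q - mfps_const c * ?t"
  have eq: "?a = a - b * (q + mfps_const c * mfps_monom \<gamma>)" by (simp add: algebra_simps)
  have "low ?a \<alpha>"
    by (rule low_diff[OF _ low_const_mult[OF t(1)]]) (use \<alpha> in \<open>simp add: is_lead_def\<close>)
  moreover have "mfps_coeff ?a \<alpha> = 0"
    using \<beta> t by (simp add: c_def is_lead_def)
  moreover obtain \<alpha>' where \<alpha>': "is_lead ?a \<alpha>'" "size \<alpha>' < M" using lead eq by metis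
  ultimately have "mono_less \<alpha> \<alpha>'" using low_lead by blast
  moreover have "\<alpha>' \<in> B" using \<alpha>' eq by (auto simp: B_def)
  ultimately show False using max by blast
qed

section \<open>Common primitives of differentially dependent series\<close>

text \<open>The components of da \<and> db = 0.\<close>

definition diff_dep :: "('n, 'a::comm_ring_1) mfps \<Rightarrow> ('n, 'a) mfps \<Rightarrow> bool"
  where "diff_dep a b \<longleftrightarrow> (\<forall>i j. mfps_deriv i a * mfps_deriv j b = mfps_deriv j a * mfps_deriv i b)"

lemma diff_dep_refl: "diff_dep a a"
  by (simp add: diff_dep_def mult.commute)

lemma diff_dep_sym: "diff_dep a b \<Longrightarrow> diff_dep b a"
  unfolding diff_dep_def by (metis mult.commute)

lemma diff_dep_const: "diff_dep f (mfps_const c)"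
  by (simp add: diff_dep_def)

lemma diff_dep_diff: "diff_dep f a \<Longrightarrow> diff_dep f b \<Longrightarrow> diff_dep f (a - b)"
  by (simp add: diff_dep_def right_diff_distrib)

lemma diff_dep_mult: "diff_dep f a \<Longrightarrow> diff_dep f b \<Longrightarrow> diff_dep f (a * b)"
  unfolding diff_dep_def deriv_mult
  by (simp add: distrib_left mult.left_commute[of "mfps_deriv _ f" a])
    (metis mult.assoc)

lemma diff_dep_power: "diff_dep f a \<Longrightarrow> diff_dep f (a ^ k)"
  by (induction k) (auto intro: diff_dep_mult simp: diff_dep_const[of _ 1, simplified])

text \<open>Constants depend on everything, so df \<noteq> 0 is essential: then da and db are
  multiples of df over the fraction field.\<close>

lemma diff_dep_trans:
  fixes f :: "('n::finite, 'a::idom) mfps"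
  assumes "diff_dep f a" "diff_dep f b" "mfps_deriv m f \<noteq> 0"
  shows "diff_dep a b"
  unfolding diff_dep_def
proof (intro allI)
  fix i j
  let ?f = "mfps_deriv m f"
  have a: "?f * mfps_deriv k a = mfps_deriv k f * mfps_deriv m a" for k
    using assms(1) by (simp add: diff_dep_def)
  have b: "?f * mfps_deriv k b = mfps_deriv k f * mfps_deriv m b" for k
    using assms(2) by (simp add: diff_dep_def)
  have "?f * ?f * (mfps_deriv i a * mfps_deriv j b) = (?f * mfps_deriv i a) * (?f * mfps_deriv j b)"
    by (simp add: algebra_simps)
  also have "\<dots> = (?f * mfps_deriv j a) * (?f * mfps_deriv i b)"
    unfolding a b by (simp add: algebra_simps)
  also have "\<dots> = ?f * ?f * (mfps_deriv j a * mfps_deriv i b)"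
    by (simp add: algebra_simps)
  finally show "mfps_deriv i a * mfps_deriv j b = mfps_deriv j a * mfps_deriv i b"
    using assms(3) by simp
qed

lemma diff_dep_cancel:
  fixes f :: "('n::finite, 'a::idom) mfps"
  assumes "diff_dep f g" "diff_dep f (g * a)" "g \<noteq> 0"
  shows "diff_dep f a"
  unfolding diff_dep_def
proof (intro allI)
  fix i j
  have g: "mfps_deriv i f * mfps_deriv j g = mfps_deriv j f * mfps_deriv i g"
    using assms(1) by (simp add: diff_dep_def)
  have "mfps_deriv i f * mfps_deriv j (g * a) = mfps_deriv j f * mfps_deriv i (g * a)"
    using assms(2) by (simp add: diff_dep_def)
  then have "(mfps_deriv i f * mfps_deriv j g) * a + g * (mfps_deriv i f * mfps_deriv j a) =
      (mfps_deriv j f * mfps_deriv i g) * a + g * (mfps_deriv j f * mfps_deriv i a)"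
    by (simp add: deriv_mult algebra_simps)
  then show "mfps_deriv i f * mfps_deriv j a = mfps_deriv j f * mfps_deriv i a"
    using assms(3) by (simp add: g)
qed

text \<open>
  Comparing leading coefficients in \<open>da \<and> db = 0\<close> shows that the exponent vectors of the leading
  monomials are parallel.
\<close>

lemma diff_dep_lead:
  fixes a b :: "('n::finite, 'a::{idom, ring_char_0}) mfps"
  assumes "diff_dep a b" "is_lead a \<alpha>" "is_lead b \<beta>" "size \<alpha> = size \<beta>"
  shows "\<alpha> = \<beta>"
proof -
  have euler: "low (euler1 i f) \<mu>" if "is_lead f \<mu>" for i and f :: "('n, 'a) mfps" and \<mu>
    using that by (simp add: low_def coeff_euler1 is_lead_def)
  have par: "count \<alpha> i * count \<beta> j = count \<alpha> j * count \<beta> i" for i j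
  proof -
    have "mfps_deriv i a * mfps_deriv j b = mfps_deriv j a * mfps_deriv i b"
      using assms(1) by (simp add: diff_dep_def)
    then have "euler1 i a * euler1 j b = euler1 j a * euler1 i b"
      unfolding euler1_def by (metis (no_types, lifting) mult.assoc mult.left_commute)
    then have "mfps_coeff (euler1 i a) \<alpha> * mfps_coeff (euler1 j b) \<beta> =
        mfps_coeff (euler1 j a) \<alpha> * mfps_coeff (euler1 i b) \<beta>"
      using euler[OF assms(2)] euler[OF assms(3)] low_mult(2) by metis
    then have "(of_nat (count \<alpha> i * count \<beta> j) :: 'a) * (mfps_coeff a \<alpha> * mfps_coeff b \<beta>) =
        of_nat (count \<alpha> j * count \<beta> i) * (mfps_coeff a \<alpha> * mfps_coeff b \<beta>)"
      by (simp add: coeff_euler1 mult_ac)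
    then have "(of_nat (count \<alpha> i * count \<beta> j) :: 'a) = of_nat (count \<alpha> j * count \<beta> i)"
      using assms(2,3) by (simp add: is_lead_def)
    then show ?thesis by (simp only: of_nat_eq_iff)
  qed
  have size: "size \<mu> = (\<Sum>j\<in>UNIV. count \<mu> j)" for \<mu> :: "'n multiset"
    using deg_in_sum[of UNIV \<mu>] by simp
  show ?thesis
  proof (rule multiset_eqI)
    fix i
    have "count \<alpha> i * size \<beta> = size \<alpha> * count \<beta> i"
      unfolding size sum_distrib_left sum_distrib_right using par by simp
    then show "count \<alpha> i = count \<beta> i"
      using assms(4) by (cases "size \<beta> = 0") auto
  qed
qed

text \<open>
  One element \<open>e\<close> of the ring \<open>{a. diff_dep f a}\<close> is chosen for each residue class of orders modulo
  the order of \<open>g\<close>.  Since leading terms of equal order are proportional, an element of large order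
  can be expanded in terms \<open>g ^ l * e\<close> with \<open>l \<ge> k\<close>.
\<close>

lemma diff_dep_conductor:
  fixes f g :: "('n::finite, 'a::field_char_0) mfps"
  assumes f: "mfps_deriv m f \<noteq> 0" and g: "diff_dep f g" "is_lead g \<gamma>" "\<gamma> \<noteq> {#}"
  shows "\<exists>N. \<forall>k a. diff_dep f a \<longrightarrow> ord_ge UNIV ((k + N) * size \<gamma>) a \<longrightarrow> g ^ k dvd a"
proof -
  define p where "p = size \<gamma>"
  have p: "p > 0" using g(3) by (simp add: p_def nonempty_has_size)
  define P where
    "P j n \<longleftrightarrow> (\<exists>e \<epsilon>. diff_dep f e \<and> is_lead e \<epsilon> \<and> size \<epsilon> mod p = j \<and> size \<epsilon> = n)" for j n
  \<comment> \<open>Any realised order will do, not only the least; for a class without realised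
    order \<open>n\<close> is arbitrary.\<close>
  have "\<forall>j. \<exists>n. \<forall>n'. P j n' \<longrightarrow> P j n" by blast
  then obtain n where n: "\<And>j n'. P j n' \<Longrightarrow> P j (n j)"
    using choice[of "\<lambda>j n. \<forall>n'. P j n' \<longrightarrow> P j n"] by blast
  \<comment> \<open>Any common bound of the chosen orders works. Since \<epsilon> has size at most N
    \<le> N * p, order at least (k + N) * p leaves room for l \<ge> k factors
    \<open>g\<close>.\<close>
  define N where "N = (\<Sum>j<p. n j)"
  have N: "n j \<le> N" if "j < p" for j
    unfolding N_def using that by (intro member_le_sum) auto
  have "g ^ k dvd a" if a: "diff_dep f a" "ord_ge UNIV ((k + N) * p) a" for k a
  proof (rule dvd_limit)
    show "g ^ k \<noteq> 0" using g(2) is_lead_nonzero by auto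
    have "\<exists>q. ord_ge UNIV M (a - g ^ k * q) \<and> diff_dep f (a - g ^ k * q) \<and>
        ord_ge UNIV ((k + N) * p) (a - g ^ k * q)" for M
    proof (induction M)
      case 0
      show ?case by (rule exI[of _ 0]) (use a in auto)
    next
      case (Suc M)
      then obtain q where q: "ord_ge UNIV M (a - g ^ k * q)" "diff_dep f (a - g ^ k * q)"
        "ord_ge UNIV ((k + N) * p) (a - g ^ k * q)" by blast
      let ?a = "a - g ^ k * q"
      show ?case
      proof (cases "ord_ge UNIV (Suc M) ?a")
        case False
        then have "?a \<noteq> 0" using ord_ge_zero by metis
        then obtain \<alpha> where \<alpha>: "is_lead ?a \<alpha>" using ex_lead by blast
        have size: "size \<alpha> = M" "(k + N) * p \<le> M"
          using False q(1,3) by (auto simp: is_lead_ord_ge[OF \<alpha>])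
        have "P (M mod p) M" using q(2) \<alpha> size unfolding P_def by blast
        then obtain e \<epsilon> where e: "diff_dep f e" "is_lead e \<epsilon>" "size \<epsilon> mod p = M mod p"
          "size \<epsilon> = n (M mod p)" using n unfolding P_def by blast
        have "size \<epsilon> \<le> N" using e(4) N p by simp
        also have "N \<le> N * p" using p by simp
        finally have eN: "size \<epsilon> \<le> N * p" .
        then have "size \<epsilon> + k * p \<le> M" using size(2) by (simp add: algebra_simps)
        moreover obtain l where "M = size \<epsilon> + l * p"
        proof -
          have "M = size \<epsilon> + (M - size \<epsilon>) div p * p"
            using calculation e(3) by (metis add_leD1 dvd_div_mult_self le_add_diff_inverse mod_eq_dvd_iff_nat)
          then show ?thesis using that by blast
        qed
        ultimately have l: "M = size \<epsilon> + l * p" "k \<le> l" using p by auto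
        let ?t = "g ^ l * e"
        have t: "diff_dep f ?t" "is_lead ?t (repeat_mset l \<gamma> + \<epsilon>)"
          using g e by (auto intro!: diff_dep_mult diff_dep_power is_lead_mult is_lead_power)
        have "\<alpha> = repeat_mset l \<gamma> + \<epsilon>"
        proof (rule diff_dep_lead[OF _ \<alpha> t(2)])
          show "diff_dep ?a ?t" using diff_dep_trans[OF q(2) t(1) f] .
          show "size \<alpha> = size (repeat_mset l \<gamma> + \<epsilon>)" using size l by (simp add: p_def)
        qed
        then have t': "low ?t \<alpha>" "mfps_coeff ?t \<alpha> \<noteq> 0" using t(2) by (auto simp: is_lead_def)
        define c where "c = mfps_coeff ?a \<alpha> / mfps_coeff ?t \<alpha>"
        let ?b = "?a - mfps_const c * ?t"
        have "g ^ l = g ^ k * g ^ (l - k)" using l(2) by (simp flip: power_add)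
        then have eq: "?b = a - g ^ k * (q + mfps_const c * (g ^ (l - k) * e))"
          by (simp add: algebra_simps)
        have b: "diff_dep f ?b"
          by (intro diff_dep_diff q diff_dep_mult[OF diff_dep_const] t)
        \<comment> \<open>Cancelling one monomial raises the whole order: by
          \<open>diff_dep_lead\<close> a new leading monomial of the same size would again be
          \<open>\<alpha>\<close>.\<close>
        have "ord_ge UNIV (Suc M) ?b"
        proof (cases "?b = 0")
          case False
          then obtain \<beta> where \<beta>: "is_lead ?b \<beta>" using ex_lead by blast
          have "low ?b \<alpha>" "mfps_coeff ?b \<alpha> = 0"
            using \<alpha> t' by (auto intro!: low_diff low_const_mult simp: is_lead_def c_def)
          then have less: "mono_less \<alpha> \<beta>" using \<beta> low_lead by blast
          then have "\<alpha> \<noteq> \<beta>" by auto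
          moreover have "diff_dep ?a ?b" using diff_dep_trans[OF q(2) b f] .
          ultimately have "size \<alpha> \<noteq> size \<beta>" using diff_dep_lead \<alpha> \<beta> by blast
          then have "size \<alpha> < size \<beta>" using less by (simp add: mono_less_def)
          then show ?thesis using \<beta> size by (simp add: is_lead_ord_ge)
        qed (metis ord_ge_zero)
        moreover from this have "ord_ge UNIV ((k + N) * p) ?b"
          by (rule ord_ge_mono) (use size in simp)
        ultimately show ?thesis using b eq by metis
      qed (use q in blast)
    qed
    then show "\<exists>q. ord_ge UNIV M (a - g ^ k * q)" for M by blast
  qed
  then show ?thesis unfolding p_def by blast
qed

text \<open>
  The primitive \<open>g\<close> is a non-zero element without constant term of least order in the ring
  \<open>{a. diff_dep f a}\<close>.  By the conductor and complete integral closedness it divides every other such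
  element, with quotient in the ring again.
\<close>

lemma ex_primitive:
  fixes f :: "('n::finite, 'a::field_char_0) mfps"
  assumes f: "mfps_deriv m f \<noteq> 0"
  shows "\<exists>g. mfps_coeff g {#} = 0 \<and> (\<forall>a. diff_dep f a \<longrightarrow>
    (\<exists>c. \<forall>M. ord_ge UNIV M (a - (\<Sum>k<M. mfps_const (c k) * g ^ k))))"
proof -
  let ?P = "\<lambda>n. \<exists>g \<gamma>. diff_dep f g \<and> mfps_coeff g {#} = 0 \<and> is_lead g \<gamma> \<and> size \<gamma> = n"
  have "\<exists>n. ?P n"
  proof -
    let ?g = "f - mfps_const (mfps_coeff f {#})"
    have "mfps_deriv m ?g \<noteq> 0" using f by simp
    then have "?g \<noteq> 0" by (metis deriv_0)
    then obtain \<gamma> where "is_lead ?g \<gamma>" using ex_lead by blast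
    moreover have "diff_dep f ?g" by (intro diff_dep_diff diff_dep_refl diff_dep_const)
    moreover have "mfps_coeff ?g {#} = 0" by (simp add: coeff_const)
    ultimately show ?thesis by blast
  qed
  then have "?P (LEAST n. ?P n)" by (rule LeastI_ex)
  then obtain g \<gamma> where g: "diff_dep f g" "mfps_coeff g {#} = 0" "is_lead g \<gamma>"
    and "size \<gamma> = (LEAST n. ?P n)" by blast
  then have min: "size \<gamma> \<le> n" if "?P n" for n using Least_le[of ?P n] that by simp
  have \<gamma>: "\<gamma> \<noteq> {#}" using g by (auto simp: is_lead_def)
  obtain N where N: "\<And>k a. diff_dep f a \<Longrightarrow> ord_ge UNIV ((k + N) * size \<gamma>) a \<Longrightarrow> g ^ k dvd a"
    using diff_dep_conductor[OF f g(1,3) \<gamma>] by blast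
  have dvd: "g dvd a" if a: "diff_dep f a" "mfps_coeff a {#} = 0" for a
  proof (rule completely_integrally_closed)
    show "g \<noteq> 0" using g(3) is_lead_nonzero by blast
    have ord: "ord_ge UNIV (size \<gamma>) a"
    proof (cases "a = 0")
      case False
      then obtain \<alpha> where "is_lead a \<alpha>" using ex_lead by blast
      then show ?thesis using min a is_lead_ord_ge by blast
    qed simp
    \<comment> \<open>Minimality of \<open>size \<gamma>\<close> gives \<open>a ^ k\<close> order at
      least \<open>k * size \<gamma>\<close>; the factor \<open>g ^ N\<close> adds exactly the
      surplus demanded by the conductor.\<close>
    show "g ^ k dvd g ^ N * a ^ k" for k
    proof (rule N)
      show "diff_dep f (g ^ N * a ^ k)" by (intro diff_dep_mult diff_dep_power g a)
      have "ord_ge UNIV (N * size \<gamma> + k * size \<gamma>) (g ^ N * a ^ k)"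
        by (intro ord_ge_mult ord_ge_power ord) (simp add: is_lead_ord_ge[OF g(3)])
      then show "ord_ge UNIV ((k + N) * size \<gamma>) (g ^ N * a ^ k)" by (simp add: algebra_simps)
    qed
  qed
  have step: "\<exists>b. diff_dep f b \<and> a = mfps_const (mfps_coeff a {#}) + g * b"
    if a: "diff_dep f a" for a
  proof -
    let ?a = "a - mfps_const (mfps_coeff a {#})"
    have d: "diff_dep f ?a" by (intro diff_dep_diff a diff_dep_const)
    then obtain b where b: "?a = g * b" using dvd[of ?a] by (auto simp: coeff_const)
    then have "diff_dep f b"
      using diff_dep_cancel[OF g(1)] d is_lead_nonzero[OF g(3)] by metis
    then show ?thesis using b by (metis add.commute diff_add_cancel)
  qed
  \<comment> \<open>Iterated division by \<open>g\<close> yields the g-adic expansion, whose k-th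
    coefficient is the constant term of the k-th quotient.\<close>
  then obtain nxt where nxt: "\<And>a. diff_dep f a \<Longrightarrow> diff_dep f (nxt a)"
    "\<And>a. diff_dep f a \<Longrightarrow> a = mfps_const (mfps_coeff a {#}) + g * nxt a" by metis
  have "ord_ge UNIV M (a - (\<Sum>k<M. mfps_const (mfps_coeff ((nxt ^^ k) a) {#}) * g ^ k))"
    if a: "diff_dep f a" for a M
  proof -
    have d: "diff_dep f ((nxt ^^ k) a)" for k by (induction k) (auto intro: a nxt(1))
    have "a - (\<Sum>k<M. mfps_const (mfps_coeff ((nxt ^^ k) a) {#}) * g ^ k) = g ^ M * (nxt ^^ M) a"
    proof (induction M)
      case (Suc M)
      have "g ^ M * (nxt ^^ M) a =
          g ^ M * (mfps_const (mfps_coeff ((nxt ^^ M) a) {#}) + g * (nxt ^^ Suc M) a)"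
        using nxt(2)[OF d[of M]] by simp
      with Suc show ?case by (simp add: algebra_simps)
    qed simp
    moreover have "ord_ge UNIV (M * 1) (g ^ M)"
      by (intro ord_ge_power) (simp add: ord_ge_UNIV_1 g del: One_nat_def)
    ultimately show ?thesis by (simp add: ord_ge_mult_right)
  qed
  then have "\<And>a. diff_dep f a \<Longrightarrow> \<exists>c. \<forall>M. ord_ge UNIV M (a - (\<Sum>k<M. mfps_const (c k) * g ^ k))"
    by (metis (no_types))
  then show ?thesis using g(2) by blast
qed

text \<open>\<open>F\<close> and \<open>H\<close> are series in one variable, encoded as series in
  two that are constant in the first. So substitution of (s, g) serves them for every
  \<open>s\<close>, as the final pull-back requires.\<close>

lemma ex_common_primitive:
  fixes f h :: "('n::finite, 'a::field_char_0) mfps"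
  assumes "diff_dep f h"
  shows "\<exists>g F H. mfps_coeff g {#} = 0 \<and> mfps_deriv 1 F = 0 \<and> mfps_deriv 1 H = 0 \<and>
    (\<forall>s. mfps_coeff s {#} = 0 \<longrightarrow> mfps_subst (vector [s, g] :: ('n, 'a) mfps ^ 2) F = f \<and>
      mfps_subst (vector [s, g] :: ('n, 'a) mfps ^ 2) H = h)"
proof -
  have "\<exists>g. mfps_coeff g {#} = 0 \<and> (\<forall>a\<in>{f, h}.
    (\<exists>c. \<forall>M. ord_ge UNIV M (a - (\<Sum>k<M. mfps_const (c k) * g ^ k))))"
  proof (cases "\<exists>m. mfps_deriv m f \<noteq> 0 \<or> mfps_deriv m h \<noteq> 0")
    case True
    then consider m where "mfps_deriv m f \<noteq> 0" | m where "mfps_deriv m h \<noteq> 0" by blast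
    then show ?thesis
    proof cases
      case 1
      show ?thesis using ex_primitive[OF 1] assms diff_dep_refl by blast
    next
      case 2
      show ?thesis using ex_primitive[OF 2] assms diff_dep_refl diff_dep_sym by blast
    qed
  next
    case False
    \<comment> \<open>When df = dh = 0 both series are constants and \<open>g = 0\<close> is a
      primitive.\<close>
    have const: "a = mfps_const (mfps_coeff a {#})" if "\<And>m. mfps_deriv m a = 0" for a :: "('n, 'a) mfps"
    proof (rule mfps_eqI)
      fix \<mu>
      show "mfps_coeff a \<mu> = mfps_coeff (mfps_const (mfps_coeff a {#})) \<mu>"
      proof (cases \<mu>)
        case (add i \<nu>)
        have "mfps_coeff (mfps_deriv i a) \<nu> = 0" using that by simp
        then have "mfps_coeff a (add_mset i \<nu>) = 0"
          unfolding coeff_deriv by (metis mult_eq_0_iff nat.distinct(1) of_nat_eq_0_iff)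
        then show ?thesis using add by (simp add: coeff_const)
      qed (simp add: coeff_const)
    qed
    have *: "ord_ge UNIV M (a - (\<Sum>k<M. mfps_const (if k = 0 then mfps_coeff a {#} else 0) * 0 ^ k))"
      if "a \<in> {f, h}" for a M
    proof (cases M)
      case (Suc M')
      have "(\<Sum>k<M. mfps_const (if k = 0 then mfps_coeff a {#} else 0) * 0 ^ k) =
          (\<Sum>k<M. if k = 0 then a else 0)"
        using const[of a] that False by (intro sum.cong) auto
      then show ?thesis using Suc by simp
    qed simp
    have "\<exists>c. \<forall>M. ord_ge UNIV M (a - (\<Sum>k<M. mfps_const (c k) * 0 ^ k))" if "a \<in> {f, h}" for a
      by (rule exI[of _ "\<lambda>k. if k = 0 then mfps_coeff a {#} else 0"]) (use *[OF that] in blast)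
    then show ?thesis by (intro exI[of _ 0] conjI ballI) simp_all
  qed
  then obtain g where g: "mfps_coeff g {#} = 0" and
    ex: "\<And>a. a \<in> {f, h} \<Longrightarrow> \<exists>c. \<forall>M. ord_ge UNIV M (a - (\<Sum>k<M. mfps_const (c k) * g ^ k))" by blast
  have "\<exists>F. mfps_deriv 1 F = 0 \<and> (\<forall>s. mfps_coeff s {#} = 0 \<longrightarrow>
      mfps_subst (vector [s, g] :: ('n, 'a) mfps ^ 2) F = a)" if a: "a \<in> {f, h}" for a
  proof -
    obtain c where c: "\<And>M. ord_ge UNIV M (a - (\<Sum>k<M. mfps_const (c k) * g ^ k))"
      using ex[OF a] by blast
    define F :: "(2, 'a) mfps" where "F = Abs_mfps (\<lambda>\<kappa>. if 1 \<in># \<kappa> then 0 else c (size \<kappa>))"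
    have "mfps_deriv 1 F = 0"
      by (rule mfps_eqI) (simp add: coeff_deriv F_def)
    moreover have "mfps_subst (vector [s, g] :: ('n, 'a) mfps ^ 2) F = a"
      if s: "mfps_coeff s {#} = 0" for s
    proof (rule mfps_eqI)
      fix \<mu> :: "'n multiset"
      let ?\<phi> = "vector [s, g] :: ('n, 'a) mfps ^ 2"
      have rep: "\<kappa> = replicate_mset (size \<kappa>) 2" if "1 \<notin># \<kappa>" for \<kappa> :: "2 multiset"
      proof -
        have "x = 2" if "x \<in># \<kappa>" for x
          using that \<open>1 \<notin># \<kappa>\<close> exhaust_2[of x] by auto
        then show ?thesis by (intro set_mset_subset_singletonD) auto
      qed
      have "mfps_coeff (mfps_subst ?\<phi> F) \<mu> = (\<Sum>\<kappa> | size \<kappa> \<le> size \<mu> \<and> 1 \<notin># \<kappa>.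
          c (size \<kappa>) * mfps_coeff (\<Prod>k\<in>#\<kappa>. ?\<phi> $ k) \<mu>)"
        unfolding coeff_subst by (rule sum.mono_neutral_cong_right) (auto simp: F_def)
      also have "\<dots> = (\<Sum>k<Suc (size \<mu>). c k * mfps_coeff (g ^ k) \<mu>)"
      proof (rule sum.reindex_bij_witness[of _ "\<lambda>k. replicate_mset k 2" size])
        fix \<kappa> :: "2 multiset" assume "\<kappa> \<in> {\<kappa>. size \<kappa> \<le> size \<mu> \<and> 1 \<notin># \<kappa>}"
        then have "\<kappa> = replicate_mset (size \<kappa>) 2" using rep by blast
        then have "(\<Prod>k\<in>#\<kappa>. ?\<phi> $ k) = (\<Prod>k\<in>#replicate_mset (size \<kappa>) 2. ?\<phi> $ k)" by simp
        also have "\<dots> = g ^ size \<kappa>" by simp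
        finally show "c (size \<kappa>) * mfps_coeff (g ^ size \<kappa>) \<mu> =
            c (size \<kappa>) * mfps_coeff (\<Prod>k\<in>#\<kappa>. ?\<phi> $ k) \<mu>" by simp
      qed (auto simp: rep[symmetric])
      also have "\<dots> = mfps_coeff (\<Sum>k<Suc (size \<mu>). mfps_const (c k) * g ^ k) \<mu>"
        by (simp add: coeff_sum)
      also have "\<dots> = mfps_coeff a \<mu>"
        using c[of "Suc (size \<mu>)"] by (simp add: ord_ge_def del: sum.lessThan_Suc)
      finally show "mfps_coeff (mfps_subst ?\<phi> F) \<mu> = mfps_coeff a \<mu>" .
    qed
    ultimately show ?thesis by blast
  qed
  from this[of f] this[of h] show ?thesis using g by simp blast
qed

section \<open>Euler fields and fixed points\<close>

definition euler :: "'n set \<Rightarrow> ('n, 'a::comm_ring_1) mfps \<Rightarrow> ('n, 'a) mfps"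
  where "euler S f = Abs_mfps (\<lambda>\<mu>. of_nat (deg_in S \<mu>) * mfps_coeff f \<mu>)"

text \<open>Division by zero gives 0 on monomials of S-degree 0, so this inverts
  \<open>euler S\<close> only on series of S-order at least 1.\<close>

definition inv_euler :: "'n set \<Rightarrow> ('n, 'a::field) mfps \<Rightarrow> ('n, 'a) mfps"
  where "inv_euler S f = Abs_mfps (\<lambda>\<mu>. mfps_coeff f \<mu> / of_nat (deg_in S \<mu>))"

lemma coeff_euler: "mfps_coeff (euler S f) \<mu> = of_nat (deg_in S \<mu>) * mfps_coeff f \<mu>"
  by (simp add: euler_def)

lemma coeff_inv_euler: "mfps_coeff (inv_euler S f) \<mu> = mfps_coeff f \<mu> / of_nat (deg_in S \<mu>)"
  by (simp add: inv_euler_def)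

lemma euler_sum:
  fixes f :: "('n::finite, 'a::comm_ring_1) mfps"
  shows "euler S f = (\<Sum>i\<in>S. mfps_X i * mfps_deriv i f)"
proof (rule mfps_eqI)
  fix \<mu>
  have "mfps_coeff (\<Sum>i\<in>S. mfps_X i * mfps_deriv i f) \<mu> = (\<Sum>i\<in>S. mfps_coeff (euler1 i f) \<mu>)"
    by (simp add: euler1_def coeff_sum)
  then show "mfps_coeff (euler S f) \<mu> = mfps_coeff (\<Sum>i\<in>S. mfps_X i * mfps_deriv i f) \<mu>"
    by (simp add: coeff_euler coeff_euler1 deg_in_sum sum_distrib_right)
qed

lemma euler_add [simp]: "euler S (f + g) = euler S f + euler S g"
  by (rule mfps_eqI) (simp add: coeff_euler algebra_simps)

lemma euler_diff [simp]: "euler S (f - g) = euler S f - euler S g"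
  by (rule mfps_eqI) (simp add: coeff_euler algebra_simps)

lemma euler_0 [simp]: "euler S 0 = 0"
  by (rule mfps_eqI) (simp add: coeff_euler)

lemma euler_1 [simp]: "euler S 1 = 0"
  by (rule mfps_eqI) (simp add: coeff_euler coeff_one)

lemma euler_X: "i \<notin> S \<Longrightarrow> euler S (mfps_X i) = 0"
  by (rule mfps_eqI) (simp add: coeff_euler coeff_X)

lemma euler_mult:
  fixes f g :: "('n::finite, 'a::comm_ring_1) mfps"
  shows "euler S (f * g) = euler S f * g + f * euler S g"
  by (simp add: euler_sum deriv_mult sum_distrib_left sum_distrib_right sum.distrib algebra_simps)

lemma deriv_euler:
  "mfps_deriv k (euler S f) = euler S (mfps_deriv k f) + (if k \<in> S then mfps_deriv k f else 0)"
  by (rule mfps_eqI) (simp add: coeff_deriv coeff_euler algebra_simps)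

lemma ord_ge_euler_1: "ord_ge S 1 (euler S f)"
  by (simp add: ord_ge_def coeff_euler)

lemma euler_inv_euler:
  fixes f :: "('n, 'a::field_char_0) mfps"
  assumes "ord_ge S 1 f"
  shows "euler S (inv_euler S f) = f"
  using assms by (intro mfps_eqI) (auto simp: ord_ge_def coeff_euler coeff_inv_euler)

lemma ord_ge_inv_euler: "ord_ge S d f \<Longrightarrow> ord_ge S d (inv_euler S f)"
  by (simp add: ord_ge_def coeff_inv_euler)

lemma inv_euler_diff: "inv_euler S (f - g) = inv_euler S f - inv_euler S g"
  by (rule mfps_eqI) (simp add: coeff_inv_euler diff_divide_distrib)

lemma deriv_inv_euler_0:
  "k \<notin> S \<Longrightarrow> mfps_deriv k f = 0 \<Longrightarrow> mfps_deriv k (inv_euler S f) = 0"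
proof (rule mfps_eqI)
  fix \<mu> assume "k \<notin> S" "mfps_deriv k f = 0"
  then have "mfps_coeff (mfps_deriv k f) \<mu> = 0" by simp
  with \<open>k \<notin> S\<close> show "mfps_coeff (mfps_deriv k (inv_euler S f)) \<mu> = mfps_coeff 0 \<mu>"
    by (simp add: coeff_deriv coeff_inv_euler del: of_nat_Suc)
qed

text \<open>In S-degree d the operator E + c is multiplication by c + d, non-zero in characteristic
  0. The value c = 1 belongs to coefficients of dx_k with k in S, because the Lie derivative of dx_k
  along the Euler field is dx_k.\<close>

lemma ord_ge_euler_step:
  fixes f :: "('n, 'a::field_char_0) mfps"
  assumes "ord_ge S d f" "ord_ge S (Suc d) (euler S f + of_nat c * f)" "c + d > 0"
  shows "ord_ge S (Suc d) f"
  unfolding ord_ge_def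
proof (intro allI impI)
  fix \<mu> assume *: "deg_in S \<mu> < Suc d"
  have c: "of_nat c * f = mfps_const (of_nat c) * f"
  proof -
    have "of_nat c = (mfps_const (of_nat c) :: ('n, 'a) mfps)"
      by (induction c) (auto intro!: mfps_eqI simp: coeff_const coeff_one)
    then show ?thesis by simp
  qed
  have "(of_nat (deg_in S \<mu>) + of_nat c) * mfps_coeff f \<mu> = 0"
    using assms(2) * unfolding c by (simp add: ord_ge_def coeff_euler distrib_right)
  then have "of_nat (deg_in S \<mu> + c) * mfps_coeff f \<mu> = 0" by simp
  then show "mfps_coeff f \<mu> = 0"
    using assms(1,3) * unfolding mult_eq_0_iff of_nat_eq_0_iff ord_ge_def
    by (metis add_is_0 less_SucE not_gr_zero add.commute)
qed

text \<open>Banach's theorem for the S-order: the coefficient of \<mu> is stationary from the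
  iterate with number \<open>deg_in S \<mu>\<close> on.\<close>

lemma fixed_point:
  assumes T: "\<And>z. ord_ge S 1 z \<Longrightarrow> ord_ge S 1 (T z)"
    and contr: "\<And>z z' d. ord_ge S 1 z \<Longrightarrow> ord_ge S 1 z' \<Longrightarrow> ord_ge S d (z - z') \<Longrightarrow>
      ord_ge S (Suc d) (T z - T z')"
  shows "\<exists>z. ord_ge S 1 z \<and> T z = z"
proof -
  define z where "z n = (T ^^ n) 0" for n
  have z1: "ord_ge S 1 (z n)" for n
    by (induction n) (auto simp: z_def intro: T[unfolded One_nat_def])
  have step: "ord_ge S (Suc n) (z (Suc n) - z n)" for n
  proof (induction n)
    case 0
    show ?case using z1[of 1] by (simp add: z_def)
  next
    case (Suc n)
    from contr[OF z1 z1 this] show ?case by (simp add: z_def)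
  qed
  have diff: "ord_ge S (Suc n) (z (n + k) - z n)" for n k
  proof (induction k)
    case (Suc k)
    have "ord_ge S (Suc n) ((z (n + Suc k) - z (n + k)) + (z (n + k) - z n))"
      by (intro ord_ge_add Suc ord_ge_mono[OF step[of "n + k", folded add_Suc_right]]) simp
    then show ?case by simp
  qed simp
  define Z where "Z = Abs_mfps (\<lambda>\<mu>. mfps_coeff (z (deg_in S \<mu>)) \<mu>)"
  have Z: "ord_ge S (Suc n) (Z - z n)" for n
    unfolding ord_ge_def
  proof (intro allI impI)
    fix \<mu> assume "deg_in S \<mu> < Suc n"
    then have "ord_ge S (Suc (deg_in S \<mu>)) (z n - z (deg_in S \<mu>))"
      using diff[of "deg_in S \<mu>" "n - deg_in S \<mu>"] by simp
    then show "mfps_coeff (Z - z n) \<mu> = 0" by (simp add: ord_ge_def Z_def)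
  qed
  have Z1: "ord_ge S 1 Z" using Z[of 0] by (simp add: z_def)
  have "ord_ge S n (T Z - Z)" for n
  proof -
    have "ord_ge S n ((T Z - T (z n)) - (Z - z (Suc n)))"
      by (intro ord_ge_diff ord_ge_mono[OF contr[OF Z1 z1 Z]] ord_ge_mono[OF Z]) auto
    then show ?thesis by (simp add: z_def)
  qed
  then have "T Z - Z = 0" by (rule ord_ge_eq_0)
  then show ?thesis using Z1 by auto
qed

lemma mfps_unit:
  fixes f :: "('n, 'a::field) mfps"
  assumes "mfps_coeff f {#} \<noteq> 0"
  shows "\<exists>g. f * g = 1"
proof -
  let ?c = "mfps_const (1 / mfps_coeff f {#})"
  let ?r = "1 - ?c * f"
  have r: "ord_ge UNIV 1 ?r"
    using assms by (simp add: ord_ge_UNIV_1 coeff_one coeff_const del: One_nat_def)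
  \<comment> \<open>The equation says (1 - r) (1 + z) = 1, so 1 + z is the geometric series in r = 1
    - c f.\<close>
  have "\<exists>z. ord_ge UNIV 1 z \<and> ?r * (1 + z) = z"
  proof (rule fixed_point)
    fix z z' :: "('n, 'a) mfps" and d
    assume "ord_ge UNIV d (z - z')"
    then have "ord_ge UNIV (1 + d) (?r * (z - z'))" using r by (rule ord_ge_mult[rotated])
    then show "ord_ge UNIV (Suc d) (?r * (1 + z) - ?r * (1 + z'))" by (simp add: algebra_simps)
  qed (rule ord_ge_mult_right[OF r])
  then obtain z where "?r * (1 + z) = z" by blast
  then have "f * (?c * (1 + z)) = 1" by (simp add: algebra_simps)
  then show ?thesis by blast
qed

section \<open>Congruences modulo high S-order\<close>

lemma rel_mult:
  assumes "ord_ge S d (f - f')" "ord_ge S d (g - g')"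
  shows "ord_ge S d (f * g - f' * g')"
proof -
  have "ord_ge S d (f * (g - g') + (f - f') * g')"
    by (intro ord_ge_add ord_ge_mult_left ord_ge_mult_right assms)
  then show ?thesis by (simp add: algebra_simps)
qed

text \<open>Products of two small factors gain an order, which is what makes the non-linear terms of
  a fixed point problem contracting.\<close>

lemma rel_mult_Suc:
  assumes "ord_ge S d (f - f')" "ord_ge S d (g - g')" "ord_ge S 1 f" "ord_ge S 1 g'"
  shows "ord_ge S (Suc d) (f * g - f' * g')"
proof -
  have "ord_ge S (Suc d) (f * (g - g') + (f - f') * g')"
    using ord_ge_mult[OF assms(3,2)] ord_ge_mult[OF assms(1,4)] by (intro ord_ge_add) auto
  then show ?thesis by (simp add: algebra_simps)
qed

lemma rel_subst:
  assumes "\<And>k. ord_ge S d (\<phi> $ k - \<psi> $ k)"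
  shows "ord_ge S d (mfps_subst \<phi> P - mfps_subst \<psi> P)"
  unfolding ord_ge_def
proof (intro allI impI)
  fix \<mu> assume *: "deg_in S \<mu> < d"
  have "ord_ge S d ((\<Prod>k\<in>#\<kappa>. \<phi> $ k) - (\<Prod>k\<in>#\<kappa>. \<psi> $ k))" for \<kappa>
    by (induction \<kappa>) (auto intro: rel_mult assms)
  then have "mfps_coeff (\<Prod>k\<in>#\<kappa>. \<phi> $ k) \<mu> = mfps_coeff (\<Prod>k\<in>#\<kappa>. \<psi> $ k) \<mu>" for \<kappa>
    using * by (simp add: ord_ge_def)
  then show "mfps_coeff (mfps_subst \<phi> P - mfps_subst \<psi> P) \<mu> = 0"
    by (simp add: coeff_subst)
qed

section \<open>Integrable formal forms and the Kupka case\<close>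

definition fderiv :: "('n::finite, 'a::comm_ring_1) formal_form \<Rightarrow> 'n \<Rightarrow> 'n \<Rightarrow> ('n, 'a) mfps"
  where "fderiv a i j = mfps_deriv i (a $ j) - mfps_deriv j (a $ i)"

definition fintegrable :: "('n::finite, 'a::comm_ring_1) formal_form \<Rightarrow> bool"
  where "fintegrable a \<longleftrightarrow>
    (\<forall>i j k. a $ i * fderiv a j k - a $ j * fderiv a i k + a $ k * fderiv a i j = 0)"

lemma fintegrableD:
  "fintegrable a \<Longrightarrow> a $ i * fderiv a j k - a $ j * fderiv a i k + a $ k * fderiv a i j = 0"
  by (simp add: fintegrable_def)

lemma fderiv_antisym: "fderiv a j i = - fderiv a i j"
  by (simp add: fderiv_def)

lemma fintegrable_scale:
  assumes "fintegrable a"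
  shows "fintegrable (u *s a)"
  unfolding fintegrable_def
proof (intro allI)
  fix i j k
  have d: "fderiv (u *s a) p q = u * fderiv a p q + mfps_deriv p u * a $ q - mfps_deriv q u * a $ p"
    for p q by (simp add: fderiv_def deriv_mult algebra_simps)
  have "(u *s a) $ i * fderiv (u *s a) j k - (u *s a) $ j * fderiv (u *s a) i k +
      (u *s a) $ k * fderiv (u *s a) i j =
      u * u * (a $ i * fderiv a j k - a $ j * fderiv a i k + a $ k * fderiv a i j)"
    unfolding d by (simp add: algebra_simps)
  then show "(u *s a) $ i * fderiv (u *s a) j k - (u *s a) $ j * fderiv (u *s a) i k +
      (u *s a) $ k * fderiv (u *s a) i j = 0"
    using fintegrableD[OF assms] by simp
qed

text \<open>Over the fraction field integrability gives d\<omega> = \<omega> \<and> \<eta>, where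
  \<eta> is the contraction of d\<omega> with \<partial>_m divided by \<open>a $ m\<close>. So
  d\<omega> is decomposable and satisfies the Pluecker relations.\<close>

lemma fderiv_pluecker:
  fixes a :: "('n::finite, 'a::idom) formal_form"
  assumes "fintegrable a" "a $ m \<noteq> 0"
  shows "fderiv a i j * fderiv a k l + fderiv a j k * fderiv a i l + fderiv a k i * fderiv a j l = 0"
proof -
  have e: "a $ m * fderiv a p q = a $ p * fderiv a m q - a $ q * fderiv a m p" for p q
    using fintegrableD[OF assms(1), of m p q] by (simp add: algebra_simps eq_neg_iff_add_eq_0)
  have "a $ m * a $ m * (fderiv a i j * fderiv a k l + fderiv a j k * fderiv a i l +
      fderiv a k i * fderiv a j l) =
    (a $ m * fderiv a i j) * (a $ m * fderiv a k l) + (a $ m * fderiv a j k) * (a $ m * fderiv a i l) +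
      (a $ m * fderiv a k i) * (a $ m * fderiv a j l)"
    by (simp add: algebra_simps)
  also have "\<dots> = 0" unfolding e by (simp add: algebra_simps)
  finally show ?thesis using assms(2) by simp
qed

text \<open>
  Suitable multiples of the fields \<open>d\<omega>\<^sub>i\<^sub>j \<partial>\<^sub>k + d\<omega>\<^sub>j\<^sub>k \<partial>\<^sub>i + d\<omega>\<^sub>k\<^sub>i \<partial>\<^sub>j\<close> annihilate both \<open>\<omega>\<close> and \<open>d\<omega>\<close>.  Combining them with
  coefficients \<open>x\<^sub>k\<close> gives a field \<open>Y\<close> whose leading part is the Euler field in the variables other
  than \<open>x\<^sub>i\<close>, \<open>x\<^sub>j\<close>, so that \<open>Y \<phi> = 0\<close> has a unique solution extending given data on the \<open>(x\<^sub>i, x\<^sub>j)\<close>-plane.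
  The form \<open>\<omega>\<close> and the pull-back of its restriction to that plane are both \<open>Y\<close>-basic, hence equal.
\<close>

lemma kupka:
  fixes a :: "('n::finite, 'a::field_char_0) formal_form"
  assumes int: "fintegrable a" and nz: "mfps_coeff (fderiv a i j) {#} \<noteq> 0"
  shows "\<exists>(\<phi> :: ('n, 'a) mfps ^ 2) \<omega>. (\<forall>k. mfps_coeff (\<phi> $ k) {#} = 0) \<and> a = formal_pullback \<phi> \<omega>"
proof -
  define S where "S = - {i, j}"
  have S: "i \<notin> S" "j \<notin> S" by (auto simp: S_def)
  have "fderiv a i j \<noteq> 0" using nz by auto
  then have ij: "i \<noteq> j" by (auto simp: fderiv_def)
  have "a $ i \<noteq> 0 \<or> a $ j \<noteq> 0" using \<open>fderiv a i j \<noteq> 0\<close> by (auto simp: fderiv_def)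
  then obtain m where m: "a $ m \<noteq> 0" by blast
  obtain r where r: "fderiv a i j * r = 1" using mfps_unit[OF nz] by blast
  \<comment> \<open>The factor \<open>r\<close> normalises the \<partial>_k-coefficient of each
    field to 1. \<open>A\<close> and \<open>B\<close> are the \<partial>_i- and
    \<partial>_j-components of the combination with weights x_k.\<close>
  define A where "A = (\<Sum>k\<in>S. mfps_X k * (r * fderiv a j k))"
  define B where "B = (\<Sum>k\<in>S. mfps_X k * (r * fderiv a k i))"
  have AB: "ord_ge S 1 A" "ord_ge S 1 B"
    unfolding A_def B_def by (intro ord_ge_sum ord_ge_mult_right ord_ge_X; assumption)+
  define Y where "Y f = euler S f + A * mfps_deriv i f + B * mfps_deriv j f" for f
  \<comment> \<open>On derivatives of \<open>f\<close> this is [\<partial>_l, Y] f. With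
    coefficients of \<omega> in their place, \<open>Y (a $ l) + D l (a $ l) (a $ i) (a $ j)\<close>
    is the dx_l-component of the Lie derivative of \<omega> along \<open>Y\<close>.\<close>
  define D where "D l g g' g'' = (if l \<in> S then g else 0) + mfps_deriv l A * g' + mfps_deriv l B * g''"
    for l g g' g''
  have Y_mult: "Y (f * g) = Y f * g + f * Y g" for f g
    by (simp add: Y_def euler_mult deriv_mult algebra_simps)
  have Y_add: "Y (f + g) = Y f + Y g" for f g
    by (simp add: Y_def algebra_simps)
  have Y_diff: "Y (f - g) = Y f - Y g" for f g
    by (simp add: Y_def algebra_simps)
  have Y_deriv: "Y (mfps_deriv l f) = mfps_deriv l (Y f) -
      D l (mfps_deriv l f) (mfps_deriv i f) (mfps_deriv j f)" for l f
    by (simp add: Y_def D_def deriv_mult deriv_euler deriv_commute[of _ l] algebra_simps)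

  \<comment> \<open>The contractions of \<omega> and of d\<omega> with \<open>Y\<close> vanish, the
    first by integrability and the second by the Pluecker relation.\<close>
  have contr: "(\<Sum>k\<in>S. mfps_X k * (a $ k)) + A * a $ i + B * a $ j = 0"
  proof -
    have "mfps_X k * (a $ k) + mfps_X k * (r * fderiv a j k) * a $ i + mfps_X k * (r * fderiv a k i) * a $ j = 0" for k
    proof -
      have "mfps_X k * (a $ k) + mfps_X k * (r * fderiv a j k) * a $ i + mfps_X k * (r * fderiv a k i) * a $ j
        = mfps_X k * (a $ k) * (1 - fderiv a i j * r) + mfps_X k * r *
          (a $ i * fderiv a j k - a $ j * fderiv a i k + a $ k * fderiv a i j)"
        unfolding fderiv_antisym[of a k i] by (simp add: algebra_simps)
      then show ?thesis by (simp add: r fintegrableD[OF int])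
    qed
    then show ?thesis
      by (simp add: A_def B_def sum_distrib_right flip: sum.distrib)
  qed
  have contr2: "(\<Sum>k\<in>S. mfps_X k * fderiv a k l) + A * fderiv a i l + B * fderiv a j l = 0" for l
  proof -
    have "mfps_X k * fderiv a k l + mfps_X k * (r * fderiv a j k) * fderiv a i l +
        mfps_X k * (r * fderiv a k i) * fderiv a j l = 0" for k
    proof -
      have "mfps_X k * fderiv a k l + mfps_X k * (r * fderiv a j k) * fderiv a i l +
          mfps_X k * (r * fderiv a k i) * fderiv a j l
        = mfps_X k * fderiv a k l * (1 - fderiv a i j * r) + mfps_X k * r *
          (fderiv a i j * fderiv a k l + fderiv a j k * fderiv a i l + fderiv a k i * fderiv a j l)"
        by (simp add: algebra_simps)
      then show ?thesis by (simp add: r fderiv_pluecker[OF int m])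
    qed
    then show ?thesis
      by (simp add: A_def B_def sum_distrib_right flip: sum.distrib)
  qed
  \<comment> \<open>Cartan's formula: both contractions vanish, hence so does the Lie
    derivative.\<close>
  have Ya: "Y (a $ l) = - D l (a $ l) (a $ i) (a $ j)" for l
  proof -
    have X: "mfps_deriv l (mfps_X k * (a $ k)) =
        (if k = l then a $ k else 0) + mfps_X k * mfps_deriv l (a $ k)" for k
      by (simp add: deriv_mult deriv_X)
    have sums: "(\<Sum>k\<in>S. mfps_deriv l (mfps_X k * (a $ k))) =
        (if l \<in> S then a $ l else 0) + (\<Sum>k\<in>S. mfps_X k * mfps_deriv l (a $ k))"
      unfolding X sum.distrib by simp
    have "0 = mfps_deriv l ((\<Sum>k\<in>S. mfps_X k * (a $ k)) + A * a $ i + B * a $ j)"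
      by (simp add: contr)
    also have "\<dots> = D l (a $ l) (a $ i) (a $ j) + ((\<Sum>k\<in>S. mfps_X k * mfps_deriv l (a $ k)) +
        A * mfps_deriv l (a $ i) + B * mfps_deriv l (a $ j))"
      by (simp add: deriv_sum sums deriv_mult[of l A] deriv_mult[of l B] D_def algebra_simps)
    also have "(\<Sum>k\<in>S. mfps_X k * mfps_deriv l (a $ k)) +
        A * mfps_deriv l (a $ i) + B * mfps_deriv l (a $ j) = Y (a $ l) -
        ((\<Sum>k\<in>S. mfps_X k * fderiv a k l) + A * fderiv a i l + B * fderiv a j l)"
      by (simp add: Y_def euler_sum fderiv_def right_diff_distrib sum_subtractf)
    finally show ?thesis unfolding contr2 by (simp add: eq_neg_iff_add_eq_0 add.commute)
  qed

  \<comment> \<open>For \<phi> = x_p + z this is E z = -(A \<partial>_i + B \<partial>_j)(x_p + z).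
    \<open>A\<close> and \<open>B\<close> raise the S-order while \<partial>_i and \<partial>_j
    preserve it, so inverting E gives a contraction.\<close>
  have "\<exists>\<phi>. ord_ge S 1 (\<phi> - mfps_X p) \<and> Y \<phi> = 0" if p: "p \<notin> S" for p
  proof -
    let ?G = "\<lambda>z. A * mfps_deriv i (mfps_X p + z) + B * mfps_deriv j (mfps_X p + z)"
    have G: "ord_ge S 1 (?G z)" for z
      by (intro ord_ge_add ord_ge_mult_right AB)
    have "\<exists>z. ord_ge S 1 z \<and> inv_euler S (- ?G z) = z"
    proof (rule fixed_point)
      fix z :: "('n, 'a) mfps" show "ord_ge S 1 (inv_euler S (- ?G z))" by (intro ord_ge_inv_euler ord_ge_uminus G)
    next
      fix z z' :: "('n, 'a) mfps" and d assume "ord_ge S d (z - z')"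
      then have "ord_ge S (1 + d) (A * mfps_deriv i (z - z'))" "ord_ge S (1 + d) (B * mfps_deriv j (z - z'))"
        by (intro ord_ge_mult AB ord_ge_deriv S; assumption)+
      then have "ord_ge S (Suc d) (- ?G z - (- ?G z'))"
        using ord_ge_uminus[OF ord_ge_add] by (fastforce simp: algebra_simps)
      then show "ord_ge S (Suc d) (inv_euler S (- ?G z) - inv_euler S (- ?G z'))"
        unfolding inv_euler_diff[symmetric] by (rule ord_ge_inv_euler)
    qed
    then obtain z where z: "ord_ge S 1 z" "inv_euler S (- ?G z) = z" by blast
    have "euler S z = - ?G z"
      using euler_inv_euler[OF ord_ge_uminus[OF G[of z]]] z(2) by simp
    then have "Y (mfps_X p + z) = 0"
      using p by (simp add: Y_def euler_X)
    then show ?thesis using z(1) by (intro exI[of _ "mfps_X p + z"]) simp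
  qed
  then obtain \<Phi> where \<Phi>: "\<And>p. p \<notin> S \<Longrightarrow> ord_ge S 1 (\<Phi> p - mfps_X p)" "\<And>p. p \<notin> S \<Longrightarrow> Y (\<Phi> p) = 0"
    by metis

  define \<iota> :: "2 \<Rightarrow> 'n" where "\<iota> k = (if k = 1 then i else j)" for k
  have \<iota>: "\<iota> k \<notin> S" for k using S by (simp add: \<iota>_def)
  have \<iota>12: "\<iota> 1 = i" "\<iota> 2 = j" by (auto simp: \<iota>_def)
  have inj: "inj \<iota>"
    by (rule injI) (metis \<iota>_def exhaust_2 ij)
  define \<phi> :: "('n, 'a) mfps ^ 2" where "\<phi> = (\<chi> k. \<Phi> (\<iota> k))"
  \<comment> \<open>The restriction of \<open>a\<close> to the (x_i, x_j)-plane: setting the other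
    variables to 0 leaves the monomials in the image of \<open>\<iota>\<close>.\<close>
  define \<omega> :: "(2, 'a) formal_form"
    where "\<omega> = (\<chi> k. Abs_mfps (\<lambda>\<kappa>. mfps_coeff (a $ \<iota> k) (image_mset \<iota> \<kappa>)))"
  have \<phi>X: "ord_ge S 1 (\<phi> $ k - mfps_X (\<iota> k))" for k
    unfolding \<phi>_def using \<Phi>(1)[OF \<iota>] by simp
  have Y\<phi>: "Y (\<phi> $ k) = 0" for k using \<Phi>(2)[OF \<iota>] by (simp add: \<phi>_def)
  have \<phi>0: "mfps_coeff (\<phi> $ k) {#} = 0" for k
    using \<phi>X[of k] by (simp add: ord_ge_def coeff_X)
  have Ysubst: "Y (mfps_subst \<phi> P) = 0" for P
  proof -
    have "Y (mfps_subst \<phi> P) = (\<Sum>k\<in>UNIV. mfps_subst \<phi> (mfps_deriv k P) * Y (\<phi> $ k))"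
      by (simp add: Y_def euler_sum deriv_subst \<phi>0 sum_2 sum.distrib sum_distrib_left algebra_simps)
    then show ?thesis by (simp add: Y\<phi>)
  qed
  define \<zeta> where "\<zeta> = formal_pullback \<phi> \<omega>"
  have \<zeta>: "\<zeta> $ l = mfps_subst \<phi> (\<omega> $ 1) * mfps_deriv l (\<phi> $ 1) +
      mfps_subst \<phi> (\<omega> $ 2) * mfps_deriv l (\<phi> $ 2)" for l
    by (simp add: \<zeta>_def formal_pullback_def sum_2)
  have Y\<zeta>: "Y (\<zeta> $ l) = - D l (\<zeta> $ l) (\<zeta> $ i) (\<zeta> $ j)" for l
    by (simp add: \<zeta> Y_mult Y_add Ysubst Y_deriv Y\<phi> D_def algebra_simps)
  define \<eta> where "\<eta> l = a $ l - \<zeta> $ l" for l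
  have Y\<eta>: "Y (\<eta> l) = - D l (\<eta> l) (\<eta> i) (\<eta> j)" for l
    by (simp add: \<eta>_def Y_diff Ya Y\<zeta> D_def algebra_simps)

  have restr: "ord_ge S 1 (mfps_subst \<phi> (\<omega> $ k) - a $ \<iota> k)" for k
  proof -
    let ?\<psi> = "(\<chi> k. mfps_X (\<iota> k)) :: ('n, 'a) mfps ^ 2"
    have "ord_ge S 1 (mfps_subst \<phi> (\<omega> $ k) - mfps_subst ?\<psi> (\<omega> $ k))"
      by (rule rel_subst) (use \<phi>X in simp)
    moreover have "ord_ge S 1 (mfps_subst ?\<psi> (\<omega> $ k) - a $ \<iota> k)"
      unfolding ord_ge_def
    proof (intro allI impI)
      fix \<mu> assume "deg_in S \<mu> < 1"
      then have "set_mset \<mu> \<subseteq> {i, j}" by (auto simp: deg_in_eq_0_iff S_def)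
      then have "\<mu> = image_mset (\<iota> \<circ> (\<lambda>l. if l = i then 1 else 2)) \<mu>"
        using ij by (intro image_mset_cong[of \<mu> "\<lambda>x. x", simplified]) (auto simp: \<iota>_def)
      then obtain \<kappa> where \<kappa>: "\<mu> = image_mset \<iota> \<kappa>" by (metis multiset.map_comp)
      have "mfps_coeff (mfps_subst ?\<psi> (\<omega> $ k)) \<mu> =
          (\<Sum>\<kappa>' | size \<kappa>' \<le> size \<mu>. if \<kappa>' = \<kappa> then mfps_coeff (a $ \<iota> k) \<mu> else 0)"
        unfolding coeff_subst
      proof (intro sum.cong refl)
        fix \<kappa>'
        have "\<mu> = image_mset \<iota> \<kappa>' \<longleftrightarrow> \<kappa>' = \<kappa>"
          using \<kappa> inj by (metis injD multiset.inj_map)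
        moreover have "(\<Prod>k\<in>#\<kappa>'. ?\<psi> $ k) = (\<Prod>k\<in>#\<kappa>'. mfps_X (\<iota> k))" by simp
        ultimately show "mfps_coeff (\<omega> $ k) \<kappa>' * mfps_coeff (\<Prod>k\<in>#\<kappa>'. ?\<psi> $ k) \<mu> =
            (if \<kappa>' = \<kappa> then mfps_coeff (a $ \<iota> k) \<mu> else 0)"
          using \<kappa> by (simp add: mfps_prod_X_coeff \<omega>_def)
      qed
      then show "mfps_coeff (mfps_subst ?\<psi> (\<omega> $ k) - a $ \<iota> k) \<mu> = 0"
        by (simp add: \<kappa>)
    qed
    ultimately have "ord_ge S 1 ((mfps_subst \<phi> (\<omega> $ k) - mfps_subst ?\<psi> (\<omega> $ k)) +
      (mfps_subst ?\<psi> (\<omega> $ k) - a $ \<iota> k))" by (rule ord_ge_add)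
    then show ?thesis by simp
  qed
  have base: "ord_ge S 1 (\<eta> l)" if l: "l \<in> {i, j}" for l
  proof -
    have d: "ord_ge S 1 (mfps_deriv l (\<phi> $ k) - mfps_deriv l (mfps_X (\<iota> k)))" for k
      unfolding deriv_diff[symmetric] by (rule ord_ge_deriv) (use l S \<phi>X in auto)
    have "ord_ge S 1 ((mfps_subst \<phi> (\<omega> $ 1) * mfps_deriv l (\<phi> $ 1) - a $ \<iota> 1 * mfps_deriv l (mfps_X (\<iota> 1))) +
       (mfps_subst \<phi> (\<omega> $ 2) * mfps_deriv l (\<phi> $ 2) - a $ \<iota> 2 * mfps_deriv l (mfps_X (\<iota> 2))))"
      by (intro ord_ge_add rel_mult restr d)
    also have "(mfps_subst \<phi> (\<omega> $ 1) * mfps_deriv l (\<phi> $ 1) - a $ \<iota> 1 * mfps_deriv l (mfps_X (\<iota> 1))) +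
       (mfps_subst \<phi> (\<omega> $ 2) * mfps_deriv l (\<phi> $ 2) - a $ \<iota> 2 * mfps_deriv l (mfps_X (\<iota> 2))) = - \<eta> l"
      using l ij by (auto simp: \<eta>_def \<zeta> \<iota>12 deriv_X)
    finally show ?thesis using ord_ge_uminus by fastforce
  qed
  \<comment> \<open>The equations for \<open>\<eta> i\<close> and \<open>\<eta> j\<close> involve no
    other component. Once both vanish, each remaining \<open>\<eta> l\<close> satisfies a scalar
    equation with leading part E + 1.\<close>
  have "ord_ge S (Suc d) (\<eta> i) \<and> ord_ge S (Suc d) (\<eta> j)" for d
  proof (induction d)
    case 0
    then show ?case using base by simp
  next
    case (Suc d)
    have "ord_ge S (Suc (Suc d)) (\<eta> l)" if l: "l \<in> {i, j}" for l
    proof (rule ord_ge_euler_step[where c = 0])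
      have lS: "l \<notin> S" using l S by auto
      have *: "ord_ge S (Suc (Suc d)) (f * g)" if "ord_ge S 1 f" "ord_ge S (Suc d) g" for f g
        using ord_ge_mult[OF that] by simp
      show l': "ord_ge S (Suc d) (\<eta> l)" using Suc l by auto
      have "ord_ge S (Suc (Suc d)) (- (mfps_deriv l A * \<eta> i + mfps_deriv l B * \<eta> j +
          A * mfps_deriv i (\<eta> l) + B * mfps_deriv j (\<eta> l)))"
        using Suc by (intro ord_ge_uminus ord_ge_add * ord_ge_deriv AB S lS l') auto
      also have "- (mfps_deriv l A * \<eta> i + mfps_deriv l B * \<eta> j +
          A * mfps_deriv i (\<eta> l) + B * mfps_deriv j (\<eta> l)) = euler S (\<eta> l) + of_nat 0 * \<eta> l"
        using Y\<eta>[of l] lS by (simp add: Y_def D_def algebra_simps eq_neg_iff_add_eq_0 neg_eq_iff_add_eq_0)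
      finally show "ord_ge S (Suc (Suc d)) (euler S (\<eta> l) + of_nat 0 * \<eta> l)" .
    qed simp
    then show ?case by simp
  qed
  then have "ord_ge S d (\<eta> i)" "ord_ge S d (\<eta> j)" for d
    by (meson ord_ge_mono le_SucI order_refl)+
  then have \<eta>0: "\<eta> i = 0" "\<eta> j = 0" by (blast intro: ord_ge_eq_0)+
  have "\<eta> l = 0" for l
  proof (cases "l \<in> S")
    case True
    have "ord_ge S d (\<eta> l)" for d
    proof (induction d)
      case (Suc d)
      show ?case
      proof (rule ord_ge_euler_step[where c = 1])
        have "ord_ge S (1 + d) (- (A * mfps_deriv i (\<eta> l) + B * mfps_deriv j (\<eta> l)))"
          by (intro ord_ge_uminus ord_ge_add ord_ge_mult AB ord_ge_deriv S Suc)
        also have "- (A * mfps_deriv i (\<eta> l) + B * mfps_deriv j (\<eta> l)) = euler S (\<eta> l) + of_nat 1 * \<eta> l"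
          using Y\<eta>[of l] True \<eta>0 by (simp add: Y_def D_def algebra_simps eq_neg_iff_add_eq_0 neg_eq_iff_add_eq_0)
        finally show "ord_ge S (Suc d) (euler S (\<eta> l) + of_nat 1 * \<eta> l)" by simp
      qed (use Suc in auto)
    qed simp
    then show ?thesis by (rule ord_ge_eq_0)
  qed (use \<eta>0 in \<open>auto simp: S_def\<close>)
  then have "a = formal_pullback \<phi> \<omega>"
    by (simp add: vec_eq_iff \<eta>_def \<zeta>_def)
  then show ?thesis using \<phi>0 by blast
qed

section \<open>A non-degenerate direction\<close>

text \<open>
  It is enough to know \<open>u \<omega> = s ds + df + s dh\<close> on \<open>\<partial>\<^sub>x\<close> and on the Euler field of the other variables:
  the Euler contraction of the integrability condition bounds the order of the error \<open>\<theta>\<close> by itself.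
\<close>

lemma normal_form_rigid:
  fixes a :: "('n::finite, 'a::field_char_0) formal_form"
  assumes int: "fintegrable a"
    and ao: "u * a $ x = s * mfps_deriv x s"
    and radial: "u * (\<Sum>k\<in>-{x}. mfps_X k * a $ k) = s * euler (-{x}) s + euler (-{x}) f + s * euler (-{x}) h"
    and f: "mfps_deriv x f = 0" and h: "mfps_deriv x h = 0"
    and s: "ord_ge (-{x}) 1 (s - mfps_X x)"
  shows "u * a $ k = s * mfps_deriv k s + mfps_deriv k f + s * mfps_deriv k h"
    and "diff_dep f h"
proof -
  define S where "S = - {x}"
  have xS: "x \<notin> S" by (simp add: S_def)
  define E where "E = (euler S :: ('n, 'a) mfps \<Rightarrow> ('n, 'a) mfps)"
  define D where "D = (mfps_deriv :: 'n \<Rightarrow> ('n, 'a) mfps \<Rightarrow> ('n, 'a) mfps)"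
  define \<theta> where "\<theta> k = u * a $ k - s * D k s - D k f - s * D k h" for k
  have ua: "(u *s a) $ k = s * D k s + D k f + s * D k h + \<theta> k" for k by (simp add: \<theta>_def)
  have fx: "D x f = 0" "D x h = 0" using f h by (simp_all add: D_def)
  have \<theta>x: "\<theta> x = 0" using ao fx by (simp add: \<theta>_def D_def)
  have DD: "D i (D j g) = D j (D i g)" for i j g by (simp add: D_def deriv_commute)
  have dua: "fderiv (u *s a) j k = D j s * D k h - D k s * D j h + D j (\<theta> k) - D k (\<theta> j)" for j k
    unfolding fderiv_def ua D_def[symmetric]
    by (simp add: D_def deriv_mult) (simp add: D_def[symmetric] DD[of k j] algebra_simps)
  have E_sum: "(\<Sum>k\<in>S. mfps_X k * D k g) = E g" for g by (simp add: E_def euler_sum D_def)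
  have radial0: "(\<Sum>k\<in>S. mfps_X k * \<theta> k) = 0"
  proof -
    have "(\<Sum>k\<in>S. mfps_X k * \<theta> k) = u * (\<Sum>k\<in>S. mfps_X k * a $ k) -
        s * (\<Sum>k\<in>S. mfps_X k * D k s) - (\<Sum>k\<in>S. mfps_X k * D k f) -
        s * (\<Sum>k\<in>S. mfps_X k * D k h)"
      by (simp add: \<theta>_def right_diff_distrib sum_subtractf sum_distrib_left mult.left_commute)
    then show ?thesis using radial by (simp add: E_sum) (simp add: S_def E_def)
  qed
  have sx: "ord_ge S 1 (D x s - 1)"
    using ord_ge_deriv[OF xS s[folded S_def]] by (simp add: D_def deriv_X)
  then have "mfps_coeff (D x s) {#} = 1" by (simp add: ord_ge_def coeff_one)
  then obtain r where r: "D x s * r = 1" using mfps_unit[of "D x s"] by auto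

  have triple: "s * D x s * (D j s * D k h - D k s * D j h + D j (\<theta> k) - D k (\<theta> j)) -
      (s * D j s + D j f + s * D j h + \<theta> j) * (D x s * D k h + D x (\<theta> k)) +
      (s * D k s + D k f + s * D k h + \<theta> k) * (D x s * D j h + D x (\<theta> j)) = 0" for j k
  proof -
    have "D m (\<theta> x) = 0" for m using \<theta>x by (simp add: D_def)
    moreover have "(u *s a) $ x = s * D x s" using ua[of x] by (simp add: fx \<theta>x)
    ultimately show ?thesis
      using fintegrableD[OF fintegrable_scale[OF int], of u x j k]
      unfolding dua by (simp add: fx ua del: vector_smult_component)
  qed
  \<comment> \<open>The Euler contraction of \<open>triple\<close> in the index \<open>j\<close>,
    divided by the unit \<open>D x s\<close>. The terms with derivatives of
    \<open>\<theta> j\<close> are evaluated by differentiating \<open>radial0\<close>.\<close>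
  have main: "s * (E (\<theta> k) + \<theta> k) =
      E f * D k h - E h * D k f + r * ((s * E s + E f + s * E h) * D x (\<theta> k)) - E h * \<theta> k"
    if k: "k \<in> S" for k
  proof -
    have c1: "(\<Sum>j\<in>S. mfps_X j * D k (\<theta> j)) = - \<theta> k"
    proof -
      have X: "D k (mfps_X j * \<theta> j) = (if j = k then \<theta> j else 0) + mfps_X j * D k (\<theta> j)" for j
        by (simp add: D_def deriv_mult deriv_X)
      have "0 = D k (\<Sum>j\<in>S. mfps_X j * \<theta> j)" by (simp add: radial0 D_def)
      also have "\<dots> = (\<Sum>j\<in>S. D k (mfps_X j * \<theta> j))" by (simp add: D_def deriv_sum)
      also have "\<dots> = \<theta> k + (\<Sum>j\<in>S. mfps_X j * D k (\<theta> j))"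
        unfolding X sum.distrib using k by simp
      finally show ?thesis by (simp add: eq_neg_iff_add_eq_0 add.commute)
    qed
    have c2: "(\<Sum>j\<in>S. mfps_X j * D x (\<theta> j)) = 0"
    proof -
      have "D x (mfps_X j * \<theta> j) = mfps_X j * D x (\<theta> j)" if "j \<in> S" for j
        using that xS by (auto simp: D_def deriv_mult deriv_X)
      then have "(\<Sum>j\<in>S. mfps_X j * D x (\<theta> j)) = D x (\<Sum>j\<in>S. mfps_X j * \<theta> j)"
        by (simp add: D_def deriv_sum)
      then show ?thesis by (simp add: radial0 D_def)
    qed
    have "0 = (\<Sum>j\<in>S. mfps_X j * (s * D x s * (D j s * D k h - D k s * D j h + D j (\<theta> k) - D k (\<theta> j)) -
      (s * D j s + D j f + s * D j h + \<theta> j) * (D x s * D k h + D x (\<theta> k)) +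
      (s * D k s + D k f + s * D k h + \<theta> k) * (D x s * D j h + D x (\<theta> j))))"
      by (simp only: triple) simp
    also have "\<dots> = s * D x s * ((\<Sum>j\<in>S. mfps_X j * D j s) * D k h - D k s * (\<Sum>j\<in>S. mfps_X j * D j h) +
        (\<Sum>j\<in>S. mfps_X j * D j (\<theta> k)) - (\<Sum>j\<in>S. mfps_X j * D k (\<theta> j))) -
      (s * (\<Sum>j\<in>S. mfps_X j * D j s) + (\<Sum>j\<in>S. mfps_X j * D j f) + s * (\<Sum>j\<in>S. mfps_X j * D j h) +
        (\<Sum>j\<in>S. mfps_X j * \<theta> j)) * (D x s * D k h + D x (\<theta> k)) +
      (s * D k s + D k f + s * D k h + \<theta> k) *
        (D x s * (\<Sum>j\<in>S. mfps_X j * D j h) + (\<Sum>j\<in>S. mfps_X j * D x (\<theta> j)))"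
      by (simp add: sum_distrib_left sum_distrib_right sum.distrib sum_subtractf algebra_simps)
    also have "\<dots> = s * D x s * (E s * D k h - D k s * E h + E (\<theta> k) + \<theta> k) -
      (s * E s + E f + s * E h) * (D x s * D k h + D x (\<theta> k)) +
      (s * D k s + D k f + s * D k h + \<theta> k) * (D x s * E h)"
      unfolding E_sum c1 c2 radial0 by simp
    also have "\<dots> = D x s * (s * (E (\<theta> k) + \<theta> k) - (E f * D k h - E h * D k f) + E h * \<theta> k) -
        (s * E s + E f + s * E h) * D x (\<theta> k)"
      by (simp add: algebra_simps)
    finally have "r * (D x s * (s * (E (\<theta> k) + \<theta> k) - (E f * D k h - E h * D k f) + E h * \<theta> k)) =
        r * ((s * E s + E f + s * E h) * D x (\<theta> k))" by simp
    moreover have "r * (D x s * g) = g" for g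
      using r by (metis mult.assoc mult.commute mult.left_neutral)
    ultimately have "s * (E (\<theta> k) + \<theta> k) - (E f * D k h - E h * D k f) + E h * \<theta> k =
        r * ((s * E s + E f + s * E h) * D x (\<theta> k))" by simp
    then show ?thesis by (simp add: algebra_simps)
  qed
  have E1: "ord_ge S 1 (E g)" for g unfolding E_def by (rule ord_ge_euler_1)
  have "\<forall>k. ord_ge S d (\<theta> k)" for d
  proof (induction d)
    case (Suc d)
    show ?case
    proof
      fix k
      show "ord_ge S (Suc d) (\<theta> k)"
      proof (cases "k \<in> S")
        case True
        let ?Q = "E f * D k h - E h * D k f"
        let ?T = "E (\<theta> k) + \<theta> k"
        have T: "ord_ge S d ?T"
          using Suc by (auto intro!: ord_ge_add simp: E_def ord_ge_def coeff_euler)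
        have D\<theta>: "ord_ge S d (D x (\<theta> k))"
          using ord_ge_deriv[OF xS spec[OF Suc]] by (simp add: D_def)
        have "ord_ge S (1 + d) ((s * E s + E f + s * E h) * D x (\<theta> k))"
          by (intro ord_ge_mult[OF _ D\<theta>] ord_ge_add ord_ge_mult_left E1)
        from ord_ge_mult_left[OF this, of r]
          ord_ge_mult[OF E1 spec[OF Suc], of h k] ord_ge_mult[OF s[folded S_def] T]
        have "ord_ge S (1 + d) (r * ((s * E s + E f + s * E h) * D x (\<theta> k)) - E h * \<theta> k
            - (s - mfps_X x) * ?T)"
          by (blast intro: ord_ge_diff)
        also have "r * ((s * E s + E f + s * E h) * D x (\<theta> k)) - E h * \<theta> k - (s - mfps_X x) * ?T
            = mfps_X x * ?T - ?Q"
          using main[OF True] by (simp add: algebra_simps)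
        finally have *: "ord_ge S (Suc d) (mfps_X x * ?T - ?Q)" by simp
        \<comment> \<open>\<open>?Q\<close> is free of x while every monomial of
          \<open>mfps_X x * ?T\<close> contains x. So the two cannot cancel, and the bound on their
          difference passes to \<open>?T\<close>.\<close>
        have Q: "D x ?Q = 0"
        proof -
          have "D x (E g) = 0" if "D x g = 0" for g
            using that xS by (simp add: D_def E_def deriv_euler)
          moreover have "D x (D k g) = 0" if "D x g = 0" for g
            using that by (subst DD) (simp add: D_def)
          ultimately show ?thesis using fx by (simp add: D_def deriv_mult)
        qed
        have "ord_ge S (Suc d) ?T"
          unfolding ord_ge_def
        proof (intro allI impI)
          fix \<mu> assume \<mu>: "deg_in S \<mu> < Suc d"
          have "mfps_coeff (mfps_X x * ?T - ?Q) (add_mset x \<mu>) = 0"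
            using * \<mu> xS by (simp add: ord_ge_def)
          moreover have "mfps_coeff (D x ?Q) \<mu> = 0" using Q by simp
          then have "mfps_coeff ?Q (add_mset x \<mu>) = 0"
            unfolding D_def coeff_deriv by (metis mult_eq_0_iff nat.distinct(1) of_nat_eq_0_iff)
          ultimately show "mfps_coeff ?T \<mu> = 0" by (simp add: coeff_X_mult)
        qed
        then have "ord_ge S (Suc d) (euler S (\<theta> k) + of_nat 1 * \<theta> k)" by (simp add: E_def)
        from ord_ge_euler_step[OF _ this] Suc show ?thesis by simp
      qed (simp add: S_def \<theta>x)
    qed
  qed simp
  then have \<theta>: "\<theta> k = 0" for k by (blast intro: ord_ge_eq_0)
  then show "u * a $ k = s * mfps_deriv k s + mfps_deriv k f + s * mfps_deriv k h"
    using ua[of k] by (simp add: D_def)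
  show "diff_dep f h"
    unfolding diff_dep_def D_def[symmetric]
  proof (intro allI)
    fix j k
    have "D x s * (D k f * D j h - D j f * D k h) = 0"
      using triple[of j k] by (simp add: \<theta>, simp add: D_def, simp add: algebra_simps)
    then have "r * (D x s * (D k f * D j h - D j f * D k h)) = 0" by simp
    moreover have "r * (D x s * g) = g" for g
      using r by (metis mult.assoc mult.commute mult.left_neutral)
    ultimately show "D j f * D k h = D k f * D j h" by simp
  qed
qed

text \<open>
  For \<open>w = 1\<close> modulo the variables other than \<open>x\<close>, the equation has leading part
  \<open>x\<^sup>2 E w + E f + x E h\<close>, and every series without pure powers of \<open>x\<close> has a unique such decomposition
  (into the parts of \<open>x\<close>-degree at least 2, 0 and 1).  The equation thus is a contracting fixed point
  problem for the series \<open>z\<close> that is decomposed.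
\<close>

lemma normal_form_exists:
  fixes a \<beta> :: "('n::finite, 'a::field_char_0) mfps"
  assumes a: "ord_ge (-{x}) 1 (a - mfps_X x)" and \<beta>: "ord_ge (-{x}) 1 \<beta>"
  shows "\<exists>w f h. ord_ge (-{x}) 1 (w - 1) \<and> mfps_deriv x f = 0 \<and> mfps_deriv x h = 0 \<and>
    w * mfps_deriv x (a * w) * \<beta> = a * w * euler (-{x}) (a * w) + euler (-{x}) f + a * w * euler (-{x}) h"
proof -
  define S where "S = - {x}"
  have xS: "x \<notin> S" by (simp add: S_def)
  define X :: "('n, 'a) mfps" where "X = mfps_X x"
  note a = a[folded S_def X_def] and \<beta> = \<beta>[folded S_def]
  define D where "D = (mfps_deriv x :: ('n, 'a) mfps \<Rightarrow> ('n, 'a) mfps)"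
  define b0 where "b0 z = Abs_mfps (\<lambda>\<mu>. if x \<in># \<mu> then 0 else mfps_coeff z \<mu>)" for z :: "('n, 'a) mfps"
  define b1 where "b1 z = Abs_mfps (\<lambda>\<mu>. if x \<in># \<mu> then 0 else mfps_coeff z (add_mset x \<mu>))"
    for z :: "('n, 'a) mfps"
  define W where "W z = Abs_mfps (\<lambda>\<mu>. mfps_coeff z (add_mset x (add_mset x \<mu>)))" for z :: "('n, 'a) mfps"
  have split: "z = X * (X * W z) + X * b1 z + b0 z" for z
  proof (rule mfps_eqI)
    fix \<mu> :: "'n multiset"
    show "mfps_coeff z \<mu> = mfps_coeff (X * (X * W z) + X * b1 z + b0 z) \<mu>"
    proof (cases "x \<in># \<mu>")
      case True
      then obtain \<nu> where "\<mu> = add_mset x \<nu>" by (metis insert_DiffM)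
      then show ?thesis
        by (cases "x \<in># \<nu>") (auto simp: X_def coeff_X_mult W_def b1_def b0_def)
    qed (simp add: X_def coeff_X_mult b0_def)
  qed
  have lin: "W (z - z') = W z - W z'" "b1 (z - z') = b1 z - b1 z'" for z z'
    by (auto simp: W_def b1_def intro!: mfps_eqI)
  have ord: "ord_ge S d (W z)" "ord_ge S d (b1 z)" "ord_ge S d (b0 z)" if "ord_ge S d z" for d z
    using that xS by (auto simp: W_def b1_def b0_def ord_ge_def)
  define w where "w z = 1 + inv_euler S (W z)" for z
  have Ew: "euler S (w z) = W z" if "ord_ge S 1 z" for z
    using euler_inv_euler[OF ord(1)[OF that]] by (simp add: w_def)
  have w1: "ord_ge S 1 (w z - 1)" if "ord_ge S 1 z" for z
    using ord_ge_inv_euler[OF ord(1)[OF that]] by (simp add: w_def)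
  \<comment> \<open>Put E w = \<open>W z\<close>, E f = \<open>b0 z\<close>, E h =
    \<open>b1 z\<close> and expand E (a w) by the product rule. Isolating the leading part, which is
    \<open>z\<close> by \<open>split\<close>, turns the equation into \<open>T z = z\<close>; every
    term of \<open>T z\<close> has a factor of S-order at least 1.\<close>
  define T where "T z = \<beta> * (w z * D (a * w z)) - euler S a * (a * w z * w z) -
    (a * a * w z - X * X) * W z - (a * w z - X) * b1 z" for z
  have a2: "ord_ge S 1 (a * a * w z - X * X)" "ord_ge S 1 (a * w z - X)" if z: "ord_ge S 1 z" for z
  proof -
    show "ord_ge S 1 (a * w z - X)"
      using rel_mult[OF a w1[OF z]] by simp
    show "ord_ge S 1 (a * a * w z - X * X)"
      using rel_mult[OF rel_mult[OF a a] w1[OF z]] by simp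
  qed
  have "\<exists>z. ord_ge S 1 z \<and> T z = z"
  proof (rule fixed_point)
    fix z :: "('n, 'a) mfps" assume z: "ord_ge S 1 z"
    show "ord_ge S 1 (T z)"
      unfolding T_def
      by (intro ord_ge_diff ord_ge_mult_right \<beta> ord_ge_euler_1 a2 z)
  next
    fix z z' :: "('n, 'a) mfps" and d
    assume z: "ord_ge S 1 z" "ord_ge S 1 z'" and d: "ord_ge S d (z - z')"
    have dW: "ord_ge S d (W z - W z')" "ord_ge S d (b1 z - b1 z')"
      using ord(1,2)[OF d] by (simp_all add: lin)
    have dw: "ord_ge S d (w z - w z')"
      using ord_ge_inv_euler[OF dW(1)] by (simp add: w_def inv_euler_diff)
    have self: "ord_ge S d (g - g)" for g by simp
    have daw: "ord_ge S d (a * w z - a * w z')" by (intro rel_mult self dw)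
    have dD: "ord_ge S d (D (a * w z) - D (a * w z'))"
      using ord_ge_deriv[OF xS daw] by (simp add: D_def)
    have Suc: "ord_ge S (Suc d) (p * q - p * q')" if "ord_ge S 1 p" "ord_ge S d (q - q')" for p q q'
      using ord_ge_mult[OF that] by (simp add: right_diff_distrib)
    have t1: "ord_ge S (Suc d) (\<beta> * (w z * D (a * w z)) - \<beta> * (w z' * D (a * w z')))"
      by (intro Suc \<beta> rel_mult dw dD)
    have t2: "ord_ge S (Suc d) (euler S a * (a * w z * w z) - euler S a * (a * w z' * w z'))"
      by (intro Suc ord_ge_euler_1 rel_mult dw self)
    have t3: "ord_ge S (Suc d) ((a * a * w z - X * X) * W z - (a * a * w z' - X * X) * W z')"
    proof (rule rel_mult_Suc[OF _ dW(1) a2(1)[OF z(1)] ord(1)[OF z(2)]])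
      show "ord_ge S d (a * a * w z - X * X - (a * a * w z' - X * X))"
        using rel_mult[OF self[of "a * a"] dw] by simp
    qed
    have t4: "ord_ge S (Suc d) ((a * w z - X) * b1 z - (a * w z' - X) * b1 z')"
    proof (rule rel_mult_Suc[OF _ dW(2) a2(2)[OF z(1)] ord(2)[OF z(2)]])
      show "ord_ge S d (a * w z - X - (a * w z' - X))"
        using daw by simp
    qed
    have "T z - T z' = (\<beta> * (w z * D (a * w z)) - \<beta> * (w z' * D (a * w z'))) -
        (euler S a * (a * w z * w z) - euler S a * (a * w z' * w z')) -
        ((a * a * w z - X * X) * W z - (a * a * w z' - X * X) * W z') -
        ((a * w z - X) * b1 z - (a * w z' - X) * b1 z')"
      unfolding T_def by simp
    then show "ord_ge S (Suc d) (T z - T z')"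
      using ord_ge_diff[OF ord_ge_diff[OF ord_ge_diff[OF t1 t2] t3] t4] by simp
  qed
  then obtain z where z: "ord_ge S 1 z" "T z = z" by blast
  define f where "f = inv_euler S (b0 z)"
  define h where "h = inv_euler S (b1 z)"
  have Ef: "euler S f = b0 z" "euler S h = b1 z"
    using ord[OF z(1)] by (simp_all add: f_def h_def euler_inv_euler)
  have Df: "mfps_deriv x f = 0" "mfps_deriv x h = 0"
    unfolding f_def h_def
    by (intro deriv_inv_euler_0 xS; intro mfps_eqI; simp add: coeff_deriv b0_def b1_def)+
  have "\<beta> * (w z * D (a * w z)) - euler S a * (a * w z * w z) -
      (a * a * w z - X * X) * W z - (a * w z - X) * b1 z = X * (X * W z) + X * b1 z + b0 z"
    using z(2) split[of z] unfolding T_def by simp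
  then have "w z * D (a * w z) * \<beta> = a * w z * (euler S a * w z + a * W z) + b0 z + a * w z * b1 z"
    by (simp add: algebra_simps)
  then have "w z * D (a * w z) * \<beta> = a * w z * euler S (a * w z) + euler S f + a * w z * euler S h"
    by (simp add: Ef euler_mult Ew[OF z(1)])
  then show ?thesis
    using Df w1[OF z(1)] unfolding S_def D_def by blast
qed

lemma nondegenerate_direction_aux:
  fixes a :: "('n::finite, 'a::field_char_0) formal_form"
  assumes int: "fintegrable a" and a: "ord_ge (-{x}) 1 (a $ x - mfps_X x)"
  shows "\<exists>u (\<phi> :: ('n, 'a) mfps ^ 2) \<omega>. mfps_coeff u {#} \<noteq> 0 \<and>
    (\<forall>k. mfps_coeff (\<phi> $ k) {#} = 0) \<and> u *s a = formal_pullback \<phi> \<omega>"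
proof -
  let ?S = "- {x}"
  let ?\<beta> = "\<Sum>k\<in>?S. mfps_X k * a $ k"
  have "ord_ge ?S 1 ?\<beta>" by (intro ord_ge_sum ord_ge_mult_right ord_ge_X)
  then obtain w f h where w: "ord_ge ?S 1 (w - 1)" and fh: "mfps_deriv x f = 0" "mfps_deriv x h = 0"
    and eq: "w * mfps_deriv x (a $ x * w) * ?\<beta> =
      a $ x * w * euler ?S (a $ x * w) + euler ?S f + a $ x * w * euler ?S h"
    using normal_form_exists[OF a] by blast
  define s where "s = a $ x * w"
  \<comment> \<open>This choice gives u a_x = s \<partial>_x s whatever \<open>w\<close> is, so only
    the radial equation was left to determine \<open>w\<close>.\<close>
  define u where "u = w * mfps_deriv x s"
  have s: "ord_ge ?S 1 (s - mfps_X x)"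
    using rel_mult[OF a w] by (simp add: s_def)
  have s0: "mfps_coeff s {#} = 0" using s by (simp add: ord_ge_def coeff_X)
  have "mfps_coeff s {#x#} = 1" using s by (simp add: ord_ge_def coeff_X)
  moreover have "mfps_coeff w {#} = 1" using w by (simp add: ord_ge_def coeff_one)
  ultimately have u0: "mfps_coeff u {#} \<noteq> 0" by (simp add: u_def coeff_deriv)
  have ux: "u * a $ x = s * mfps_deriv x s" by (simp add: u_def s_def mult_ac)
  have ur: "u * ?\<beta> = s * euler ?S s + euler ?S f + s * euler ?S h"
    using eq by (simp add: u_def s_def)
  note nf = normal_form_rigid[OF int ux ur fh s]
  obtain g F H where g: "mfps_coeff g {#} = 0" and F1: "mfps_deriv 1 F = 0" "mfps_deriv 1 H = 0"
    and FH: "mfps_subst (vector [s, g] :: ('n, 'a) mfps ^ 2) F = f"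
      "mfps_subst (vector [s, g] :: ('n, 'a) mfps ^ 2) H = h"
    using ex_common_primitive[OF nf(2)] s0 by blast
  define \<phi> :: "('n, 'a) mfps ^ 2" where "\<phi> = vector [s, g]"
  have \<phi>12: "\<phi> $ 1 = s" "\<phi> $ 2 = g" by (simp_all add: \<phi>_def)
  have \<phi>: "mfps_coeff (\<phi> $ k) {#} = 0" for k
    using exhaust_2[of k] by (auto simp: \<phi>12 s0 g)
  define \<omega> :: "(2, 'a) formal_form"
    where "\<omega> = vector [mfps_X 1, mfps_deriv 2 F + mfps_X 1 * mfps_deriv 2 H]"
  have df: "mfps_deriv k f = mfps_subst \<phi> (mfps_deriv 2 F) * mfps_deriv k g"
    "mfps_deriv k h = mfps_subst \<phi> (mfps_deriv 2 H) * mfps_deriv k g" for k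
    using deriv_subst[of \<phi> k F] deriv_subst[of \<phi> k H] \<phi>
    by (simp_all add: sum_2 F1 \<phi>12 FH[folded \<phi>_def])
  have "u *s a = formal_pullback \<phi> \<omega>"
    unfolding vec_eq_iff
    by (simp add: nf(1) formal_pullback_def sum_2 \<omega>_def subst_X subst_mult \<phi> \<phi>12 df algebra_simps)
  then show ?thesis using u0 \<phi> by blast
qed

text \<open>On the x-axis \<open>a $ x\<close> is x times the unit \<open>\<alpha>\<close>;
  multiplying the form by the inverse of \<open>\<alpha>\<close> makes this restriction equal to
  x.\<close>

lemma nondegenerate_direction:
  fixes a :: "('n::finite, 'a::field_char_0) formal_form"
  assumes int: "fintegrable a" and a0: "mfps_coeff (a $ x) {#} = 0" and ax: "mfps_coeff (a $ x) {#x#} \<noteq> 0"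
  shows "\<exists>u (\<phi> :: ('n, 'a) mfps ^ 2) \<omega>. mfps_coeff u {#} \<noteq> 0 \<and>
    (\<forall>k. mfps_coeff (\<phi> $ k) {#} = 0) \<and> u *s a = formal_pullback \<phi> \<omega>"
proof -
  define \<alpha> where "\<alpha> = Abs_mfps (\<lambda>\<mu>. if deg_in (-{x}) \<mu> = 0 then mfps_coeff (a $ x) (add_mset x \<mu>) else 0)"
  have "mfps_coeff \<alpha> {#} \<noteq> 0" using ax by (simp add: \<alpha>_def)
  then obtain r where r: "\<alpha> * r = 1" using mfps_unit by blast
  then have "mfps_coeff (\<alpha> * r) {#} = 1" by (simp add: coeff_one)
  then have r0: "mfps_coeff r {#} \<noteq> 0" by auto
  have "ord_ge (-{x}) 1 (a $ x - mfps_X x * \<alpha>)"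
    unfolding ord_ge_def
  proof (intro allI impI)
    fix \<mu> assume *: "deg_in (- {x}) \<mu> < 1"
    show "mfps_coeff (a $ x - mfps_X x * \<alpha>) \<mu> = 0"
    proof (cases "x \<in># \<mu>")
      case True
      then obtain \<nu> where "\<mu> = add_mset x \<nu>" by (metis insert_DiffM)
      then show ?thesis using * by (simp add: coeff_X_mult \<alpha>_def)
    next
      case False
      then have "\<mu> = {#}" using * by (auto simp: deg_in_eq_0_iff)
      then show ?thesis using a0 by (simp add: coeff_X)
    qed
  qed
  from ord_ge_mult_left[OF this, of r] have "ord_ge (-{x}) 1 ((r *s a) $ x - mfps_X x)"
  proof -
    have "r * (a $ x - mfps_X x * \<alpha>) = (r *s a) $ x - mfps_X x * (\<alpha> * r)"
      by (simp add: algebra_simps)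
    then show ?thesis using r \<open>ord_ge (-{x}) 1 (r * (a $ x - mfps_X x * \<alpha>))\<close> by simp
  qed
  from nondegenerate_direction_aux[OF fintegrable_scale[OF int] this]
  obtain u and \<phi> :: "('n, 'a) mfps ^ 2" and \<omega> where "mfps_coeff u {#} \<noteq> 0"
    "\<forall>k. mfps_coeff (\<phi> $ k) {#} = 0" "u *s (r *s a) = formal_pullback \<phi> \<omega>" by blast
  then show ?thesis
    using r0 by (intro exI[of _ "u * r"] exI[of _ \<phi>] exI[of _ \<omega>]) (simp add: vector_smult_assoc)
qed

text \<open>The shear \<open>\<sigma>\<close> replaces x_j by x_j + x_i, which turns a mixed term
  x_i x_j into one containing a square. The four-term sum is the resulting x_i-coefficient of the
  dx_i-component, and \<open>\<tau>\<close> undoes the shear.\<close>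

lemma hyperbolic_direction:
  fixes a :: "('n::finite, 'a::field_char_0) formal_form"
  assumes int: "fintegrable a" and a0: "\<And>k. mfps_coeff (a $ k) {#} = 0" and ij: "i \<noteq> j"
    and aij: "mfps_coeff (a $ i) {#i#} + mfps_coeff (a $ i) {#j#} +
      mfps_coeff (a $ j) {#i#} + mfps_coeff (a $ j) {#j#} \<noteq> 0"
  shows "\<exists>u (\<phi> :: ('n, 'a) mfps ^ 2) \<omega>. mfps_coeff u {#} \<noteq> 0 \<and>
    (\<forall>k. mfps_coeff (\<phi> $ k) {#} = 0) \<and> u *s a = formal_pullback \<phi> \<omega>"
proof -
  define \<sigma> :: "('n, 'a) mfps ^ 'n" where "\<sigma> = (\<chi> l. mfps_X l + (if l = j then mfps_X i else 0))"
  define \<tau> :: "('n, 'a) mfps ^ 'n" where "\<tau> = (\<chi> l. mfps_X l - (if l = j then mfps_X i else 0))"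
  have \<sigma>0: "mfps_coeff (\<sigma> $ l) {#} = 0" and \<tau>0: "mfps_coeff (\<tau> $ l) {#} = 0" for l
    by (auto simp: \<sigma>_def \<tau>_def coeff_X)
  define s where "s f = mfps_subst \<sigma> f" for f
  have D\<sigma>: "mfps_deriv p (\<sigma> $ l) = (if l = p then 1 else 0) + (if l = j then if p = i then 1 else 0 else 0)" for p l
    by (simp add: \<sigma>_def deriv_X)
  have dist: "(\<Sum>l\<in>UNIV. t l * mfps_deriv p (\<sigma> $ l)) = t p + (if p = i then t j else 0)"
    for t :: "'n \<Rightarrow> ('n, 'a) mfps" and p
    by (simp add: D\<sigma> distrib_left sum.distrib if_distrib[of "\<lambda>x. _ * x"] cong: if_cong)
  have Ds: "mfps_deriv p (s f) = s (mfps_deriv p f) + (if p = i then s (mfps_deriv j f) else 0)" for p f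
    unfolding s_def deriv_subst[of \<sigma>, OF \<sigma>0] dist ..
  define b where "b = formal_pullback \<sigma> a"
  have b: "b $ l = s (a $ l) + (if l = i then s (a $ j) else 0)" for l
    unfolding b_def formal_pullback_def s_def by (simp only: vec_lambda_beta dist)
  define d where "d p q = s (fderiv a p q)" for p q
  have anti: "d q p = - d p q" for p q
    using fderiv_antisym[of a q p] subst_diff[of \<sigma> 0 "fderiv a p q"] by (simp add: d_def s_def)
  have d0: "d p p = 0" for p by (simp add: d_def fderiv_def s_def)
  have db: "fderiv b p q = d p q + (if p = i then d j q else 0) + (if q = i then d p j else 0)" for p q
    using d0[of j] unfolding fderiv_def b
    by (simp add: Ds d_def fderiv_def) (simp add: s_def)
  have w: "s (a $ p) * d q r - s (a $ q) * d p r + s (a $ r) * d p q = 0" for p q r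
  proof -
    have "s (a $ p * fderiv a q r - a $ q * fderiv a p r + a $ r * fderiv a p q) = 0"
      unfolding fintegrableD[OF int] by (simp add: s_def)
    then show ?thesis by (simp add: s_def d_def subst_mult \<sigma>0)
  qed
  have "fintegrable b"
    unfolding fintegrable_def b db
  proof (intro allI)
    fix p q r
    define A where "A l = s (a $ l)" for l
    note w = w[folded A_def]
    \<comment> \<open>\<open>P\<close>, \<open>Q\<close>, \<open>R\<close> stand for the indicators
      of p = i, q = i, r = i. By multilinearity the component is a combination of instances of
      \<open>w\<close> and one antisymmetric pair.\<close>
    have alg: "(A p + P * A j) * (d q r + Q * d j r + R * d q j) -
        (A q + Q * A j) * (d p r + P * d j r + R * d p j) +
        (A r + R * A j) * (d p q + P * d j q + Q * d p j) = 0" for P Q R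
    proof -
      have "(A p + P * A j) * (d q r + Q * d j r + R * d q j) -
        (A q + Q * A j) * (d p r + P * d j r + R * d p j) +
        (A r + R * A j) * (d p q + P * d j q + Q * d p j) =
        (A p * d q r - A q * d p r + A r * d p q) +
        P * (A j * d q r - A q * d j r + A r * d j q) +
        Q * (A p * d j r - A j * d p r + A r * d p j) +
        R * (A p * d q j - A q * d p j + A j * d p q) +
        P * R * A j * (d q j + d j q)"
        by (simp add: algebra_simps)
      also have "\<dots> = 0" unfolding w using anti[of j q] by simp
      finally show ?thesis .
    qed
    have if_mult: "(if c then y else 0) = (if c then 1 else 0) * y" for c and y :: "('n, 'a) mfps" by simp
    show "(s (a $ p) + (if p = i then s (a $ j) else 0)) *
        (d q r + (if q = i then d j r else 0) + (if r = i then d q j else 0)) -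
        (s (a $ q) + (if q = i then s (a $ j) else 0)) *
        (d p r + (if p = i then d j r else 0) + (if r = i then d p j else 0)) +
        (s (a $ r) + (if r = i then s (a $ j) else 0)) *
        (d p q + (if p = i then d j q else 0) + (if q = i then d p j else 0)) = 0"
      using alg[of "if p = i then 1 else 0" "if q = i then 1 else 0" "if r = i then 1 else 0"]
      unfolding A_def if_mult[symmetric] .
  qed
  moreover have "mfps_coeff (b $ i) {#} = 0" by (simp add: b s_def a0)
  moreover have "mfps_coeff (b $ i) {#i#} \<noteq> 0"
  proof -
    have "mfps_coeff (b $ i) {#i#} = mfps_coeff (mfps_deriv i (b $ i)) {#}" by (simp add: coeff_deriv)
    also have "\<dots> = mfps_coeff (a $ i) {#i#} + mfps_coeff (a $ i) {#j#} +
        mfps_coeff (a $ j) {#i#} + mfps_coeff (a $ j) {#j#}"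
      by (simp add: b Ds) (simp add: s_def coeff_deriv)
    finally show ?thesis using aij by simp
  qed
  ultimately obtain u and \<phi> :: "('n, 'a) mfps ^ 2" and \<omega> where u: "mfps_coeff u {#} \<noteq> 0"
    and \<phi>: "\<And>k. mfps_coeff (\<phi> $ k) {#} = 0" and eq: "u *s b = formal_pullback \<phi> \<omega>"
    using nondegenerate_direction[of b i] by blast
  have "(\<chi> k. mfps_subst \<tau> (\<sigma> $ k)) = (\<chi> k. mfps_X k)"
  proof (simp add: vec_eq_iff, intro allI)
    fix k show "mfps_subst \<tau> (\<sigma> $ k) = mfps_X k"
      using ij by (simp add: \<sigma>_def subst_X \<tau>0) (simp add: \<tau>_def)
  qed
  then have "formal_pullback \<tau> b = formal_pullback (\<chi> k. mfps_X k) a"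
    unfolding b_def by (simp add: formal_pullback_comp \<sigma>0 \<tau>0)
  also have "\<dots> = a"
  proof -
    have "(\<Sum>k\<in>UNIV. a $ k * mfps_deriv l (mfps_X k)) = a $ l" for l
      by (simp add: deriv_X if_distrib[of "\<lambda>x. _ * x"] cong: if_cong)
    then show ?thesis by (simp add: vec_eq_iff formal_pullback_def subst_X_id)
  qed
  finally have "mfps_subst \<tau> u *s a = formal_pullback \<tau> (u *s b)"
    by (simp add: formal_pullback_scale \<tau>0)
  then have "mfps_subst \<tau> u *s a = formal_pullback (\<chi> k. mfps_subst \<tau> (\<phi> $ k)) \<omega>"
    by (simp add: eq formal_pullback_comp \<phi> \<tau>0)
  then show ?thesis using u \<phi>
    by (intro exI[of _ "mfps_subst \<tau> u"] exI[of _ "\<chi> k. mfps_subst \<tau> (\<phi> $ k)"] exI[of _ \<omega>]) simp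
qed

theorem formal_pullback_two_variables:
  fixes a :: "('n::finite, 'a::field_char_0) formal_form"
  assumes int: "fintegrable a" and a0: "\<And>k. mfps_coeff (a $ k) {#} = 0"
    and lin: "mfps_coeff (a $ i) {#j#} \<noteq> 0"
  shows "\<exists>u (\<phi> :: ('n, 'a) mfps ^ 2) \<omega>. mfps_coeff u {#} \<noteq> 0 \<and>
    (\<forall>k. mfps_coeff (\<phi> $ k) {#} = 0) \<and> u *s a = formal_pullback \<phi> \<omega>"
proof (cases "mfps_coeff (a $ i) {#i#} \<noteq> 0 \<or> mfps_coeff (a $ j) {#j#} \<noteq> 0")
  case True
  then show ?thesis using nondegenerate_direction[OF int a0] by blast
next
  case diag: False
  show ?thesis
  proof (cases "mfps_coeff (fderiv a i j) {#} = 0")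
    case True
    then have "mfps_coeff (a $ j) {#i#} = mfps_coeff (a $ i) {#j#}"
      by (simp add: fderiv_def coeff_deriv)
    moreover have "i \<noteq> j" using diag lin by auto
    \<comment> \<open>The diagonal coefficients vanish and the mixed ones agree, so the four-term
      sum is twice a non-zero number.\<close>
    ultimately show ?thesis
      using lin diag by (intro hyperbolic_direction[OF int a0, of i j]) auto
  next
    case False
    from kupka[OF int this] show ?thesis
      by (metis coeff_one one_neq_zero vector_smult_lid)
  qed
qed

section \<open>Taylor expansion\<close>

lemma has_partial_deriv:
  assumes "f differentiable (at x)"
  shows "((\<lambda>t. f (x + t *\<^sub>R axis i 1)) has_real_derivative partial_deriv i f x) (at 0)"
proof -
  have "(f has_derivative frechet_derivative f (at x)) (at (x + 0 *\<^sub>R axis i 1))"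
    using assms by (simp add: frechet_derivative_works[symmetric])
  moreover have "((\<lambda>t. x + t *\<^sub>R axis i 1) has_derivative (\<lambda>t. t *\<^sub>R axis i 1)) (at 0)"
    by (auto intro!: derivative_eq_intros)
  ultimately have "((\<lambda>t. f (x + t *\<^sub>R axis i 1)) has_derivative
      (\<lambda>t. frechet_derivative f (at x) (t *\<^sub>R axis i 1))) (at 0)"
    by (rule has_derivative_compose[rotated])
  moreover have "frechet_derivative f (at x) (t *\<^sub>R axis i 1) = t * partial_deriv i f x" for t
    using linear_frechet_derivative[OF assms] by (simp add: partial_deriv_def linear_cmul)
  ultimately show ?thesis
    by (simp add: has_field_derivative_def mult_commute_abs)
qed

lemma has_partial_deriv':
  assumes "f differentiable (at (x + t *\<^sub>R axis i 1))"
  shows "((\<lambda>t. f (x + t *\<^sub>R axis i 1)) has_real_derivative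
    partial_deriv i f (x + t *\<^sub>R axis i 1)) (at t)"
  using has_partial_deriv[OF assms] DERIV_shift[of "\<lambda>t. f (x + t *\<^sub>R axis i 1)" _ 0 t]
  by (simp add: algebra_simps)

lemma partial_deriv_cong:
  assumes "open S" "x \<in> S" "\<And>y. y \<in> S \<Longrightarrow> f y = g y"
  shows "partial_deriv i f x = partial_deriv i g x"
proof -
  have "(f has_derivative f') (at x) \<longleftrightarrow> (g has_derivative f') (at x)" for f'
    using assms(3) by (auto intro: has_derivative_transform_within_open[OF _ assms(1,2)])
  then show ?thesis by (simp add: partial_deriv_def frechet_derivative_def)
qed

lemma foldr_partial_deriv_cong:
  assumes "open S" "\<And>y. y \<in> S \<Longrightarrow> f y = g y" "x \<in> S"
  shows "foldr partial_deriv is f x = foldr partial_deriv is g x"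
  using assms(3)
proof (induction "is" arbitrary: x)
  case (Cons i "is")
  show ?case using partial_deriv_cong[OF assms(1) Cons.prems Cons.IH] by simp
qed (use assms in simp)

lemma smooth_fun_on_partial_deriv:
  assumes "smooth_fun_on S f"
  shows "smooth_fun_on S (partial_deriv i f)"
  unfolding smooth_fun_on_def
proof
  fix "is"
  show "\<forall>x\<in>S. foldr partial_deriv is (partial_deriv i f) differentiable (at x)"
    using assms[unfolded smooth_fun_on_def, rule_format, of _ "is @ [i]"] by simp
qed

lemma smooth_fun_on_diff: "smooth_fun_on S f \<Longrightarrow> x \<in> S \<Longrightarrow> f differentiable (at x)"
  unfolding smooth_fun_on_def by (auto dest: spec[of _ "[]"])

text \<open>The second difference quotient of \<open>f\<close> in the directions \<open>i\<close> and \<open>j\<close>, symmetric in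
  \<open>i\<close> and \<open>j\<close>, is by the mean value theorem a value of either mixed derivative near \<open>x\<close>.\<close>

lemma second_difference:
  fixes f :: "real ^ 'n::finite \<Rightarrow> real"
  assumes S: "ball x r \<subseteq> S" and h: "0 < h" "2 * h < r"
    and f: "\<And>y. y \<in> S \<Longrightarrow> f differentiable (at y)"
    and fi: "\<And>y. y \<in> S \<Longrightarrow> partial_deriv i f differentiable (at y)"
  shows "\<exists>y. dist x y \<le> 2 * h \<and>
    f (x + h *\<^sub>R axis i 1 + h *\<^sub>R axis j 1) - f (x + h *\<^sub>R axis i 1) - f (x + h *\<^sub>R axis j 1) + f x =
    h * h * partial_deriv j (partial_deriv i f) y"
proof -
  have near: "dist x (x + s *\<^sub>R axis i 1 + t *\<^sub>R axis j 1) \<le> 2 * h"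
    if "0 \<le> s" "s \<le> h" "0 \<le> t" "t \<le> h" for s t
  proof -
    have "norm (s *\<^sub>R axis i 1 + t *\<^sub>R axis j 1 :: real ^ 'n) \<le> \<bar>s\<bar> + \<bar>t\<bar>"
      by (rule order_trans[OF norm_triangle_ineq]) simp
    then have "norm (s *\<^sub>R axis i 1 + t *\<^sub>R axis j 1 :: real ^ 'n) \<le> 2 * h" using that by simp
    moreover have "dist x (x + v) = norm v" for v by (simp add: dist_norm)
    ultimately show ?thesis by (simp add: add.assoc)
  qed
  then have mem: "x + s *\<^sub>R axis i 1 + t *\<^sub>R axis j 1 \<in> S"
    if "0 \<le> s" "s \<le> h" "0 \<le> t" "t \<le> h" for s t
    using that S h by (intro subsetD[OF S]) (auto simp: intro: order_le_less_trans)
  define g where "g s = f (x + h *\<^sub>R axis j 1 + s *\<^sub>R axis i 1) - f (x + s *\<^sub>R axis i 1)" for s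
  have "\<exists>s. 0 < s \<and> s < h \<and> g h - g 0 = (h - 0) *
      (partial_deriv i f (x + h *\<^sub>R axis j 1 + s *\<^sub>R axis i 1) - partial_deriv i f (x + s *\<^sub>R axis i 1))"
  proof (rule MVT2[OF h(1)])
    fix s assume s: "0 \<le> s" "s \<le> h"
    then show "(g has_real_derivative partial_deriv i f (x + h *\<^sub>R axis j 1 + s *\<^sub>R axis i 1) -
        partial_deriv i f (x + s *\<^sub>R axis i 1)) (at s)"
      unfolding g_def using mem[of s h] mem[of s 0] h
      by (intro DERIV_diff has_partial_deriv' f) (auto simp: ac_simps)
  qed
  then obtain s where s: "0 < s" "s < h" and gs: "g h - g 0 = h *
      (partial_deriv i f (x + h *\<^sub>R axis j 1 + s *\<^sub>R axis i 1) - partial_deriv i f (x + s *\<^sub>R axis i 1))"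
    by auto
  let ?x = "x + s *\<^sub>R axis i 1"
  have "\<exists>t. 0 < t \<and> t < h \<and> partial_deriv i f (?x + h *\<^sub>R axis j 1) - partial_deriv i f (?x + 0 *\<^sub>R axis j 1) =
      (h - 0) * partial_deriv j (partial_deriv i f) (?x + t *\<^sub>R axis j 1)"
    by (rule MVT2[OF h(1)], intro has_partial_deriv' fi mem) (use s in auto)
  then obtain t where t: "0 < t" "t < h" and
    "partial_deriv i f (?x + h *\<^sub>R axis j 1) - partial_deriv i f ?x =
      h * partial_deriv j (partial_deriv i f) (?x + t *\<^sub>R axis j 1)" by auto
  then have "g h - g 0 = h * h * partial_deriv j (partial_deriv i f) (?x + t *\<^sub>R axis j 1)"
    using gs by (simp add: ac_simps)
  then show ?thesis
    using near[of s t] s t by (intro exI[of _ "?x + t *\<^sub>R axis j 1"]) (simp add: g_def ac_simps)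
qed

lemma partial_deriv_commute:
  fixes f :: "real ^ 'n::finite \<Rightarrow> real"
  assumes "open S" "x \<in> S" and f: "smooth_fun_on S f"
  shows "partial_deriv i (partial_deriv j f) x = partial_deriv j (partial_deriv i f) x"
proof -
  obtain r where r: "r > 0" "ball x r \<subseteq> S" using assms(1,2) open_contains_ball by blast
  \<comment> \<open>Here 2 * \<open>h n\<close> is r / (n + 2), so the points of every second
    difference stay in the ball.\<close>
  define h where "h n = r / 2 * inverse (real (Suc (Suc n)))" for n
  have h: "0 < h n" "2 * h n < r" for n
  proof -
    show "0 < h n" using r by (simp add: h_def)
    show "2 * h n < r" using r by (simp add: h_def field_simps add_pos_nonneg)
  qed
  have h0: "h \<longlonglongrightarrow> 0"
    unfolding h_def using tendsto_mult[OF tendsto_const LIMSEQ_Suc[OF LIMSEQ_inverse_real_of_nat]] by fastforce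
  let ?\<Delta> = "\<lambda>n. f (x + h n *\<^sub>R axis i 1 + h n *\<^sub>R axis j 1) - f (x + h n *\<^sub>R axis i 1) -
    f (x + h n *\<^sub>R axis j 1) + f x"
  have *: "(\<lambda>n. ?\<Delta> n / (h n * h n)) \<longlonglongrightarrow> partial_deriv q (partial_deriv p f) x"
    if pq: "p = i \<and> q = j \<or> p = j \<and> q = i" for p q
  proof -
    have "\<exists>y. dist x y \<le> 2 * h n \<and> ?\<Delta> n = h n * h n * partial_deriv q (partial_deriv p f) y" for n
      using pq second_difference[OF r(2) h[of n], of f p q]
        smooth_fun_on_diff[OF f] smooth_fun_on_diff[OF smooth_fun_on_partial_deriv[OF f]]
      by (auto simp: ac_simps)
    then obtain y where y: "\<And>n. dist x (y n) \<le> 2 * h n"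
      "\<And>n. ?\<Delta> n = h n * h n * partial_deriv q (partial_deriv p f) (y n)" by metis
    have "y \<longlonglongrightarrow> x"
    proof (rule metric_tendsto_imp_tendsto[of "\<lambda>n. 2 * h n" 0])
      show "(\<lambda>n. 2 * h n) \<longlonglongrightarrow> 0" using tendsto_mult[OF tendsto_const h0] by simp
      show "\<forall>\<^sub>F n in sequentially. dist (y n) x \<le> dist (2 * h n) 0"
        using y(1) h(1) by (auto simp: dist_commute less_imp_le)
    qed
    moreover have "isCont (partial_deriv q (partial_deriv p f)) x"
      by (rule differentiable_imp_continuous_within)
        (intro smooth_fun_on_diff[OF _ assms(2)] smooth_fun_on_partial_deriv f)
    ultimately have "(\<lambda>n. partial_deriv q (partial_deriv p f) (y n)) \<longlonglongrightarrow> partial_deriv q (partial_deriv p f) x"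
      using isCont_tendsto_compose by blast
    moreover have "partial_deriv q (partial_deriv p f) (y n) = ?\<Delta> n / (h n * h n)" for n
      using y(2)[of n] h(1)[of n] by simp
    ultimately show ?thesis by simp
  qed
  from *[of i j] *[of j i] show ?thesis by (auto intro: LIMSEQ_unique)
qed

text \<open>Makes \<open>taylor\<close> independent of the list that \<open>SOME\<close>
  selects.\<close>

lemma foldr_partial_deriv_mset:
  fixes f :: "real ^ 'n::finite \<Rightarrow> real"
  assumes S: "open S" "x \<in> S" "smooth_fun_on S f" and "mset is = mset js"
  shows "foldr partial_deriv is f x = foldr partial_deriv js f x"
  using assms(2-)
proof (induction "is" arbitrary: js f x)
  case (Cons i "is")
  then obtain xs ys where js: "js = xs @ i # ys"
    by (metis in_set_conv_decomp list.set_intros(1) mset_eq_setD)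
  have eq: "mset is = mset (xs @ ys)" using Cons.prems(3) js by simp
  have smooth: "smooth_fun_on S (foldr partial_deriv zs f)" for zs
    by (induction zs) (auto intro: smooth_fun_on_partial_deriv Cons.prems(2))
  have "foldr partial_deriv (xs @ i # ys) f y = partial_deriv i (foldr partial_deriv (xs @ ys) f) y"
    if "y \<in> S" for y
    using that
  proof (induction xs arbitrary: y)
    case (Cons z zs)
    then have "foldr partial_deriv ((z # zs) @ i # ys) f y =
        partial_deriv z (partial_deriv i (foldr partial_deriv (zs @ ys) f)) y"
      using partial_deriv_cong[OF S(1) Cons.prems Cons.IH] by simp
    also have "\<dots> = partial_deriv i (partial_deriv z (foldr partial_deriv (zs @ ys) f)) y"
      by (rule partial_deriv_commute[OF S(1) Cons.prems smooth])
    finally show ?case by simp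
  qed simp
  then have "foldr partial_deriv js f x = partial_deriv i (foldr partial_deriv (xs @ ys) f) x"
    using Cons.prems js by simp
  also have "\<dots> = partial_deriv i (foldr partial_deriv is f) x"
    by (rule partial_deriv_cong[OF S(1) Cons.prems(1)]) (metis Cons.IH Cons.prems(2) eq)
  finally show ?case by simp
qed simp

section \<open>Taylor coefficients and derivatives\<close>

lemma coeff_taylor_empty: "mfps_coeff (taylor f) {#} = f 0"
  by (simp add: taylor_def)

lemma taylor_cong:
  assumes "open S" "0 \<in> S" "\<And>y. y \<in> S \<Longrightarrow> f y = g y"
  shows "taylor f = taylor g"
  unfolding taylor_def by (simp add: foldr_partial_deriv_cong[OF assms(1,3,2)])

lemma prod_fact_add_mset:
  "(\<Prod>k\<in>set_mset (add_mset i \<mu>). fact (count (add_mset i \<mu>) k) :: real) =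
    of_nat (Suc (count \<mu> i)) * (\<Prod>k\<in>set_mset \<mu>. fact (count \<mu> k))"
proof -
  have "(\<Prod>k\<in>set_mset (add_mset i \<mu>). fact (count (add_mset i \<mu>) k) :: real) =
      fact (Suc (count \<mu> i)) * (\<Prod>k\<in>set_mset \<mu> - {i}. fact (count \<mu> k))"
    by (subst prod.remove[of _ i]) (auto intro!: prod.cong split: if_splits)
  also have "(\<Prod>k\<in>set_mset \<mu>. fact (count \<mu> k) :: real) =
      fact (count \<mu> i) * (\<Prod>k\<in>set_mset \<mu> - {i}. fact (count \<mu> k))"
  proof (cases "i \<in># \<mu>")
    case False
    then have "count \<mu> i = 0" by (simp only: not_in_iff)
    then show ?thesis using False by simp
  qed (simp add: prod.remove[of _ i])
  ultimately show ?thesis by simp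
qed

lemma deriv_taylor:
  fixes f :: "real ^ 'n::finite \<Rightarrow> real"
  assumes S: "open S" "0 \<in> S" "smooth_fun_on S f"
  shows "mfps_deriv i (taylor f) = taylor (partial_deriv i f)"
proof (rule mfps_eqI)
  fix \<mu> :: "'n multiset"
  let ?js = "SOME is. mset is = add_mset i \<mu>" and ?is = "SOME is. mset is = \<mu>"
  have "mset ?js = add_mset i \<mu>" "mset ?is = \<mu>"
    using ex_mset by (metis (mono_tags, lifting) someI_ex)+
  then have "foldr partial_deriv ?js f 0 = foldr partial_deriv (?is @ [i]) f 0"
    by (intro foldr_partial_deriv_mset[OF S]) simp
  then show "mfps_coeff (mfps_deriv i (taylor f)) \<mu> = mfps_coeff (taylor (partial_deriv i f)) \<mu>"
    unfolding coeff_deriv taylor_def mfps_coeff_Abs prod_fact_add_mset by simp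
qed

section \<open>Smooth functions as an algebra\<close>

lemma partial_deriv_add:
  assumes "f differentiable (at x)" "g differentiable (at x)"
  shows "partial_deriv i (\<lambda>x. f x + g x) x = partial_deriv i f x + partial_deriv i g x"
proof -
  have "((\<lambda>x. f x + g x) has_derivative
      (\<lambda>h. frechet_derivative f (at x) h + frechet_derivative g (at x) h)) (at x)"
    using assms by (intro has_derivative_add) (simp_all add: frechet_derivative_works[symmetric])
  then show ?thesis
    by (simp add: partial_deriv_def frechet_derivative_at[symmetric])
qed

lemma partial_deriv_diff:
  assumes "f differentiable (at x)" "g differentiable (at x)"
  shows "partial_deriv i (\<lambda>x. f x - g x) x = partial_deriv i f x - partial_deriv i g x"
proof -
  have "((\<lambda>x. f x - g x) has_derivative
      (\<lambda>h. frechet_derivative f (at x) h - frechet_derivative g (at x) h)) (at x)"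
    using assms by (intro has_derivative_diff) (simp_all add: frechet_derivative_works[symmetric])
  then show ?thesis
    by (simp add: partial_deriv_def frechet_derivative_at[symmetric])
qed

lemma partial_deriv_mult:
  fixes f g :: "real ^ 'n::finite \<Rightarrow> real"
  assumes "f differentiable (at x)" "g differentiable (at x)"
  shows "partial_deriv i (\<lambda>x. f x * g x) x = partial_deriv i f x * g x + f x * partial_deriv i g x"
proof -
  have "((\<lambda>x. f x * g x) has_derivative
      (\<lambda>h. f x * frechet_derivative g (at x) h + frechet_derivative f (at x) h * g x)) (at x)"
    using assms by (intro has_derivative_mult) (simp_all add: frechet_derivative_works[symmetric])
  then show ?thesis
    by (simp add: partial_deriv_def frechet_derivative_at[symmetric])
qed

text \<open>Closure of \<open>Q\<close> under derivatives is asked only up to equality on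
  \<open>S\<close>, since the differentiation rules are available only there; openness of
  \<open>S\<close> makes this enough for the next derivative.\<close>

lemma smooth_fun_on_coinduct:
  assumes "open S" and diff: "\<And>f x. Q f \<Longrightarrow> x \<in> S \<Longrightarrow> f differentiable (at x)"
    and step: "\<And>f i. Q f \<Longrightarrow> \<exists>g. Q g \<and> (\<forall>x\<in>S. partial_deriv i f x = g x)" and "Q f"
  shows "smooth_fun_on S f"
proof -
  have "\<exists>g. Q g \<and> (\<forall>x\<in>S. foldr partial_deriv is f x = g x)" for "is"
  proof (induction "is")
    case (Cons i "is")
    then obtain g where g: "Q g" "\<And>x. x \<in> S \<Longrightarrow> foldr partial_deriv is f x = g x" by blast
    then obtain g' where "Q g'" "\<And>x. x \<in> S \<Longrightarrow> partial_deriv i g x = g' x" using step by blast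
    then show ?case using partial_deriv_cong[OF assms(1) _ g(2)] by auto
  qed (use assms(4) in auto)
  then show ?thesis
    unfolding smooth_fun_on_def differentiable_def
    using diff[unfolded differentiable_def]
    by (metis assms(1) has_derivative_transform_within_open)
qed

text \<open>
  Closing the smooth functions under arithmetic makes the set of functions stable under partial
  derivatives, so that smoothness of sums and products follows by coinduction.
\<close>

inductive smooth_alg :: "(real ^ 'n::finite) set \<Rightarrow> (real ^ 'n \<Rightarrow> real) \<Rightarrow> bool" for S where
  smooth_alg_base: "smooth_fun_on S f \<Longrightarrow> smooth_alg S f"
| smooth_alg_add: "smooth_alg S f \<Longrightarrow> smooth_alg S g \<Longrightarrow> smooth_alg S (\<lambda>x. f x + g x)"
| smooth_alg_diff: "smooth_alg S f \<Longrightarrow> smooth_alg S g \<Longrightarrow> smooth_alg S (\<lambda>x. f x - g x)"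
| smooth_alg_mult: "smooth_alg S f \<Longrightarrow> smooth_alg S g \<Longrightarrow> smooth_alg S (\<lambda>x. f x * g x)"

lemma smooth_alg_differentiable: "smooth_alg S f \<Longrightarrow> x \<in> S \<Longrightarrow> f differentiable (at x)"
  by (induction rule: smooth_alg.induct) (auto intro: smooth_fun_on_diff)

lemma smooth_alg_partial_deriv:
  "smooth_alg S f \<Longrightarrow> \<exists>g. smooth_alg S g \<and> (\<forall>x\<in>S. partial_deriv i f x = g x)"
proof (induction rule: smooth_alg.induct)
  case (smooth_alg_base f)
  then show ?case using smooth_fun_on_partial_deriv smooth_alg.smooth_alg_base by blast
next
  case (smooth_alg_add f g)
  then obtain f' g' where "smooth_alg S f'" "\<forall>x\<in>S. partial_deriv i f x = f' x"
    "smooth_alg S g'" "\<forall>x\<in>S. partial_deriv i g x = g' x" by blast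
  with smooth_alg_add show ?case
    by (intro exI[of _ "\<lambda>x. f' x + g' x"])
      (auto simp: partial_deriv_add smooth_alg_differentiable intro: smooth_alg.smooth_alg_add)
next
  case (smooth_alg_diff f g)
  then obtain f' g' where "smooth_alg S f'" "\<forall>x\<in>S. partial_deriv i f x = f' x"
    "smooth_alg S g'" "\<forall>x\<in>S. partial_deriv i g x = g' x" by blast
  with smooth_alg_diff show ?case
    by (intro exI[of _ "\<lambda>x. f' x - g' x"])
      (auto simp: partial_deriv_diff smooth_alg_differentiable intro: smooth_alg.smooth_alg_diff)
next
  case (smooth_alg_mult f g)
  then obtain f' g' where "smooth_alg S f'" "\<forall>x\<in>S. partial_deriv i f x = f' x"
    "smooth_alg S g'" "\<forall>x\<in>S. partial_deriv i g x = g' x" by blast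
  with smooth_alg_mult show ?case
    by (intro exI[of _ "\<lambda>x. f' x * g x + f x * g' x"])
      (auto simp: partial_deriv_mult smooth_alg_differentiable
        intro: smooth_alg.smooth_alg_add smooth_alg.smooth_alg_mult)
qed

lemma smooth_alg_smooth: "open S \<Longrightarrow> smooth_alg S f \<Longrightarrow> smooth_fun_on S f"
  by (rule smooth_fun_on_coinduct[where Q = "smooth_alg S"])
    (auto intro: smooth_alg_differentiable smooth_alg_partial_deriv)

lemma smooth_fun_on_arith:
  assumes "open S" "smooth_fun_on S f" "smooth_fun_on S g"
  shows "smooth_fun_on S (\<lambda>x. f x + g x)" "smooth_fun_on S (\<lambda>x. f x - g x)"
    "smooth_fun_on S (\<lambda>x. f x * g x)"
  using assms by (auto intro: smooth_alg_smooth smooth_alg.intros)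

section \<open>Taylor expansion as a ring homomorphism\<close>

lemma taylor_add:
  assumes S: "open S" "0 \<in> S" and f: "smooth_fun_on S f" and g: "smooth_fun_on S g"
  shows "taylor (\<lambda>x. f x + g x) = taylor f + taylor g"
proof -
  have "foldr partial_deriv is (\<lambda>x. f x + g x) x = foldr partial_deriv is f x + foldr partial_deriv is g x"
    if "x \<in> S" for "is" x
    using that
  proof (induction "is" arbitrary: x)
    case (Cons i "is")
    have "foldr partial_deriv (i # is) (\<lambda>x. f x + g x) x =
        partial_deriv i (\<lambda>x. foldr partial_deriv is f x + foldr partial_deriv is g x) x"
      using partial_deriv_cong[OF S(1) Cons.prems Cons.IH] by simp
    then show ?case
      using Cons.prems f g by (simp add: partial_deriv_add smooth_fun_on_def)
  qed simp
  then show ?thesis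
    using S(2) by (intro mfps_eqI) (simp add: taylor_def add_divide_distrib)
qed

lemma taylor_diff:
  assumes S: "open S" "0 \<in> S" and f: "smooth_fun_on S f" and g: "smooth_fun_on S g"
  shows "taylor (\<lambda>x. f x - g x) = taylor f - taylor g"
proof -
  have "foldr partial_deriv is (\<lambda>x. f x - g x) x = foldr partial_deriv is f x - foldr partial_deriv is g x"
    if "x \<in> S" for "is" x
    using that
  proof (induction "is" arbitrary: x)
    case (Cons i "is")
    have "foldr partial_deriv (i # is) (\<lambda>x. f x - g x) x =
        partial_deriv i (\<lambda>x. foldr partial_deriv is f x - foldr partial_deriv is g x) x"
      using partial_deriv_cong[OF S(1) Cons.prems Cons.IH] by simp
    then show ?case
      using Cons.prems f g by (simp add: partial_deriv_diff smooth_fun_on_def)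
  qed simp
  then show ?thesis
    using S(2) by (intro mfps_eqI) (simp add: taylor_def diff_divide_distrib)
qed

text \<open>The coefficient at \<open>add_mset i \<mu>\<close> is, up to a non-zero integer, that of
  the i-th derivative at \<open>\<mu>\<close>. The Leibniz rule on both sides then leads to other
  pairs of functions, hence the induction over arbitrary \<open>f\<close> and
  \<open>g\<close>.\<close>

lemma taylor_mult:
  assumes S: "open S" "0 \<in> S" and "smooth_fun_on S f" "smooth_fun_on S g"
  shows "taylor (\<lambda>x. f x * g x) = taylor f * taylor g"
proof (rule mfps_eqI)
  fix \<mu>
  show "mfps_coeff (taylor (\<lambda>x. f x * g x)) \<mu> = mfps_coeff (taylor f * taylor g) \<mu>"
    using assms(3,4)
  proof (induction \<mu> arbitrary: f g)
    case empty
    then show ?case by (simp add: coeff_taylor_empty)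
  next
    case (add i \<mu>)
    note f = add.prems(1) and g = add.prems(2)
    note f' = smooth_fun_on_partial_deriv[OF f, of i] and g' = smooth_fun_on_partial_deriv[OF g, of i]
    have "mfps_deriv i (taylor (\<lambda>x. f x * g x)) = taylor (partial_deriv i (\<lambda>x. f x * g x))"
      by (intro deriv_taylor[OF S] smooth_fun_on_arith S f g)
    also have "\<dots> = taylor (\<lambda>x. partial_deriv i f x * g x + f x * partial_deriv i g x)"
      by (rule taylor_cong[OF S]) (simp add: partial_deriv_mult smooth_fun_on_diff[OF f] smooth_fun_on_diff[OF g])
    also have "\<dots> = taylor (\<lambda>x. partial_deriv i f x * g x) + taylor (\<lambda>x. f x * partial_deriv i g x)"
      by (intro taylor_add[OF S] smooth_fun_on_arith S f g f' g')
    finally have "mfps_coeff (mfps_deriv i (taylor (\<lambda>x. f x * g x))) \<mu> =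
        mfps_coeff (mfps_deriv i (taylor f * taylor g)) \<mu>"
      by (simp add: deriv_mult add.IH[OF f' g] add.IH[OF f g'] deriv_taylor[OF S f] deriv_taylor[OF S g])
    then show ?case by (simp add: coeff_deriv del: of_nat_Suc)
  qed
qed

lemma fintegrable_taylor_form:
  assumes S: "open S" "0 \<in> S" and a: "\<And>i. smooth_fun_on S (\<lambda>x. a x $ i)"
    and int: "\<And>x i j k. x \<in> S \<Longrightarrow> wedge12 (a x) (ext_deriv a x) i j k = 0"
  shows "fintegrable (taylor_form a)"
  unfolding fintegrable_def
proof (intro allI)
  fix i j k
  let ?d = "\<lambda>i j x. ext_deriv a x i j"
  note a' = smooth_fun_on_partial_deriv[OF a]
  have d: "smooth_fun_on S (?d p q)" for p q
    unfolding ext_deriv_def by (intro smooth_fun_on_arith S a')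
  have td: "fderiv (taylor_form a) p q = taylor (?d p q)" for p q
    unfolding ext_deriv_def
    by (subst taylor_diff[OF S a' a']) (simp add: fderiv_def taylor_form_def deriv_taylor[OF S a])
  have "taylor (\<lambda>x. wedge12 (a x) (ext_deriv a x) i j k) =
      taylor_form a $ i * fderiv (taylor_form a) j k - taylor_form a $ j * fderiv (taylor_form a) i k +
      taylor_form a $ k * fderiv (taylor_form a) i j"
    unfolding wedge12_def td
    by (simp add: taylor_add[OF S] taylor_diff[OF S] taylor_mult[OF S] smooth_fun_on_arith S(1) a d
        taylor_form_def)
  \<comment> \<open>The zero function is written as a difference of smooth functions, so that
    \<open>taylor_diff\<close> evaluates its expansion.\<close>
  also have "taylor (\<lambda>x. wedge12 (a x) (ext_deriv a x) i j k) = taylor (\<lambda>x. a x $ i - a x $ i)"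
    by (rule taylor_cong[OF S]) (simp add: int)
  also have "\<dots> = 0" by (subst taylor_diff[OF S a a]) simp
  finally show "taylor_form a $ i * fderiv (taylor_form a) j k - taylor_form a $ j * fderiv (taylor_form a) i k +
      taylor_form a $ k * fderiv (taylor_form a) i j = 0" ..
qed

section \<open>One-forms on manifolds\<close>

lemma chart_image_open:
  assumes "is_chart M c" "openin M W"
  shows "open (snd c ` (fst c \<inter> W))"
proof -
  obtain U \<psi> where c: "c = (U, \<psi>)" by (cases c)
  have U: "openin M U" "open (\<psi> ` U)"
    and hom: "homeomorphic_map (subtopology M U) (top_of_set (\<psi> ` U)) \<psi>"
    using assms(1) by (auto simp: is_chart_def c)
  have "openin (subtopology M U) (U \<inter> W)"
    using assms(2) by (auto simp: openin_subtopology Int_commute)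
  then have "openin (top_of_set (\<psi> ` U)) (\<psi> ` (U \<inter> W))"
    using homeomorphic_imp_open_map[OF hom] by (simp add: open_map_def)
  then show ?thesis using U(2) by (simp add: c openin_open_eq)
qed

theorem theorem3p4:
  fixes M :: "'m topology"
    and A :: "('m, 'n::finite) chart set"
    and W :: "'m set" and m :: 'm
    and \<omega> :: "('m, 'n) one_form"
    and c :: "('m, 'n) chart"
  assumes "smooth_manifold M A"
    and "openin M W" and "m \<in> W"
    and "smooth_one_form_on A W \<omega>"
    and "integrable_form_on A W \<omega>"
    and "c \<in> A" and "centered_chart c m"
    and "\<omega> c 0 = 0"
    and "linear_part (\<omega> c) \<noteq> 0"
  shows "\<exists>(u :: ('n, real) mfps) (\<phi> :: ('n, real) mfps ^ 2) (\<omega>\<^sub>2 :: (2, real) formal_form).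
    mfps_coeff u {#} \<noteq> 0 \<and> (\<forall>k. mfps_coeff (\<phi> $ k) {#} = 0) \<and>
    u *s taylor_form (\<omega> c) = formal_pullback \<phi> \<omega>\<^sub>2"
proof -
  let ?S = "snd c ` (fst c \<inter> W)"
  have "is_chart M c" using assms(1,6) by (simp add: smooth_manifold_def)
  then have S: "open ?S" using assms(2) by (rule chart_image_open)
  have S0: "0 \<in> ?S" using assms(3,7) by (auto simp: centered_chart_def intro!: image_eqI[of 0 _ m])
  have int: "fintegrable (taylor_form (\<omega> c))"
    using assms(4-6)
    by (intro fintegrable_taylor_form[OF S S0]) (auto simp: smooth_one_form_on_def integrable_form_on_def)
  have zero: "mfps_coeff (taylor_form (\<omega> c) $ k) {#} = 0" for k
    by (simp add: taylor_form_def coeff_taylor_empty assms(8))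
  obtain i \<mu> where "mfps_coeff (linear_part (\<omega> c) $ i) \<mu> \<noteq> 0"
    using assms(9) by (metis coeff_zero mfps_eqI vec_eq_iff zero_index)
  then have "size \<mu> = 1" "mfps_coeff (taylor_form (\<omega> c) $ i) \<mu> \<noteq> 0"
    by (auto simp: linear_part_def mfps_hom_part_def split: if_splits)
  then obtain j where "mfps_coeff (taylor_form (\<omega> c) $ i) {#j#} \<noteq> 0"
    using size_1_singleton_mset by blast
  from formal_pullback_two_variables[OF int zero this] show ?thesis .
qed

end
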